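(* Let $$f(z)=\frac23\left(\mathrm ie^{\mathrm i\pi/6}\frac1{z-1}-\frac12\frac1{z+\frac12}-\mathrm ie^{-\mathrm i\pi/6}\frac1{z+2}\right),\qquad g(z)=-1+\frac1ze^{\mathrm i\pi/3}-\frac1{z+1}e^{-\mathrm i\pi/3},\qquad\overline g(z)=\overline{g(\bar z)}.$$ For $\zeta$ in the upper half plane $\mathbb H$ let $\gamma_\zeta$ be a contour from $\bar\zeta$ to $\zeta$ crossing $\mathbb R$ exactly once, at a point of $(-\infty,-2)$. Then $-\frac12-\frac1{2\pi\mathrm i}\int_{\gamma_\zeta}f(z)\overline g(z)\,dz$ is real valued, and, as $\zeta$ ranges over $\mathbb H$, the map $$\zeta\mapsto\left(e^{-\mathrm i\frac{2\pi}3}-\frac1{2\pi\mathrm i}\int_{\gamma_\zeta}f(z)g(z)\,dz,\ -\frac12-\frac1{2\pi\mathrm i}\int_{\gamma_\zeta}f(z)\overline g(z)\,dz\right)$$ is a conformal parameterization of the surface $S_{\mathrm{Hex}}\subset\mathbb C\times\mathbb R$.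
   Context: $\mathbb R^{2,1}$ denotes $\mathbb C\times\mathbb R$ with the metric $|dz|^2-d\vartheta^2$. $S_{\mathrm{Hex}}$ is the unique space-like surface of zero mean curvature in $\mathbb R^{2,1}$ whose boundary contour is the union of the closed line segments connecting cyclically consecutive points $(-e^{\mathrm ik\pi/3},(-1)^k\frac12)$, $k=1,\dots,6$. Space-like means that the induced metric is Riemannian; a conformal parameterization is a diffeomorphism from $\mathbb H$ onto the surface that is conformal with respect to the standard metric on $\mathbb H$ and the metric induced from $\mathbb R^{2,1}$. *)

theory Defs
  imports "HOL-Complex_Analysis.Complex_Analysis"
begin

text \<open>\<open>k\<close> times continuously differentiable on \<open>A\<close>. Only used for open \<open>A\<close> in
  finite-dimensional spaces, where continuity of all iterated directional derivatives is the usual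
  notion.\<close>

primrec Ck_on :: "nat \<Rightarrow> ('a::real_normed_vector \<Rightarrow> 'b::real_normed_vector) \<Rightarrow> 'a set \<Rightarrow> bool" where
  "Ck_on 0 f A \<longleftrightarrow> continuous_on A f"
| "Ck_on (Suc k) f A \<longleftrightarrow> (\<forall>x\<in>A. f differentiable (at x)) \<and>
     (\<forall>v. Ck_on k (\<lambda>x. frechet_derivative f (at x) v) A)"

definition smooth_on :: "('a::real_normed_vector \<Rightarrow> 'b::real_normed_vector) \<Rightarrow> 'a set \<Rightarrow> bool" where
  "smooth_on f A \<longleftrightarrow> (\<forall>k. Ck_on k f A)"

text \<open>The Lorentzian inner product on \<open>\<complex> \<times> \<real>\<close> with quadratic form \<open>|dz|\<^sup>2 - d\<theta>\<^sup>2\<close>.\<close>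

definition lorentz :: "complex \<times> real \<Rightarrow> complex \<times> real \<Rightarrow> real" where
  "lorentz p q = fst p \<bullet> fst q - snd p * snd q"

text \<open>Parameter domains lie in \<open>\<complex> = \<real>\<^sup>2\<close>; the coordinate directions are \<open>1\<close> and \<open>\<i>\<close>.\<close>

definition dirderiv ::
  "complex \<Rightarrow> (complex \<Rightarrow> complex \<times> real) \<Rightarrow> complex \<Rightarrow> complex \<times> real" where
  "dirderiv v \<phi> x = frechet_derivative \<phi> (at x) v"

definition local_parameterization ::
  "(complex \<times> real) set \<Rightarrow> complex set \<Rightarrow> (complex \<Rightarrow> complex \<times> real) \<Rightarrow> bool" where
  "local_parameterization S W \<phi> \<longleftrightarrow>
     open W \<and> smooth_on \<phi> W \<and> (\<forall>x\<in>W. inj (frechet_derivative \<phi> (at x))) \<and>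
     openin (top_of_set S) (\<phi> ` W) \<and> (\<exists>\<psi>. homeomorphism W (\<phi> ` W) \<phi> \<psi>)"

text \<open>Embedded smooth surfaces, without boundary points.\<close>

definition regular_surface :: "(complex \<times> real) set \<Rightarrow> bool" where
  "regular_surface S \<longleftrightarrow> (\<forall>p\<in>S. \<exists>W \<phi>. local_parameterization S W \<phi> \<and> p \<in> \<phi> ` W)"

definition spacelike_at :: "(complex \<Rightarrow> complex \<times> real) \<Rightarrow> complex \<Rightarrow> bool" where
  "spacelike_at \<phi> x \<longleftrightarrow> (\<forall>v. v \<noteq> 0 \<longrightarrow> lorentz (dirderiv v \<phi> x) (dirderiv v \<phi> x) > 0)"

definition unit_normal ::
  "(complex \<Rightarrow> complex \<times> real) \<Rightarrow> complex \<Rightarrow> complex \<times> real \<Rightarrow> bool" where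
  "unit_normal \<phi> x N \<longleftrightarrow> lorentz N N = -1 \<and> (\<forall>v. lorentz N (dirderiv v \<phi> x) = 0)"

text \<open>Half the trace of the second fundamental form with respect to the first one. The sign depends
  on the choice of one of the two unit normals \<open>N\<close>; the vanishing does not.\<close>

definition mean_curvature ::
  "(complex \<Rightarrow> complex \<times> real) \<Rightarrow> complex \<Rightarrow> complex \<times> real \<Rightarrow> real" where
  "mean_curvature \<phi> x N =
    (let E = lorentz (dirderiv 1 \<phi> x) (dirderiv 1 \<phi> x);
         F = lorentz (dirderiv 1 \<phi> x) (dirderiv \<i> \<phi> x);
         G = lorentz (dirderiv \<i> \<phi> x) (dirderiv \<i> \<phi> x);
         L = lorentz (dirderiv 1 (dirderiv 1 \<phi>) x) N;
         M = lorentz (dirderiv 1 (dirderiv \<i> \<phi>) x) N;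
         P = lorentz (dirderiv \<i> (dirderiv \<i> \<phi>) x) N
     in (L * G - 2 * M * F + P * E) / (2 * (E * G - F\<^sup>2)))"

definition spacelike_surface :: "(complex \<times> real) set \<Rightarrow> bool" where
  "spacelike_surface S \<longleftrightarrow> regular_surface S \<and>
     (\<forall>W \<phi>. local_parameterization S W \<phi> \<longrightarrow> (\<forall>x\<in>W. spacelike_at \<phi> x))"

definition zero_mean_curvature :: "(complex \<times> real) set \<Rightarrow> bool" where
  "zero_mean_curvature S \<longleftrightarrow>
     (\<forall>W \<phi>. local_parameterization S W \<phi> \<longrightarrow>
        (\<forall>x\<in>W. \<forall>N. unit_normal \<phi> x N \<longrightarrow> mean_curvature \<phi> x N = 0))"

text \<open>\<open>S\<close> is a bounded surface that does not contain its boundary, and its boundary is \<open>\<Gamma>\<close>.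
  Boundedness makes \<open>S \<union> \<Gamma>\<close> compact; it rules out unbounded surfaces outside the contour.\<close>

definition has_boundary_contour :: "(complex \<times> real) set \<Rightarrow> (complex \<times> real) set \<Rightarrow> bool" where
  "has_boundary_contour S \<Gamma> \<longleftrightarrow> bounded S \<and> connected S \<and> closure S - S = \<Gamma>"

definition hex_vertex :: "nat \<Rightarrow> complex \<times> real" where
  "hex_vertex k = (- exp (\<i> * of_nat k * of_real pi / 3), (-1) ^ k * (1 / 2))"

text \<open>Since \<open>hex_vertex 7 = hex_vertex 1\<close>, the segment for \<open>k = 6\<close> closes the contour.\<close>

definition hex_contour :: "(complex \<times> real) set" where
  "hex_contour = (\<Union>k\<in>{1..6}. closed_segment (hex_vertex k) (hex_vertex (k + 1)))"

definition S_Hex :: "(complex \<times> real) set" where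
  "S_Hex = (THE S. spacelike_surface S \<and> zero_mean_curvature S \<and>
                   has_boundary_contour S hex_contour)"

definition upper_half_plane :: "complex set" where
  "upper_half_plane = {\<zeta>. Im \<zeta> > 0}"

text \<open>A map from a subset of a Euclidean space is smooth if it extends smoothly to a neighbourhood of
  each point; this is the sense in which the inverse of \<open>\<Phi>\<close> is smooth on \<open>S\<close>.\<close>

definition diffeomorphism_onto ::
  "complex set \<Rightarrow> (complex \<times> real) set \<Rightarrow> (complex \<Rightarrow> complex \<times> real) \<Rightarrow> bool" where
  "diffeomorphism_onto D S \<Phi> \<longleftrightarrow>
     smooth_on \<Phi> D \<and> bij_betw \<Phi> D S \<and>
     (\<forall>p\<in>S. \<exists>U \<Psi>. open U \<and> p \<in> U \<and> smooth_on \<Psi> U \<and> (\<forall>q\<in>S \<inter> U. \<Psi> q = inv_into D \<Phi> q))"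

definition conformal_parameterization ::
  "(complex \<times> real) set \<Rightarrow> (complex \<Rightarrow> complex \<times> real) \<Rightarrow> bool" where
  "conformal_parameterization S \<Phi> \<longleftrightarrow>
     diffeomorphism_onto upper_half_plane S \<Phi> \<and>
     (\<forall>\<zeta>\<in>upper_half_plane. \<exists>c>0. \<forall>v w.
        lorentz (dirderiv v \<Phi> \<zeta>) (dirderiv w \<Phi> \<zeta>) = c * (v \<bullet> w))"

definition f_Hex :: "complex \<Rightarrow> complex" where
  "f_Hex z = 2 / 3 * (\<i> * exp (\<i> * of_real pi / 6) * (1 / (z - 1))
                     - 1 / 2 * (1 / (z + 1 / 2))
                     - \<i> * exp (- \<i> * of_real pi / 6) * (1 / (z + 2)))"

definition g_Hex :: "complex \<Rightarrow> complex" where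
  "g_Hex z = - 1 + 1 / z * exp (\<i> * of_real pi / 3) - 1 / (z + 1) * exp (- \<i> * of_real pi / 3)"

definition g_Hex_bar :: "complex \<Rightarrow> complex" where
  "g_Hex_bar z = cnj (g_Hex (cnj z))"

definition admissible_contour :: "complex \<Rightarrow> (real \<Rightarrow> complex) \<Rightarrow> bool" where
  "admissible_contour \<zeta> \<gamma> \<longleftrightarrow>
     valid_path \<gamma> \<and> pathstart \<gamma> = cnj \<zeta> \<and> pathfinish \<gamma> = \<zeta> \<and>
     (\<exists>!t. t \<in> {0..1} \<and> \<gamma> t \<in> \<real>) \<and>
     (\<forall>t\<in>{0..1}. \<gamma> t \<in> \<real> \<longrightarrow> Re (\<gamma> t) < -2)"

definition z_Hex :: "(real \<Rightarrow> complex) \<Rightarrow> complex" where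
  "z_Hex \<gamma> = exp (- \<i> * (2 * of_real pi / 3))
     - 1 / (2 * of_real pi * \<i>) * contour_integral \<gamma> (\<lambda>z. f_Hex z * g_Hex z)"

definition theta_Hex :: "(real \<Rightarrow> complex) \<Rightarrow> complex" where
  "theta_Hex \<gamma> = - 1 / 2
     - 1 / (2 * of_real pi * \<i>) * contour_integral \<gamma> (\<lambda>z. f_Hex z * g_Hex_bar z)"

end

theory Submission
  imports Defs
begin

text \<open>Both integrands are sums of simple fractions with poles \<open>-2, -1, -1/2, 0, 1\<close>, so the two
  integrals between conjugate points are sums of arguments of \<open>\<zeta> - p\<close>, weighted with the residues. The
  residues are the differences of consecutive vertices of the contour. Hence the map is the harmonic
  extension to the upper half plane of the step function on the real line that takes the six vertices as
  its values (\<open>contour_integrals_eq_ext\<close>); in particular it is real in the last coordinate. It is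
  conformal because \<open>f\<close> and \<open>g\<close> have the same double zero: with
  \<open>s = exp (i \<pi> / 3)\<close> the functions \<open>f g\<close>, its conjugate function and \<open>f\<close> times the conjugate of \<open>g\<close> are
  \<open>(z + 1 - s)\<^sup>4\<close>, \<open>(z + s)\<^sup>4\<close> and \<open>(z + 1 - s)\<^sup>2 (z + s)\<^sup>2\<close> over the same denominator
  (\<open>hex_conformal\<close>).

  The horizontal part of the map is a local diffeomorphism, since the metric is positive. As a convex
  combination of the vertices it stays in the open hexagon, and near a boundary point it approaches a vertex
  or an edge of the contour. So it is a proper map to the simply connected hexagon, therefore a covering
  and a bijection (\<open>bij_betw_hex_chart\<close>), and the image is the graph of a smooth function \<open>u\<close>.
  Conformal harmonic coordinates turn into the equation of zero mean curvature for \<open>u\<close>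
  (\<open>conformal_harmonic_graph_operator\<close>), and this equation implies that the mean curvature vanishes in every
  parameterization of the graph (\<open>zero_mean_curvature_graph\<close>).

  It remains to show that no other surface qualifies as \<open>S_Hex\<close>
  (\<open>spacelike_zero_mean_curvature_unique\<close>). A competitor projects to an open set, hence into the hexagon,
  and the height over the graph of \<open>u\<close> is a continuous function on its compact closure that vanishes on the
  contour. The maximum principle shows that it vanishes (\<open>height_nonpos_comparison\<close>). Only the local
  structure of the competitor enters, so it need not be known in advance to be a graph. It is therefore an open
  and closed part of the connected graph.\<close>

section \<open>Calculus of \<open>k\<close> times differentiable maps\<close>

lemma Ck_on_cong:
  assumes "open A" "\<And>x. x \<in> A \<Longrightarrow> f x = g x" "Ck_on k f A"
  shows "Ck_on k g A"
  using assms(2,3)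
proof (induction k arbitrary: f g)
  case 0
  then show ?case by (metis Ck_on.simps(1) continuous_on_cong)
next
  case (Suc k)
  have der: "(g has_derivative frechet_derivative f (at x)) (at x)" if "x \<in> A" for x
    using Suc.prems that assms(1)
    by (metis Ck_on.simps(2) frechet_derivative_works has_derivative_transform_within_open)
  then have eq: "frechet_derivative g (at x) = frechet_derivative f (at x)" if "x \<in> A" for x
    using that by (metis frechet_derivative_at)
  show ?case
    unfolding Ck_on.simps
  proof (intro conjI ballI allI)
    show "g differentiable at x" if "x \<in> A" for x
      using der[OF that] by (auto simp: differentiable_def)
    show "Ck_on k (\<lambda>x. frechet_derivative g (at x) v) A" for v
      by (rule Suc.IH[of "\<lambda>x. frechet_derivative f (at x) v"]) (use eq Suc.prems in auto)
  qed
qed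

lemma Ck_on_SucI:
  assumes "open A" "\<And>x. x \<in> A \<Longrightarrow> (f has_derivative f' x) (at x)"
    and "\<And>v. Ck_on k (\<lambda>x. f' x v) A"
  shows "Ck_on (Suc k) f A"
proof -
  have "Ck_on k (\<lambda>x. frechet_derivative f (at x) v) A" for v
    by (rule Ck_on_cong[OF assms(1) _ assms(3)[of v]]) (metis assms(2) frechet_derivative_at)
  then show ?thesis
    using assms(2) by (auto simp: differentiable_def)
qed

lemma Ck_on_SucD:
  assumes "Ck_on (Suc k) f A"
  shows "x \<in> A \<Longrightarrow> (f has_derivative frechet_derivative f (at x)) (at x)"
    and "Ck_on k (\<lambda>x. frechet_derivative f (at x) v) A"
  using assms frechet_derivative_works by auto

lemma Ck_on_Suc_imp: "Ck_on (Suc k) f A \<Longrightarrow> Ck_on k f A"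
proof (induction k arbitrary: f)
  case 0
  then show ?case
    by (auto intro!: continuous_at_imp_continuous_on differentiable_imp_continuous_within)
next
  case (Suc k)
  then show ?case by (metis Ck_on.simps(2))
qed

declare Ck_on.simps(2) [simp del]

lemma Ck_on_const: "Ck_on k (\<lambda>x. c) A"
  by (induction k arbitrary: c) (auto simp: Ck_on.simps(2))

lemma Ck_on_bounded_linear:
  assumes "bounded_linear L" "open A" "Ck_on k f A"
  shows "Ck_on k (\<lambda>x. L (f x)) A"
  using assms(3)
proof (induction k arbitrary: f)
  case 0
  then show ?case
    using assms(1) by (auto intro: bounded_linear.continuous_on)
next
  case (Suc k)
  show ?case
    by (rule Ck_on_SucI[OF assms(2), where f' = "\<lambda>x v. L (frechet_derivative f (at x) v)"])
       (use Ck_on_SucD[OF Suc.prems] Suc.IH in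
         \<open>auto intro: bounded_linear.has_derivative[OF assms(1)]\<close>)
qed

lemma Ck_on_linear_self:
  assumes "bounded_linear L" "open A"
  shows "Ck_on k L A"
proof (cases k)
  case 0
  then show ?thesis using linear_continuous_on[OF assms(1)] by simp
next
  case (Suc m)
  have "(L has_derivative L) (at x)" for x
    using bounded_linear_imp_has_derivative[OF assms(1)] .
  then show ?thesis
    unfolding Suc by (intro Ck_on_SucI[OF assms(2), where f' = "\<lambda>x. L"] Ck_on_const)
qed

lemma Ck_on_add:
  assumes "open A" "Ck_on k f A" "Ck_on k g A"
  shows "Ck_on k (\<lambda>x. f x + g x) A"
  using assms(2,3)
proof (induction k arbitrary: f g)
  case 0
  then show ?case by (auto intro: continuous_intros)
next
  case (Suc k)
  show ?case
    by (rule Ck_on_SucI[OF assms(1),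
          where f' = "\<lambda>x v. frechet_derivative f (at x) v + frechet_derivative g (at x) v"])
       (use Ck_on_SucD[OF Suc.prems(1)] Ck_on_SucD[OF Suc.prems(2)] Suc.IH in
         \<open>auto intro: has_derivative_add\<close>)
qed

lemma Ck_on_sum:
  assumes "open A" "finite I" "\<And>i. i \<in> I \<Longrightarrow> Ck_on k (f i) A"
  shows "Ck_on k (\<lambda>x. \<Sum>i\<in>I. f i x) A"
  using assms(2,3) by (induction I rule: finite_induct) (auto intro: Ck_on_const Ck_on_add assms(1))

lemma Ck_on_bilinear:
  assumes "bounded_bilinear B" "open A" "Ck_on k f A" "Ck_on k g A"
  shows "Ck_on k (\<lambda>x. B (f x) (g x)) A"
  using assms(3,4)
proof (induction k arbitrary: f g)
  case 0
  then show ?case by (auto intro: bounded_bilinear.continuous_on[OF assms(1)])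
next
  case (Suc k)
  show ?case
  proof (rule Ck_on_SucI[OF assms(2)])
    show "((\<lambda>x. B (f x) (g x)) has_derivative
        (\<lambda>v. B (f x) (frechet_derivative g (at x) v) + B (frechet_derivative f (at x) v) (g x))) (at x)"
      if "x \<in> A" for x
      by (rule bounded_bilinear.FDERIV[OF assms(1)])
         (rule Ck_on_SucD(1)[OF Suc.prems(1) that] Ck_on_SucD(1)[OF Suc.prems(2) that])+
    show "Ck_on k (\<lambda>x. B (f x) (frechet_derivative g (at x) v) +
                       B (frechet_derivative f (at x) v) (g x)) A" for v
      by (intro Ck_on_add Suc.IH assms(2) Ck_on_Suc_imp[OF Suc.prems(1)]
          Ck_on_Suc_imp[OF Suc.prems(2)] Ck_on_SucD(2) Suc.prems)
  qed
qed

text \<open>The chain rule expresses the derivative of a composition through the partial derivatives of the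
  outer map, composed with the inner one; these have one order of smoothness less, so that the
  induction hypothesis applies to them.\<close>

lemma Ck_on_compose:
  fixes g :: "'a::real_normed_vector \<Rightarrow> 'b::euclidean_space"
    and f :: "'b \<Rightarrow> 'c::real_normed_vector"
  assumes "open A" "open B" "Ck_on k g A" "Ck_on k f B" "g ` A \<subseteq> B"
  shows "Ck_on k (\<lambda>x. f (g x)) A"
  using assms(3,4)
proof (induction k arbitrary: f)
  case 0
  then show ?case
    using assms(5) by (auto intro: continuous_on_compose2)
next
  case (Suc k)
  have gB: "g x \<in> B" if "x \<in> A" for x using assms(5) that by auto
  let ?D = "\<lambda>x v. \<Sum>e\<in>Basis. (frechet_derivative g (at x) v \<bullet> e) *\<^sub>R frechet_derivative f (at (g x)) e"
  show ?case
  proof (rule Ck_on_SucI[OF assms(1)])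
    fix x assume x: "x \<in> A"
    have df: "(f has_derivative frechet_derivative f (at (g x))) (at (g x))"
      using Ck_on_SucD(1)[OF Suc.prems(2) gB[OF x]] .
    have comp: "((\<lambda>x. f (g x)) has_derivative
            (\<lambda>v. frechet_derivative f (at (g x)) (frechet_derivative g (at x) v))) (at x)"
      using has_derivative_compose[OF Ck_on_SucD(1)[OF Suc.prems(1) x] df] .
    have rep: "frechet_derivative f (at (g x)) w
        = (\<Sum>e\<in>Basis. (w \<bullet> e) *\<^sub>R frechet_derivative f (at (g x)) e)" for w
    proof -
      have lin: "linear (frechet_derivative f (at (g x)))"
        using df has_derivative_linear by blast
      have "frechet_derivative f (at (g x)) w
          = frechet_derivative f (at (g x)) (\<Sum>e\<in>Basis. (w \<bullet> e) *\<^sub>R e)"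
        by (simp only: euclidean_representation)
      then show ?thesis
        by (simp add: linear_sum[OF lin] linear_cmul[OF lin])
    qed
    show "((\<lambda>x. f (g x)) has_derivative ?D x) (at x)"
      by (rule has_derivative_eq_rhs[OF comp]) (rule ext, rule rep)
  next
    fix v
    show "Ck_on k (\<lambda>x. ?D x v) A"
    proof (rule Ck_on_sum[OF assms(1) finite_Basis])
      fix e :: 'b
      have "Ck_on k (\<lambda>x. frechet_derivative g (at x) v \<bullet> e) A"
        by (rule Ck_on_bounded_linear[OF bounded_linear_inner_left assms(1) Ck_on_SucD(2)[OF Suc.prems(1)]])
      moreover have "Ck_on k (\<lambda>x. frechet_derivative f (at (g x)) e) A"
        by (rule Suc.IH[OF Ck_on_Suc_imp[OF Suc.prems(1)] Ck_on_SucD(2)[OF Suc.prems(2)]])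
      ultimately show "Ck_on k (\<lambda>x. (frechet_derivative g (at x) v \<bullet> e) *\<^sub>R
                                      frechet_derivative f (at (g x)) e) A"
        by (rule Ck_on_bilinear[OF bounded_bilinear_scaleR assms(1)])
    qed
  qed
qed

lemma Ck_on_inverse_real: "Ck_on k (inverse :: real \<Rightarrow> real) (- {0})"
proof (induction k)
  case 0
  then show ?case by (auto intro!: continuous_intros)
next
  case (Suc k)
  show ?case
  proof (rule Ck_on_SucI)
    show "(inverse has_derivative (\<lambda>v. - (inverse x * v * inverse x))) (at x)"
      if "x \<in> - {0}" for x :: real
      using that by (auto intro: has_derivative_inverse')
    show "Ck_on k (\<lambda>x::real. - (inverse x * v * inverse x)) (- {0})" for v
      by (intro Ck_on_bounded_linear[OF bounded_linear_minus[OF bounded_linear_ident]]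
          Ck_on_bilinear[OF bounded_bilinear_mult] Ck_on_const Suc) auto
  qed auto
qed

lemma Ck_on_divide_real:
  fixes f g :: "'a::real_normed_vector \<Rightarrow> real"
  assumes "open A" "Ck_on k f A" "Ck_on k g A" "\<And>x. x \<in> A \<Longrightarrow> g x \<noteq> 0"
  shows "Ck_on k (\<lambda>x. f x / g x) A"
proof -
  have "Ck_on k (\<lambda>x. inverse (g x)) A"
    by (rule Ck_on_compose[OF assms(1) _ assms(3) Ck_on_inverse_real]) (use assms(4) in auto)
  from Ck_on_bilinear[OF bounded_bilinear_mult assms(1,2) this]
  show ?thesis by (simp only: divide_inverse)
qed

lemma Ck_on_holomorphic:
  assumes "open A" "F holomorphic_on A"
  shows "Ck_on k F A"
  using assms(2)
proof (induction k arbitrary: F)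
  case 0
  then show ?case by (simp add: holomorphic_on_imp_continuous_on)
next
  case (Suc k)
  show ?case
  proof (rule Ck_on_SucI[OF assms(1)])
    show "(F has_derivative (\<lambda>v. deriv F x * v)) (at x)" if "x \<in> A" for x
      using holomorphic_derivI[OF Suc.prems assms(1) that] by (simp add: has_field_derivative_def)
    show "Ck_on k (\<lambda>x. deriv F x * v) A" for v
      using Suc.prems assms(1) by (intro Suc.IH holomorphic_intros)
  qed
qed

lemma smooth_on_cong:
  "open A \<Longrightarrow> (\<And>x. x \<in> A \<Longrightarrow> f x = g x) \<Longrightarrow> smooth_on f A \<Longrightarrow> smooth_on g A"
  unfolding smooth_on_def by (metis Ck_on_cong)

lemma smooth_on_compose:
  fixes g :: "'a::real_normed_vector \<Rightarrow> 'b::euclidean_space"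
  assumes "open A" "open B" "smooth_on g A" "smooth_on f B" "g ` A \<subseteq> B"
  shows "smooth_on (\<lambda>x. f (g x)) A"
  unfolding smooth_on_def
proof
  show "Ck_on k (\<lambda>x. f (g x)) A" for k
    by (rule Ck_on_compose[OF assms(1,2) _ _ assms(5)]) (use assms(3,4) in \<open>auto simp: smooth_on_def\<close>)
qed

section \<open>Mixed partial derivatives and smooth inverses\<close>

lemma has_real_derivative_along:
  fixes f :: "'a::real_normed_vector \<Rightarrow> real"
  assumes "(f has_derivative f') (at (c + s *\<^sub>R v))"
  shows "((\<lambda>s. f (c + s *\<^sub>R v)) has_real_derivative f' v) (at s)"
proof -
  have "((\<lambda>s. c + s *\<^sub>R v) has_derivative (\<lambda>h. h *\<^sub>R v)) (at s)"
    by (auto intro!: derivative_eq_intros)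
  from has_derivative_compose[OF this assms]
  have "((\<lambda>s. f (c + s *\<^sub>R v)) has_derivative (\<lambda>h. f' (h *\<^sub>R v))) (at s)" .
  moreover have "f' (h *\<^sub>R v) = f' v * h" for h
    using linear_cmul[OF has_derivative_linear[OF assms]] by simp
  ultimately show ?thesis by (simp add: has_field_derivative_def)
qed

text \<open>The mean value theorem is applied first along \<open>v\<close> and then along \<open>w\<close>.\<close>

lemma second_difference_mean_value:
  fixes f :: "'a::real_normed_vector \<Rightarrow> real"
  assumes C2: "Ck_on (Suc (Suc 0)) f A" and t: "t > 0"
    and sub: "\<And>s r. s \<in> {0..t} \<Longrightarrow> r \<in> {0..t} \<Longrightarrow> x + s *\<^sub>R v + r *\<^sub>R w \<in> A"
  obtains s r where "s \<in> {0..t}" "r \<in> {0..t}"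
    "f (x + t *\<^sub>R v + t *\<^sub>R w) - f (x + t *\<^sub>R v) - f (x + t *\<^sub>R w) + f x =
      t * t * frechet_derivative (\<lambda>y. frechet_derivative f (at y) v) (at (x + s *\<^sub>R v + r *\<^sub>R w)) w"
proof -
  note D1 = Ck_on_SucD(1)[OF C2] and D2 = Ck_on_SucD(1)[OF Ck_on_SucD(2)[OF C2]]
  define G where "G s = f (x + t *\<^sub>R w + s *\<^sub>R v) - f (x + s *\<^sub>R v)" for s
  have "\<exists>z. 0 < z \<and> z < t \<and> G t - G 0 = (t - 0) *
     (frechet_derivative f (at (x + t *\<^sub>R w + z *\<^sub>R v)) v - frechet_derivative f (at (x + z *\<^sub>R v)) v)"
  proof (rule MVT2[OF t])
    fix s assume s: "0 \<le> s" "s \<le> t"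
    show "(G has_real_derivative (frechet_derivative f (at (x + t *\<^sub>R w + s *\<^sub>R v)) v -
            frechet_derivative f (at (x + s *\<^sub>R v)) v)) (at s)"
      unfolding G_def
      by (intro DERIV_diff has_real_derivative_along D1)
         (use sub[of s t] sub[of s 0] s t in \<open>auto simp: algebra_simps\<close>)
  qed
  then obtain s where s: "0 < s" "s < t" and Gs: "G t - G 0 = t *
     (frechet_derivative f (at (x + t *\<^sub>R w + s *\<^sub>R v)) v - frechet_derivative f (at (x + s *\<^sub>R v)) v)"
    by auto
  let ?K = "\<lambda>r. frechet_derivative f (at (x + s *\<^sub>R v + r *\<^sub>R w)) v"
  have "\<exists>z. 0 < z \<and> z < t \<and> ?K t - ?K 0 = (t - 0) *
     frechet_derivative (\<lambda>y. frechet_derivative f (at y) v) (at (x + s *\<^sub>R v + z *\<^sub>R w)) w"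
    by (rule MVT2[OF t], rule has_real_derivative_along, rule D2, rule sub) (use s in auto)
  then obtain r where r: "0 < r" "r < t" and Kr: "?K t - ?K 0 = t *
     frechet_derivative (\<lambda>y. frechet_derivative f (at y) v) (at (x + s *\<^sub>R v + r *\<^sub>R w)) w"
    by auto
  show ?thesis
  proof (rule that)
    show "s \<in> {0..t}" "r \<in> {0..t}" using s r by auto
    have "f (x + t *\<^sub>R v + t *\<^sub>R w) - f (x + t *\<^sub>R v) - f (x + t *\<^sub>R w) + f x = G t - G 0"
      by (simp add: G_def algebra_simps)
    also have "\<dots> = t * (?K t - ?K 0)"
      unfolding Gs by (simp add: algebra_simps)
    finally show "f (x + t *\<^sub>R v + t *\<^sub>R w) - f (x + t *\<^sub>R v) - f (x + t *\<^sub>R w) + f x =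
      t * t * frechet_derivative (\<lambda>y. frechet_derivative f (at y) v) (at (x + s *\<^sub>R v + r *\<^sub>R w)) w"
      unfolding Kr by simp
  qed
qed

text \<open>Both mixed derivatives are limits of the same second difference quotient, which the mean value
  theorem evaluates in two orders.\<close>

lemma mixed_partials_real:
  fixes f :: "'a::real_normed_vector \<Rightarrow> real"
  assumes "open A" "x \<in> A" and C2: "Ck_on (Suc (Suc 0)) f A"
  shows "frechet_derivative (\<lambda>y. frechet_derivative f (at y) v) (at x) w =
         frechet_derivative (\<lambda>y. frechet_derivative f (at y) w) (at x) v"
proof -
  let ?P = "\<lambda>y. frechet_derivative (\<lambda>y. frechet_derivative f (at y) v) (at y) w"
  let ?Q = "\<lambda>y. frechet_derivative (\<lambda>y. frechet_derivative f (at y) w) (at y) v"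
  have "continuous_on A ?P" "continuous_on A ?Q"
    using Ck_on_SucD(2)[OF Ck_on_SucD(2)[OF C2]] by simp_all
  then have cont: "isCont ?P x" "isCont ?Q x"
    using continuous_on_eq_continuous_at[OF assms(1)] assms(2) by auto
  have small: "\<bar>?P x - ?Q x\<bar> < e" if e: "e > 0" for e
  proof -
    obtain d1 where d1: "d1 > 0" "\<And>y. dist y x < d1 \<Longrightarrow> dist (?P y) (?P x) < e / 2"
      using cont(1)[unfolded continuous_at_eps_delta, rule_format, OF half_gt_zero[OF e]] by blast
    obtain d2 where d2: "d2 > 0" "\<And>y. dist y x < d2 \<Longrightarrow> dist (?Q y) (?Q x) < e / 2"
      using cont(2)[unfolded continuous_at_eps_delta, rule_format, OF half_gt_zero[OF e]] by blast
    obtain d3 where d3: "d3 > 0" "ball x d3 \<subseteq> A"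
      using openE[OF assms(1,2)] by auto
    define d where "d = min d1 (min d2 d3)"
    define N where "N = norm v + norm w + 1"
    have N: "N > 0" unfolding N_def by (simp add: add_nonneg_pos)
    define t where "t = d / (2 * N)"
    have d: "d > 0" using d1 d2 d3 by (simp add: d_def)
    have t: "t > 0" unfolding t_def using d N by simp
    have near: "dist (x + s *\<^sub>R a + r *\<^sub>R b) x < d"
      if "s \<in> {0..t}" "r \<in> {0..t}" "norm a + norm b = norm v + norm w" for s r a b
    proof -
      have "dist (x + s *\<^sub>R a + r *\<^sub>R b) x = norm (s *\<^sub>R a + r *\<^sub>R b)"
        by (simp add: dist_norm algebra_simps)
      also have "\<dots> \<le> s * norm a + r * norm b"
        using norm_triangle_ineq[of "s *\<^sub>R a" "r *\<^sub>R b"] that by simp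
      also have "\<dots> \<le> t * norm a + t * norm b"
        using that by (intro add_mono mult_right_mono) auto
      also have "\<dots> = t * (norm v + norm w)" using that by (simp add: algebra_simps flip: that(3))
      also have "\<dots> \<le> t * N" using t by (simp add: N_def)
      also have "\<dots> = d / 2" unfolding t_def using N by simp
      also have "\<dots> < d" using d by simp
      finally show ?thesis .
    qed
    have inA: "y \<in> A" if "dist y x < d" for y
      using that d3 by (auto simp: d_def dist_commute)
    obtain s r where sr: "s \<in> {0..t}" "r \<in> {0..t}"
      "f (x + t *\<^sub>R v + t *\<^sub>R w) - f (x + t *\<^sub>R v) - f (x + t *\<^sub>R w) + f x =
      t * t * ?P (x + s *\<^sub>R v + r *\<^sub>R w)"
      by (rule second_difference_mean_value[OF C2 t, of x v w]) (use near inA in auto)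
    obtain s' r' where sr': "s' \<in> {0..t}" "r' \<in> {0..t}"
      "f (x + t *\<^sub>R w + t *\<^sub>R v) - f (x + t *\<^sub>R w) - f (x + t *\<^sub>R v) + f x =
      t * t * ?Q (x + s' *\<^sub>R w + r' *\<^sub>R v)"
      by (rule second_difference_mean_value[OF C2 t, of x w v]) (use near inA in auto)
    have "t * t * ?P (x + s *\<^sub>R v + r *\<^sub>R w) = t * t * ?Q (x + s' *\<^sub>R w + r' *\<^sub>R v)"
      using sr(3) sr'(3) by (simp add: algebra_simps)
    then have "?P (x + s *\<^sub>R v + r *\<^sub>R w) = ?Q (x + s' *\<^sub>R w + r' *\<^sub>R v)"
      using t by simp
    moreover have "dist (?P (x + s *\<^sub>R v + r *\<^sub>R w)) (?P x) < e / 2"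
      using near[OF sr(1,2), of v w] by (intro d1) (auto simp: d_def)
    moreover have "dist (?Q (x + s' *\<^sub>R w + r' *\<^sub>R v)) (?Q x) < e / 2"
      using near[OF sr'(1,2), of w v] by (intro d2) (auto simp: d_def)
    ultimately show ?thesis unfolding dist_real_def by linarith
  qed
  show ?thesis
  proof (rule ccontr)
    assume "?P x \<noteq> ?Q x"
    then show False using small[of "\<bar>?P x - ?Q x\<bar>"] by simp
  qed
qed

lemma mixed_partials:
  fixes f :: "'a::real_normed_vector \<Rightarrow> 'b::real_inner"
  assumes "open A" "x \<in> A" and C2: "Ck_on (Suc (Suc 0)) f A"
  shows "frechet_derivative (\<lambda>y. frechet_derivative f (at y) v) (at x) w =
         frechet_derivative (\<lambda>y. frechet_derivative f (at y) w) (at x) v"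
proof (rule vector_eq_rdot[THEN iffD1], rule allI)
  fix b :: 'b
  have first: "frechet_derivative (\<lambda>y. f y \<bullet> b) (at y) u = frechet_derivative f (at y) u \<bullet> b"
    if "y \<in> A" for y u
    using frechet_derivative_at[OF has_derivative_inner_left[OF Ck_on_SucD(1)[OF C2 that], of b], symmetric]
    by simp
  have second: "frechet_derivative (\<lambda>y. frechet_derivative (\<lambda>y. f y \<bullet> b) (at y) u) (at x) u' =
      frechet_derivative (\<lambda>y. frechet_derivative f (at y) u) (at x) u' \<bullet> b" for u u'
  proof -
    have "((\<lambda>y. frechet_derivative f (at y) u \<bullet> b) has_derivative
        (\<lambda>u'. frechet_derivative (\<lambda>y. frechet_derivative f (at y) u) (at x) u' \<bullet> b)) (at x)"
      by (rule has_derivative_inner_left[OF Ck_on_SucD(1)[OF Ck_on_SucD(2)[OF C2] assms(2)]])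
    then have "((\<lambda>y. frechet_derivative (\<lambda>y. f y \<bullet> b) (at y) u) has_derivative
        (\<lambda>u'. frechet_derivative (\<lambda>y. frechet_derivative f (at y) u) (at x) u' \<bullet> b)) (at x)"
      by (rule has_derivative_transform_within_open[OF _ assms(1,2)]) (simp add: first)
    from frechet_derivative_at[OF this, symmetric] show ?thesis by simp
  qed
  have "Ck_on (Suc (Suc 0)) (\<lambda>y. f y \<bullet> b) A"
    by (rule Ck_on_bounded_linear[OF bounded_linear_inner_left assms(1) C2])
  from mixed_partials_real[OF assms(1,2) this, of v w]
  show "frechet_derivative (\<lambda>y. frechet_derivative f (at y) v) (at x) w \<bullet> b =
         frechet_derivative (\<lambda>y. frechet_derivative f (at y) w) (at x) v \<bullet> b"
    unfolding second .
qed

lemma frechet_derivative_complex_expand: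
  fixes f :: "complex \<Rightarrow> 'b::real_normed_vector"
  assumes "f differentiable (at x)"
  shows "frechet_derivative f (at x) v =
    Re v *\<^sub>R frechet_derivative f (at x) 1 + Im v *\<^sub>R frechet_derivative f (at x) \<i>"
proof -
  have lin: "linear (frechet_derivative f (at x))"
    using assms by (rule linear_frechet_derivative)
  have "v = Re v *\<^sub>R 1 + Im v *\<^sub>R \<i>" by (simp add: complex_eq_iff)
  then have "frechet_derivative f (at x) v = frechet_derivative f (at x) (Re v *\<^sub>R 1 + Im v *\<^sub>R \<i>)"
    by simp
  then show ?thesis by (simp only: linear_add[OF lin] linear_cmul[OF lin])
qed

text \<open>The derivative of the inverse solves a \<open>2 \<times> 2\<close> linear system, which Cramer's rule does with
  coefficients that are smooth functions composed with the inverse. Hence the inverse is one order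
  smoother than what is already known about it.\<close>

lemma smooth_on_inverse_plane:
  fixes f g :: "complex \<Rightarrow> complex"
  assumes A: "open A" and f: "smooth_on f A"
    and inj: "\<And>x. x \<in> A \<Longrightarrow> inj (frechet_derivative f (at x))"
    and gf: "\<And>x. x \<in> A \<Longrightarrow> g (f x) = x"
  shows "open (f ` A)" and "smooth_on g (f ` A)"
proof -
  have f1: "Ck_on (Suc k) f A" for k using f by (simp only: smooth_on_def)
  note Df = Ck_on_SucD(1)[OF f1[of 0]]
  have contf: "continuous_on A f" using f1[of 0, THEN Ck_on_Suc_imp] by simp
  have injf: "inj_on f A" using gf by (rule inj_on_inverseI)
  show B: "open (f ` A)" by (rule invariance_of_domain[OF contf A injf])
  obtain g' where g': "homeomorphism A (f ` A) f g'"
    using invariance_of_domain_homeomorphism[OF A contf _ injf] by auto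
  have contg: "continuous_on (f ` A) g"
  proof -
    have "g y = g' y" if "y \<in> f ` A" for y using g' that gf by (auto simp: homeomorphism_def)
    then show ?thesis using g' by (simp add: homeomorphism_def cong: continuous_on_cong)
  qed
  define a b where "a x = frechet_derivative f (at x) 1" and "b x = frechet_derivative f (at x) \<i>" for x
  define det where "det x = Re (a x) * Im (b x) - Im (a x) * Re (b x)" for x
  define G where "G w x = ((Re w * Im (b x) - Im w * Re (b x)) / det x) *\<^sub>R 1
      + ((Re (a x) * Im w - Im (a x) * Re w) / det x) *\<^sub>R \<i>" for w x
  have expand: "frechet_derivative f (at x) v = Re v *\<^sub>R a x + Im v *\<^sub>R b x" if "x \<in> A" for x v
    unfolding a_def b_def
    by (rule frechet_derivative_complex_expand) (use Df[OF that] in \<open>auto simp: differentiable_def\<close>)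
  have det: "det x \<noteq> 0" if "x \<in> A" for x
  proof
    assume d: "det x = 0"
    have "v = 0" if "Re v *\<^sub>R a x + Im v *\<^sub>R b x = 0" for v
    proof -
      have "frechet_derivative f (at x) v = frechet_derivative f (at x) 0"
        using expand[OF \<open>x \<in> A\<close>] that by simp
      then show ?thesis using inj[OF \<open>x \<in> A\<close>] by (simp add: inj_eq)
    qed
    from this[of "Complex (Im (b x)) (- Im (a x))"] this[of "Complex (Re (b x)) (- Re (a x))"]
    have "Im (b x) = 0" "Im (a x) = 0" "Re (b x) = 0" "Re (a x) = 0"
      using d by (auto simp: complex_eq_iff det_def algebra_simps)
    then have "frechet_derivative f (at x) 1 = frechet_derivative f (at x) 0"
      using expand[OF that, of 1] expand[OF that, of 0] by (simp add: complex_eq_iff)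
    then show False using inj[OF that] by (simp add: inj_eq)
  qed
  have Dg: "(g has_derivative (\<lambda>w. G w (g y))) (at y)" if "y \<in> f ` A" for y
  proof (rule has_derivative_inverse_basic[OF _ _ _ _ B that])
    have gy: "g y \<in> A" using that gf by auto
    show "(f has_derivative frechet_derivative f (at (g y))) (at (g y))" using Df[OF gy] .
    have "linear (\<lambda>w. G w (g y))"
      by (rule linearI) (simp_all add: G_def complex_eq_iff algebra_simps add_divide_distrib diff_divide_distrib)
    then show "bounded_linear (\<lambda>w. G w (g y))" by (simp only: linear_conv_bounded_linear)
    show "(\<lambda>w. G w (g y)) \<circ> frechet_derivative f (at (g y)) = id"
    proof
      fix v
      have "G (Re v *\<^sub>R a (g y) + Im v *\<^sub>R b (g y)) (g y) = v"
        using det[OF gy] by (simp add: G_def complex_eq_iff divide_simps) (simp add: det_def algebra_simps)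
      then show "((\<lambda>w. G w (g y)) \<circ> frechet_derivative f (at (g y))) v = id v"
        by (simp add: expand[OF gy])
    qed
    show "continuous (at y) g" using contg that unfolding continuous_on_eq_continuous_at[OF B] by blast
    show "\<And>z. z \<in> f ` A \<Longrightarrow> f (g z) = z" using gf by auto
  qed
  have re: "Ck_on k (\<lambda>x. Re (h x)) A" and im: "Ck_on k (\<lambda>x. Im (h x)) A" if "Ck_on k h A" for k h
    using that by (auto intro: Ck_on_bounded_linear A bounded_linear_Re bounded_linear_Im)
  have mult: "Ck_on k (\<lambda>x. h x * h' x) A" if "Ck_on k h A" "Ck_on k h' A" for k and h h' :: "complex \<Rightarrow> real"
    using Ck_on_bilinear[OF bounded_bilinear_mult A that] .
  have diff: "Ck_on k (\<lambda>x. h x - h' x) A" if "Ck_on k h A" "Ck_on k h' A" for k and h h' :: "complex \<Rightarrow> real"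
    using Ck_on_add[OF A that(1) Ck_on_bounded_linear[OF bounded_linear_minus[OF bounded_linear_ident] A that(2)]]
    by simp
  have ab: "Ck_on k a A" "Ck_on k b A" for k
    unfolding a_def b_def using Ck_on_SucD(2)[OF f1] by auto
  have detk: "Ck_on k det A" for k
    unfolding det_def by (intro diff mult re im ab)
  have Gk: "Ck_on k (G w) A" for k w
    unfolding G_def
    by (intro Ck_on_add[OF A] Ck_on_bilinear[OF bounded_bilinear_scaleR A] Ck_on_divide_real[OF A]
        diff mult re im ab Ck_on_const detk det)
  have "Ck_on k g (f ` A)" for k
  proof (induction k)
    case 0
    then show ?case using contg by simp
  next
    case (Suc k)
    show ?case
    proof (rule Ck_on_SucI[OF B Dg])
      show "Ck_on k (\<lambda>x. G v (g x)) (f ` A)" for v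
        by (rule Ck_on_compose[OF B A Suc Gk]) (use gf in auto)
    qed
  qed
  then show "smooth_on g (f ` A)" by (simp add: smooth_on_def)
qed

lemma locally_injective_plane:
  fixes f :: "complex \<Rightarrow> complex"
  assumes A: "open A" "x \<in> A" and f: "Ck_on (Suc 0) f A" and inj: "inj (frechet_derivative f (at x))"
  shows "\<exists>B. x \<in> B \<and> open B \<and> B \<subseteq> A \<and> inj_on f B"
proof -
  let ?D = "\<lambda>y. frechet_derivative f (at y)"
  note D = Ck_on_SucD(1)[OF f]
  have lin: "linear (?D x)" by (rule has_derivative_linear[OF D[OF A(2)]])
  obtain g where g: "linear g" "g \<circ> ?D x = id"
    using linear_injective_left_inverse[OF lin inj] by blast
  obtain r where "r > 0" "ball x r \<subseteq> A" "inj_on f (ball x r)"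
  proof (rule has_derivative_locally_injective[OF A(2,1) _ g(2) D])
    show "bounded_linear g" using g(1) by (simp add: linear_conv_bounded_linear)
    fix e :: real assume e: "e > 0"
    have cont: "isCont (\<lambda>y. ?D y v) x" for v
      using Ck_on_SucD(2)[OF f, of v] continuous_on_eq_continuous_at[OF A(1), of "\<lambda>y. ?D y v"] A(2) by simp
    have "isCont (\<lambda>y. norm (?D y 1 - ?D x 1) + norm (?D y \<i> - ?D x \<i>)) x"
      by (intro continuous_intros cont)
    from this[unfolded continuous_at_eps_delta, rule_format, OF half_gt_zero[OF e]]
    obtain d where d: "d > 0" "\<And>y. dist y x < d \<Longrightarrow> norm (?D y 1 - ?D x 1) + norm (?D y \<i> - ?D x \<i>) < e / 2"
      by auto
    obtain d' where d': "d' > 0" "ball x d' \<subseteq> A" using openE[OF A] by blast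
    show "\<exists>d>0. \<forall>y. dist x y < d \<longrightarrow> onorm (\<lambda>v. ?D y v - ?D x v) < e"
    proof (intro exI[of _ "min d d'"] conjI allI impI)
      fix y assume y: "dist x y < min d d'"
      then have "y \<in> A" using d'(2) by auto
      then have df: "f differentiable (at y)" "f differentiable (at x)"
        using D A(2) by (auto simp: differentiable_def)
      have "onorm (\<lambda>v. ?D y v - ?D x v) \<le> e / 2"
      proof (rule onorm_le)
        fix v
        have "?D y v - ?D x v = Re v *\<^sub>R (?D y 1 - ?D x 1) + Im v *\<^sub>R (?D y \<i> - ?D x \<i>)"
          unfolding frechet_derivative_complex_expand[OF df(1), of v] frechet_derivative_complex_expand[OF df(2), of v]
          by (simp add: algebra_simps)
        also have "norm \<dots> \<le> \<bar>Re v\<bar> * norm (?D y 1 - ?D x 1) + \<bar>Im v\<bar> * norm (?D y \<i> - ?D x \<i>)"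
          by (rule order_trans[OF norm_triangle_ineq]) simp
        also have "\<dots> \<le> norm v * norm (?D y 1 - ?D x 1) + norm v * norm (?D y \<i> - ?D x \<i>)"
          by (intro add_mono mult_right_mono abs_Re_le_cmod abs_Im_le_cmod) auto
        also have "\<dots> = norm v * (norm (?D y 1 - ?D x 1) + norm (?D y \<i> - ?D x \<i>))"
          by (simp add: distrib_left)
        also have "\<dots> \<le> norm v * (e / 2)"
          using d(2)[of y] y by (intro mult_left_mono) (auto simp: dist_commute)
        finally show "norm (?D y v - ?D x v) \<le> e / 2 * norm v" by (simp add: mult.commute)
      qed
      then show "onorm (\<lambda>v. ?D y v - ?D x v) < e" using e by simp
    qed (use d d' in auto)
  qed auto
  then show ?thesis by (intro exI[of _ "ball x r"]) auto
qed

section \<open>Proper local homeomorphisms\<close>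

text \<open>A fibre is compact and, by local injectivity, discrete. Since \<open>p\<close> is a closed map, the points
  near which \<open>p\<close> is not controlled by the finitely many sheets through the fibre have an image that
  stays away from the base point.\<close>

lemma proper_local_homeomorphism_covering:
  fixes p :: "'a::euclidean_space \<Rightarrow> 'a"
  assumes S: "open S" and T: "open T" and cont: "continuous_on S p" and img: "p ` S = T"
    and loc: "\<And>x. x \<in> S \<Longrightarrow> \<exists>U. x \<in> U \<and> open U \<and> U \<subseteq> S \<and> inj_on p U"
    and proper: "\<And>K. K \<subseteq> T \<Longrightarrow> compact K \<Longrightarrow> compact (S \<inter> p -` K)"
  shows "covering_space S p T"
proof (rule covering_spaceI[OF cont img])
  fix y assume y: "y \<in> T"
  define F where "F = S \<inter> p -` {y}"
  obtain U where U: "\<And>x. x \<in> S \<Longrightarrow> x \<in> U x \<and> open (U x) \<and> U x \<subseteq> S \<and> inj_on p (U x)"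
    using loc by metis
  have "compact F" unfolding F_def by (rule proper) (use y in auto)
  then obtain D where D: "D \<subseteq> F" "finite D" "F \<subseteq> (\<Union>x\<in>D. U x)"
  proof (rule compactE_image)
    show "open (U x)" if "x \<in> F" for x using U that F_def by auto
    show "F \<subseteq> (\<Union>x\<in>F. U x)" using U F_def by auto
  qed blast
  have "F \<subseteq> D"
  proof
    fix x assume x: "x \<in> F"
    then obtain d where d: "d \<in> D" "x \<in> U d" using D by auto
    then have "inj_on p (U d)" "d \<in> U d" "p x = p d" using U D(1) x F_def by auto
    then have "x = d" using d(2) by (simp add: inj_on_eq_iff)
    then show "x \<in> D" using d by simp
  qed
  then have finF: "finite F" using D(2) finite_subset by blast
  define e where "e = Min (insert 1 ((\<lambda>(a, b). dist a b) ` {(a, b) \<in> F \<times> F. a \<noteq> b}))"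
  have finP: "finite ((\<lambda>(a, b). dist a b) ` {(a, b) \<in> F \<times> F. a \<noteq> b})"
    by (rule finite_imageI, rule finite_subset[of _ "F \<times> F"]) (use finF in auto)
  have e: "e > 0" unfolding e_def using finP by (subst Min_gr_iff) auto
  have sep: "e \<le> dist a b" if "a \<in> F" "b \<in> F" "a \<noteq> b" for a b
    unfolding e_def using finP that by (intro Min_le) (auto intro!: image_eqI[of _ _ "(a, b)"])
  define V where "V x = U x \<inter> ball x (e / 2)" for x
  have V: "x \<in> V x" "open (V x)" "V x \<subseteq> S" "inj_on p (V x)" if "x \<in> F" for x
    using U[of x] that e by (auto simp: V_def F_def inj_on_def)
  have disj: "V a \<inter> V b = {}" if "a \<in> F" "b \<in> F" "a \<noteq> b" for a b
  proof (rule ccontr)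
    assume "V a \<inter> V b \<noteq> {}"
    then obtain z where "dist a z < e / 2" "dist b z < e / 2" by (auto simp: V_def)
    then have "dist a b < e" using dist_triangle2[of a b z] by simp
    then show False using sep[OF that] by simp
  qed
  define C where "C = S - (\<Union>x\<in>F. V x)"
  define W where "W = (\<Inter>x\<in>F. p ` V x) \<inter> (T - p ` C)"
  have openpV: "open (p ` V x)" if "x \<in> F" for x
    by (rule invariance_of_domain) (use V[OF that] cont continuous_on_subset in auto)
  have "closedin (top_of_set S) C"
  proof -
    have "C = S - (S \<inter> (\<Union>x\<in>F. V x))" by (auto simp: C_def)
    then show ?thesis using V(2) by (auto intro!: openin_open_Int closedin_diff)
  qed
  then have "closedin (top_of_set T) (p ` C)"
    using img by (intro proper_map[OF _ proper]) auto
  then have "open (T - p ` C)"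
    using T by (metis openin_diff openin_subtopology_self openin_open_eq)
  then have openW: "open W"
    unfolding W_def using finF openpV by auto
  have yW: "y \<in> W"
    unfolding W_def
  proof (intro IntI DiffI INT_I)
    show "y \<in> p ` V x" if "x \<in> F" for x
      using V(1)[OF that] that by (auto simp: F_def)
    show "y \<notin> p ` C" using V(1) by (auto simp: C_def F_def)
  qed (rule y)
  have WT: "W \<subseteq> T" by (auto simp: W_def)
  define v where "v = (\<lambda>x. V x \<inter> p -` W) ` F"
  show "\<exists>W. y \<in> W \<and> openin (top_of_set T) W \<and>
         (\<exists>v. \<Union> v = S \<inter> p -` W \<and> (\<forall>u\<in>v. openin (top_of_set S) u) \<and> pairwise disjnt v \<and>
           (\<forall>u\<in>v. \<exists>q. homeomorphism u W p q))"
  proof (intro exI[of _ W] exI[of _ v] conjI ballI)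
    show "y \<in> W" by (rule yW)
    show "openin (top_of_set T) W" using openW WT T by (simp add: openin_open_eq)
    show "\<Union> v = S \<inter> p -` W" using V(3) by (auto simp: v_def W_def C_def)
    have opn: "open (V x \<inter> p -` W)" if "x \<in> F" for x
      using continuous_open_preimage[OF continuous_on_subset[OF cont V(3)[OF that]] V(2)[OF that] openW] .
    show "openin (top_of_set S) u" if "u \<in> v" for u
      using that opn V(3) S by (auto simp: v_def openin_open_eq)
    show "pairwise disjnt v"
      unfolding v_def pairwise_image by (auto simp: pairwise_def disjnt_def dest: disj)
    fix u assume "u \<in> v"
    then obtain x where x: "x \<in> F" and u: "u = V x \<inter> p -` W" by (auto simp: v_def)
    have "W \<subseteq> p ` V x" using x by (auto simp: W_def)
    then have "p ` u = W" by (auto simp: u)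
    moreover obtain q where "homeomorphism u (p ` u) p q"
    proof (rule invariance_of_domain_homeomorphism[of u p])
      show "open u" using opn x u by simp
      show "continuous_on u p" using cont V(3)[OF x] u by (meson Int_lower1 continuous_on_subset)
      show "inj_on p u" using V(4)[OF x] u by (meson Int_lower1 inj_on_subset)
    qed auto
    ultimately show "\<exists>q. homeomorphism u W p q" by auto
  qed
qed

text \<open>The identity of the simply connected target lifts through the covering. The image of the lift
  is open, by local injectivity, and closed, so it is the whole connected domain.\<close>

theorem proper_local_homeomorphism_bij_betw:
  fixes p :: "'a::euclidean_space \<Rightarrow> 'a"
  assumes S: "open S" "connected S" "S \<noteq> {}"
    and T: "open T" "simply_connected T"
    and cont: "continuous_on S p" and img: "p ` S \<subseteq> T"
    and loc: "\<And>x. x \<in> S \<Longrightarrow> \<exists>U. x \<in> U \<and> open U \<and> U \<subseteq> S \<and> inj_on p U"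
    and proper: "\<And>K. K \<subseteq> T \<Longrightarrow> compact K \<Longrightarrow> compact (S \<inter> p -` K)"
  shows "bij_betw p S T"
proof -
  obtain U where U: "\<And>x. x \<in> S \<Longrightarrow> x \<in> U x \<and> open (U x) \<and> U x \<subseteq> S \<and> inj_on p (U x)"
    using loc by metis
  have "p ` S = (\<Union>x\<in>S. p ` U x)" using U by blast
  moreover have "open (p ` U x)" if "x \<in> S" for x
    by (rule invariance_of_domain) (use U[OF that] cont continuous_on_subset in auto)
  ultimately have "open (p ` S)" by auto
  then have "openin (top_of_set T) (p ` S)" using img T(1) by (simp add: openin_open_eq)
  moreover have "closedin (top_of_set T) (p ` S)"
    by (rule proper_map[OF _ proper img]) auto
  moreover have "connected T" using T(2) by (rule simply_connected_imp_connected)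
  ultimately have onto: "p ` S = T"
    using S(3) unfolding connected_clopen by blast
  have cov: "covering_space S p T"
    by (rule proper_local_homeomorphism_covering[OF S(1) T(1) cont onto loc proper])
  have "x = x'" if x: "x \<in> S" "x' \<in> S" "p x = p x'" for x x'
  proof -
    obtain g where g: "continuous_on T g" "g \<in> T \<rightarrow> S" "g (p x) = x" "\<And>y. y \<in> T \<Longrightarrow> p (g y) = y"
    proof (rule covering_space_lift_strong[OF cov x(1) _ T(2) open_imp_locally_path_connected[OF T(1)],
          where z = "p x" and f = "\<lambda>y. y"])
      show "p x \<in> T" using x img by auto
    qed auto
    define E where "E = {z \<in> S. g (p z) = z}"
    have contgp: "continuous_on S (\<lambda>z. g (p z))"
      by (rule continuous_on_compose2[OF g(1) cont img])
    have "closedin (top_of_set S) {z \<in> S. g (p z) - z = 0}"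
      by (intro continuous_closedin_preimage_constant continuous_intros contgp)
    then have "closedin (top_of_set S) E" by (simp add: E_def)
    moreover have "openin (top_of_set S) E"
    proof (subst openin_subopen, intro ballI)
      fix z assume z: "z \<in> E"
      then have zS: "z \<in> S" and gz: "g (p z) = z" by (auto simp: E_def)
      let ?N = "U z \<inter> (S \<inter> (\<lambda>z. g (p z)) -` U z)"
      have "open (S \<inter> (\<lambda>z. g (p z)) -` U z)"
        by (rule continuous_open_preimage[OF contgp S(1)]) (use U[OF zS] in auto)
      then have "openin (top_of_set S) ?N" using U[OF zS] S(1) by (auto simp: openin_open_eq)
      moreover have "?N \<subseteq> E"
      proof
        fix t assume t: "t \<in> ?N"
        then have "p (g (p t)) = p t" using g(4) img by auto
        then have "g (p t) = t" using t U[OF zS] by (auto simp: inj_on_def)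
        then show "t \<in> E" using t by (auto simp: E_def)
      qed
      moreover have "z \<in> ?N" using zS gz U[OF zS] by auto
      ultimately show "\<exists>N. openin (top_of_set S) N \<and> z \<in> N \<and> N \<subseteq> E" by blast
    qed
    moreover have "x \<in> E" using x g(3) by (auto simp: E_def)
    ultimately have "E = S" using S(2) unfolding connected_clopen by blast
    then have "g (p x') = x'" using x by (auto simp: E_def)
    then show "x = x'" using g(3) x(3) by simp
  qed
  then show ?thesis using onto by (auto simp: bij_betw_def inj_on_def)
qed

section \<open>Second derivatives\<close>

text \<open>The derivative along \<open>w\<close> is taken first, then the one along \<open>v\<close>.\<close>

definition second_derivative ::
  "('a::real_normed_vector \<Rightarrow> 'b::real_normed_vector) \<Rightarrow> 'a \<Rightarrow> 'a \<Rightarrow> 'a \<Rightarrow> 'b" where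
  "second_derivative f x v w = frechet_derivative (\<lambda>y. frechet_derivative f (at y) w) (at x) v"

lemma has_second_derivative:
  assumes "Ck_on (Suc (Suc 0)) f A" "x \<in> A"
  shows "((\<lambda>y. frechet_derivative f (at y) w) has_derivative (\<lambda>v. second_derivative f x v w)) (at x)"
  using Ck_on_SucD(1)[OF Ck_on_SucD(2)[OF assms(1)] assms(2)] by (simp add: second_derivative_def)

lemma second_derivative_eqI:
  assumes "open A" "x \<in> A" "\<And>y. y \<in> A \<Longrightarrow> (f has_derivative f' y) (at y)"
    and "((\<lambda>y. f' y w) has_derivative f'') (at x)"
  shows "second_derivative f x v w = f'' v"
proof -
  have "((\<lambda>y. frechet_derivative f (at y) w) has_derivative f'') (at x)"
    by (rule has_derivative_transform_within_open[OF assms(4,1,2)])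
       (simp add: frechet_derivative_at[OF assms(3), symmetric])
  then show ?thesis
    unfolding second_derivative_def by (simp add: frechet_derivative_at[symmetric])
qed

lemma second_derivative_sym:
  fixes f :: "'a::real_normed_vector \<Rightarrow> 'b::real_inner"
  assumes "open A" "x \<in> A" "Ck_on (Suc (Suc 0)) f A"
  shows "second_derivative f x v w = second_derivative f x w v"
  unfolding second_derivative_def by (rule mixed_partials[OF assms])

lemma second_derivative_left:
  fixes f :: "complex \<Rightarrow> 'b::real_normed_vector"
  assumes "Ck_on (Suc (Suc 0)) f A" "x \<in> A"
  shows "second_derivative f x v w = Re v *\<^sub>R second_derivative f x 1 w + Im v *\<^sub>R second_derivative f x \<i> w"
  unfolding second_derivative_def
  by (rule frechet_derivative_complex_expand)
     (use has_second_derivative[OF assms] in \<open>auto simp: differentiable_def\<close>)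

lemma second_derivative_expand:
  fixes f :: "complex \<Rightarrow> 'b::real_inner"
  assumes "open A" "x \<in> A" "Ck_on (Suc (Suc 0)) f A"
  shows "second_derivative f x v w = (Re v * Re w) *\<^sub>R second_derivative f x 1 1
    + (Re v * Im w + Im v * Re w) *\<^sub>R second_derivative f x 1 \<i>
    + (Im v * Im w) *\<^sub>R second_derivative f x \<i> \<i>"
proof -
  note L = second_derivative_left[OF assms(3,2)] and S = second_derivative_sym[OF assms]
  have R: "second_derivative f x c w = Re w *\<^sub>R second_derivative f x c 1 + Im w *\<^sub>R second_derivative f x c \<i>"
    for c using L[of w c] S[of w c] S[of 1 c] S[of \<i> c] by simp
  show ?thesis
    unfolding L[of v w] R[of 1] R[of \<i>] S[of \<i> 1] by (simp add: algebra_simps)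
qed

text \<open>A positive second derivative along \<open>v\<close> would make the function increase along a short segment from
  its critical point.\<close>

lemma second_derivative_test_max:
  fixes f :: "'a::real_normed_vector \<Rightarrow> real"
  assumes "open A" "x \<in> A" and C2: "Ck_on (Suc (Suc 0)) f A"
    and max: "\<And>y. y \<in> A \<Longrightarrow> f y \<le> f x"
  shows "frechet_derivative f (at x) v = 0" and "second_derivative f x v v \<le> 0"
proof -
  show crit: "frechet_derivative f (at x) v = 0" for v
    using differential_zero_maxmin[OF assms(2,1) Ck_on_SucD(1)[OF C2 assms(2)]] max
    by (auto simp: fun_eq_iff)
  show "second_derivative f x v v \<le> 0"
  proof (rule ccontr)
    assume "\<not> second_derivative f x v v \<le> 0"
    then have pos: "second_derivative f x v v > 0" by simp
    let ?g = "\<lambda>s. frechet_derivative f (at (x + s *\<^sub>R v)) v"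
    have "(?g has_real_derivative second_derivative f x v v) (at 0)"
      by (rule has_real_derivative_along) (use has_second_derivative[OF C2 assms(2)] in simp)
    from DERIV_pos_inc_right[OF this pos] crit
    obtain d where d: "d > 0" "\<And>s. s > 0 \<Longrightarrow> s < d \<Longrightarrow> 0 < ?g s" by auto
    have "open ((\<lambda>s. x + s *\<^sub>R v) -` A)"
      by (intro open_vimage assms continuous_intros)
    moreover have "0 \<in> (\<lambda>s. x + s *\<^sub>R v) -` A" using assms by simp
    ultimately obtain e where e: "e > 0" "ball 0 e \<subseteq> (\<lambda>s. x + s *\<^sub>R v) -` A"
      using openE by blast
    define t where "t = min d e / 2"
    have t: "0 < t" "t < d" "t < e" using d(1) e(1) by (auto simp: t_def)
    have inA: "x + s *\<^sub>R v \<in> A" if "0 \<le> s" "s \<le> t" for s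
      using e(2) that t by (auto simp: subset_iff dist_norm)
    have "\<exists>z. 0 < z \<and> z < t \<and> f (x + t *\<^sub>R v) - f (x + 0 *\<^sub>R v) = (t - 0) * ?g z"
      by (rule MVT2[OF t(1)], rule has_real_derivative_along, rule Ck_on_SucD(1)[OF C2])
         (use inA in auto)
    then obtain z where z: "0 < z" "z < t" "f (x + t *\<^sub>R v) - f x = t * ?g z" by auto
    then have "f (x + t *\<^sub>R v) > f x" using d(2)[of z] t by (metis diff_gt_0_iff_gt less_trans mult_pos_pos)
    then show False using max[OF inA[of t]] t by simp
  qed
qed

section \<open>Surfaces that touch a graph\<close>

text \<open>The height of a point of \<open>\<complex> \<times> \<real>\<close> over the graph of \<open>u\<close>. Pulled back along a
  parameterization it turns contact of a surface with the graph into a statement about the derivatives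
  of a real function.\<close>

definition height :: "(complex \<Rightarrow> real) \<Rightarrow> complex \<times> real \<Rightarrow> real" where
  "height u q = snd q - u (fst q)"

definition grad :: "(complex \<Rightarrow> real) \<Rightarrow> complex \<Rightarrow> complex" where
  "grad u z = Complex (frechet_derivative u (at z) 1) (frechet_derivative u (at z) \<i>)"

lemma frechet_derivative_grad:
  fixes u :: "complex \<Rightarrow> real"
  assumes "u differentiable (at z)"
  shows "frechet_derivative u (at z) c = grad u z \<bullet> c"
  using frechet_derivative_complex_expand[OF assms, of c]
  by (simp add: grad_def inner_complex_def mult.commute)

text \<open>The left hand side of the equation of zero mean curvature for graphs in \<open>\<real>\<^bsup>2,1\<^esup>\<close>.\<close>

definition graph_operator :: "(complex \<Rightarrow> real) \<Rightarrow> complex \<Rightarrow> real" where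
  "graph_operator u z =
     (1 - (Im (grad u z))\<^sup>2) * second_derivative u z 1 1
     + 2 * Re (grad u z) * Im (grad u z) * second_derivative u z 1 \<i>
     + (1 - (Re (grad u z))\<^sup>2) * second_derivative u z \<i> \<i>"

lemma has_derivative_height:
  assumes "(\<phi> has_derivative \<phi>') (at y)" "u differentiable (at (fst (\<phi> y)))"
  shows "((\<lambda>y. height u (\<phi> y)) has_derivative
           (\<lambda>v. snd (\<phi>' v) - grad u (fst (\<phi> y)) \<bullet> fst (\<phi>' v))) (at y)"
proof -
  have "((\<lambda>y. u (fst (\<phi> y))) has_derivative (\<lambda>v. frechet_derivative u (at (fst (\<phi> y))) (fst (\<phi>' v)))) (at y)"
    using has_derivative_compose[OF has_derivative_fst[OF assms(1)] frechet_derivative_works[THEN iffD1, OF assms(2)]] .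
  then show ?thesis
    unfolding height_def frechet_derivative_grad[OF assms(2)]
    by (intro has_derivative_diff has_derivative_snd assms)
qed

locale surface_over =
  fixes \<phi> :: "complex \<Rightarrow> complex \<times> real" and W H :: "complex set" and u :: "complex \<Rightarrow> real"
  assumes W: "open W" and H: "open H"
    and \<phi>: "Ck_on (Suc (Suc 0)) \<phi> W" and u: "Ck_on (Suc (Suc 0)) u H"
    and over: "\<And>y. y \<in> W \<Longrightarrow> fst (\<phi> y) \<in> H"
begin

lemma Ck_on_height: "Ck_on (Suc (Suc 0)) (\<lambda>y. height u (\<phi> y)) W"
proof -
  have "Ck_on (Suc (Suc 0)) (\<lambda>y. u (fst (\<phi> y))) W"
    by (rule Ck_on_compose[OF W H Ck_on_bounded_linear[OF bounded_linear_fst W \<phi>] u]) (use over in auto)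
  then have "Ck_on (Suc (Suc 0)) (\<lambda>y. - u (fst (\<phi> y))) W"
    by (rule Ck_on_bounded_linear[OF bounded_linear_minus[OF bounded_linear_ident] W])
  then have "Ck_on (Suc (Suc 0)) (\<lambda>y. snd (\<phi> y) + - u (fst (\<phi> y))) W"
    by (intro Ck_on_add[OF W] Ck_on_bounded_linear[OF bounded_linear_snd W \<phi>])
  then show ?thesis by (simp add: height_def)
qed

lemma u_diff: "y \<in> W \<Longrightarrow> u differentiable (at (fst (\<phi> y)))"
  using Ck_on_SucD(1)[OF u over] by (auto simp: differentiable_def)

lemma has_derivative_height':
  assumes "y \<in> W"
  shows "((\<lambda>y. height u (\<phi> y)) has_derivative
           (\<lambda>v. snd (dirderiv v \<phi> y) - grad u (fst (\<phi> y)) \<bullet> fst (dirderiv v \<phi> y))) (at y)"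
  unfolding dirderiv_def by (rule has_derivative_height[OF Ck_on_SucD(1)[OF \<phi> assms] u_diff[OF assms]])

lemma second_derivative_height:
  assumes x: "x \<in> W"
  shows "second_derivative (\<lambda>y. height u (\<phi> y)) x v w =
     snd (second_derivative \<phi> x v w) - grad u (fst (\<phi> x)) \<bullet> fst (second_derivative \<phi> x v w)
     - second_derivative u (fst (\<phi> x)) (fst (dirderiv v \<phi> x)) (fst (dirderiv w \<phi> x))"
proof -
  have D\<phi>: "(\<phi> has_derivative (\<lambda>v. dirderiv v \<phi> x)) (at x)"
    unfolding dirderiv_def by (rule Ck_on_SucD(1)[OF \<phi> x])
  have DD\<phi>: "((\<lambda>y. dirderiv w \<phi> y) has_derivative (\<lambda>v. second_derivative \<phi> x v w)) (at x)"
    unfolding dirderiv_def by (rule has_second_derivative[OF \<phi> x])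
  have Dgrad: "((\<lambda>y. frechet_derivative u (at (fst (\<phi> y))) c) has_derivative
      (\<lambda>v. second_derivative u (fst (\<phi> x)) (fst (dirderiv v \<phi> x)) c)) (at x)" for c
    by (rule has_derivative_compose[OF has_derivative_fst[OF D\<phi>] has_second_derivative[OF u over[OF x]]])
  have D: "((\<lambda>y. snd (dirderiv w \<phi> y) - grad u (fst (\<phi> y)) \<bullet> fst (dirderiv w \<phi> y)) has_derivative
     (\<lambda>v. snd (second_derivative \<phi> x v w) -
       ((frechet_derivative u (at (fst (\<phi> x))) 1 * Re (fst (second_derivative \<phi> x v w)) +
         second_derivative u (fst (\<phi> x)) (fst (dirderiv v \<phi> x)) 1 * Re (fst (dirderiv w \<phi> x))) +
        (frechet_derivative u (at (fst (\<phi> x))) \<i> * Im (fst (second_derivative \<phi> x v w)) +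
         second_derivative u (fst (\<phi> x)) (fst (dirderiv v \<phi> x)) \<i> * Im (fst (dirderiv w \<phi> x)))))) (at x)"
    unfolding inner_complex_def grad_def complex.sel
    by (intro has_derivative_diff has_derivative_add has_derivative_mult has_derivative_snd
        bounded_linear.has_derivative[OF bounded_linear_Re] bounded_linear.has_derivative[OF bounded_linear_Im]
        has_derivative_fst DD\<phi> Dgrad)
  have right: "second_derivative u (fst (\<phi> x)) c d = second_derivative u (fst (\<phi> x)) c 1 * Re d
      + second_derivative u (fst (\<phi> x)) c \<i> * Im d" for c d
    unfolding second_derivative_sym[OF H over[OF x] u, of c] second_derivative_left[OF u over[OF x], of d c]
    by (simp add: mult.commute)
  from second_derivative_eqI[OF W x has_derivative_height' D, of v]
  have "second_derivative (\<lambda>y. height u (\<phi> y)) x v w = snd (second_derivative \<phi> x v w) -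
       ((frechet_derivative u (at (fst (\<phi> x))) 1 * Re (fst (second_derivative \<phi> x v w)) +
         second_derivative u (fst (\<phi> x)) (fst (dirderiv v \<phi> x)) 1 * Re (fst (dirderiv w \<phi> x))) +
        (frechet_derivative u (at (fst (\<phi> x))) \<i> * Im (fst (second_derivative \<phi> x v w)) +
         second_derivative u (fst (\<phi> x)) (fst (dirderiv v \<phi> x)) \<i> * Im (fst (dirderiv w \<phi> x))))"
    by blast
  then show ?thesis
    unfolding right[of "fst (dirderiv v \<phi> x)" "fst (dirderiv w \<phi> x)"]
    by (simp only: inner_complex_def grad_def complex.sel)
qed

end

text \<open>With \<open>A\<close> the matrix with columns \<open>z\<close>, \<open>w\<close> and \<open>B = 1 - pp\<^sup>T\<close>, the values of
  \<open>g\<close> are the entries of \<open>A\<^sup>T B A\<close>, and the left hand side is the trace of \<open>adj (A\<^sup>T B A) (A\<^sup>T X A)\<close>, which equals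
  \<open>(det A)\<^sup>2\<close> times the trace of \<open>adj B X\<close>.\<close>

lemma trace_pullback:
  fixes z w p :: complex and a b c :: real
  defines "X \<equiv> \<lambda>v v'. Re v * Re v' * a + (Re v * Im v' + Im v * Re v') * b + Im v * Im v' * c"
  defines "g \<equiv> \<lambda>v v'. v \<bullet> v' - (p \<bullet> v) * (p \<bullet> v')"
  shows "X z z * g w w - 2 * X z w * g z w + X w w * g z z =
     (Re z * Im w - Im z * Re w)\<^sup>2 *
     ((1 - (Im p)\<^sup>2) * a + 2 * Re p * Im p * b + (1 - (Re p)\<^sup>2) * c)"
  unfolding X_def g_def inner_complex_def by (simp add: algebra_simps power2_eq_square)

lemma det_pullback:
  fixes z w p :: complex
  defines "g \<equiv> \<lambda>v v'. v \<bullet> v' - (p \<bullet> v) * (p \<bullet> v')"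
  shows "g z z * g w w - (g z w)\<^sup>2 = (Re z * Im w - Im z * Re w)\<^sup>2 * (1 - p \<bullet> p)"
  unfolding g_def inner_complex_def by (simp add: algebra_simps power2_eq_square)

text \<open>The Gram determinant appears as the value of the quadratic form at the vector \<open>- F + i E\<close>, which is
  orthogonal to \<open>1\<close>.\<close>

lemma spacelike_at_first_form_pos:
  assumes "spacelike_at \<phi> x" "\<phi> differentiable (at x)"
  shows "lorentz (dirderiv 1 \<phi> x) (dirderiv 1 \<phi> x) > 0"
    and "lorentz (dirderiv 1 \<phi> x) (dirderiv 1 \<phi> x) * lorentz (dirderiv \<i> \<phi> x) (dirderiv \<i> \<phi> x)
         - (lorentz (dirderiv 1 \<phi> x) (dirderiv \<i> \<phi> x))\<^sup>2 > 0"
proof -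
  define E F G where "E = lorentz (dirderiv 1 \<phi> x) (dirderiv 1 \<phi> x)"
    and "F = lorentz (dirderiv 1 \<phi> x) (dirderiv \<i> \<phi> x)"
    and "G = lorentz (dirderiv \<i> \<phi> x) (dirderiv \<i> \<phi> x)"
  have pos: "lorentz (dirderiv v \<phi> x) (dirderiv v \<phi> x) > 0" if "v \<noteq> 0" for v
    using assms(1) that by (simp add: spacelike_at_def)
  have E: "E > 0" unfolding E_def by (rule pos) simp
  have expand: "dirderiv v \<phi> x = Re v *\<^sub>R dirderiv 1 \<phi> x + Im v *\<^sub>R dirderiv \<i> \<phi> x" for v
    unfolding dirderiv_def by (rule frechet_derivative_complex_expand[OF assms(2)])
  have "lorentz (dirderiv v \<phi> x) (dirderiv v \<phi> x) = (Re v)\<^sup>2 * E + 2 * Re v * Im v * F + (Im v)\<^sup>2 * G" for v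
    unfolding expand[of v]
    by (simp add: lorentz_def E_def F_def G_def inner_complex_def algebra_simps power2_eq_square)
  with pos[of "Complex (- F) E"] E have "F\<^sup>2 * E - 2 * F * E * F + E\<^sup>2 * G > 0"
    by (simp add: complex_eq_iff)
  then have "E * (E * G - F\<^sup>2) > 0"
    by (simp add: algebra_simps power2_eq_square)
  then have "E * G - F\<^sup>2 > 0" using E by (simp add: zero_less_mult_iff)
  then show "E * G - F\<^sup>2 > 0" "E > 0" using E by auto
qed

context surface_over
begin

lemma lorentz_tangent:
  assumes "\<And>v. snd (dirderiv v \<phi> x) = grad u (fst (\<phi> x)) \<bullet> fst (dirderiv v \<phi> x)"
  shows "lorentz (dirderiv v \<phi> x) (dirderiv w \<phi> x) = fst (dirderiv v \<phi> x) \<bullet> fst (dirderiv w \<phi> x)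
    - (grad u (fst (\<phi> x)) \<bullet> fst (dirderiv v \<phi> x)) * (grad u (fst (\<phi> x)) \<bullet> fst (dirderiv w \<phi> x))"
  unfolding lorentz_def assms by simp

lemma trace_second_derivative:
  assumes x: "x \<in> W"
    and tangent: "\<And>v. snd (dirderiv v \<phi> x) = grad u (fst (\<phi> x)) \<bullet> fst (dirderiv v \<phi> x)"
  defines "z1 \<equiv> fst (dirderiv 1 \<phi> x)" and "z2 \<equiv> fst (dirderiv \<i> \<phi> x)"
    and "X \<equiv> second_derivative u (fst (\<phi> x))"
  shows "X z1 z1 * lorentz (dirderiv \<i> \<phi> x) (dirderiv \<i> \<phi> x)
       - 2 * X z1 z2 * lorentz (dirderiv 1 \<phi> x) (dirderiv \<i> \<phi> x)
       + X z2 z2 * lorentz (dirderiv 1 \<phi> x) (dirderiv 1 \<phi> x)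
     = (Re z1 * Im z2 - Im z1 * Re z2)\<^sup>2 * graph_operator u (fst (\<phi> x))"
proof -
  have X: "X c d = Re c * Re d * X 1 1 + (Re c * Im d + Im c * Re d) * X 1 \<i> + Im c * Im d * X \<i> \<i>" for c d
    unfolding X_def using second_derivative_expand[OF H over[OF x] u, of c d] by simp
  show ?thesis
    unfolding lorentz_tangent[OF tangent] X[of z1 z1] X[of z1 z2] X[of z2 z2] graph_operator_def
      z1_def[symmetric] z2_def[symmetric] X_def[symmetric]
    by (rule trace_pullback)
qed

text \<open>The vector \<open>(grad u, 1)\<close> is a Lorentzian normal of the graph of \<open>u\<close>. Paired with it, the second
  derivatives of any surface over the domain split into those of its height over the graph and those of
  \<open>u\<close> itself.\<close>

lemma second_fundamental_form_height:
  assumes x: "x \<in> W"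
  shows "lorentz (second_derivative \<phi> x v w) (m *\<^sub>R grad u (fst (\<phi> x)), m) =
    - m * (second_derivative (\<lambda>y. height u (\<phi> y)) x v w
           + second_derivative u (fst (\<phi> x)) (fst (dirderiv v \<phi> x)) (fst (dirderiv w \<phi> x)))"
  unfolding second_derivative_height[OF x] lorentz_def
  by (simp add: inner_commute algebra_simps)

text \<open>At an extremum of the height the surface is tangent to the graph of \<open>u\<close>. There its vanishing mean
  curvature balances \<open>graph_operator u\<close> against the trace of the second derivatives of the height with
  respect to the first fundamental form, and the second derivative test gives the sign of that trace.\<close>

lemma graph_operator_at_extremum:
  assumes x: "x \<in> W" and spacelike: "spacelike_at \<phi> x"
    and zero: "\<And>N. unit_normal \<phi> x N \<Longrightarrow> mean_curvature \<phi> x N = 0"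
    and \<sigma>: "\<sigma> \<noteq> 0"
    and max: "\<And>y. y \<in> W \<Longrightarrow> \<sigma> * height u (\<phi> y) \<le> \<sigma> * height u (\<phi> x)"
  shows "\<sigma> * graph_operator u (fst (\<phi> x)) \<ge> 0"
proof -
  let ?h = "\<lambda>y. height u (\<phi> y)" and ?p = "grad u (fst (\<phi> x))"
  note h = Ck_on_height
  have \<sigma>h: "Ck_on (Suc (Suc 0)) (\<lambda>y. \<sigma> * ?h y) W"
    by (rule Ck_on_bounded_linear[OF bounded_linear_mult_right W h])
  have D: "((\<lambda>y. \<sigma> * ?h y) has_derivative (\<lambda>v. \<sigma> * frechet_derivative ?h (at y) v)) (at y)" if "y \<in> W" for y
    by (rule has_derivative_mult_right[OF Ck_on_SucD(1)[OF h that]])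
  have crit: "frechet_derivative ?h (at x) v = 0" for v
    using second_derivative_test_max(1)[OF W x \<sigma>h max, of v] \<sigma>
    by (simp add: frechet_derivative_at[OF D[OF x], symmetric])
  have "second_derivative (\<lambda>y. \<sigma> * ?h y) x v v = \<sigma> * second_derivative ?h x v v" for v
    by (rule second_derivative_eqI[OF W x D has_derivative_mult_right[OF has_second_derivative[OF h x]]])
  then have hess: "\<sigma> * second_derivative ?h x v v \<le> 0" for v
    using second_derivative_test_max(2)[OF W x \<sigma>h max, of v] by simp
  have tangent: "snd (dirderiv v \<phi> x) = ?p \<bullet> fst (dirderiv v \<phi> x)" for v
    using crit[of v] frechet_derivative_at[OF has_derivative_height'[OF x], symmetric] by simp
  define E F G where "E = lorentz (dirderiv 1 \<phi> x) (dirderiv 1 \<phi> x)"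
    and "F = lorentz (dirderiv 1 \<phi> x) (dirderiv \<i> \<phi> x)"
    and "G = lorentz (dirderiv \<i> \<phi> x) (dirderiv \<i> \<phi> x)"
  have "\<phi> differentiable (at x)" using Ck_on_SucD(1)[OF \<phi> x] by (auto simp: differentiable_def)
  from spacelike_at_first_form_pos[OF spacelike this]
  have E: "E > 0" and EG: "E * G - F\<^sup>2 > 0" by (simp_all add: E_def F_def G_def)
  define d where "d = Re (fst (dirderiv 1 \<phi> x)) * Im (fst (dirderiv \<i> \<phi> x))
                      - Im (fst (dirderiv 1 \<phi> x)) * Re (fst (dirderiv \<i> \<phi> x))"
  have "E * G - F\<^sup>2 = d\<^sup>2 * (1 - ?p \<bullet> ?p)"
    unfolding E_def F_def G_def d_def lorentz_tangent[OF tangent] by (rule det_pullback)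
  with EG have "d\<^sup>2 * (1 - ?p \<bullet> ?p) > 0" by simp
  then have d: "d\<^sup>2 > 0" and p: "1 - ?p \<bullet> ?p > 0"
    using zero_le_power2[of d] by (auto simp: zero_less_mult_iff)
  define m where "m = 1 / sqrt (1 - ?p \<bullet> ?p)"
  have m: "m \<noteq> 0" "m\<^sup>2 * (1 - ?p \<bullet> ?p) = 1"
    using p by (auto simp: m_def power_divide)
  have "unit_normal \<phi> x (m *\<^sub>R ?p, m)"
    unfolding unit_normal_def
  proof
    show "lorentz (m *\<^sub>R ?p, m) (m *\<^sub>R ?p, m) = - 1"
      using m(2) by (simp add: lorentz_def algebra_simps power2_eq_square)
    show "\<forall>v. lorentz (m *\<^sub>R ?p, m) (dirderiv v \<phi> x) = 0"
      by (simp add: lorentz_def tangent)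
  qed
  from zero[OF this] EG
  have sff: "lorentz (second_derivative \<phi> x 1 1) (m *\<^sub>R ?p, m) * G
      - 2 * lorentz (second_derivative \<phi> x 1 \<i>) (m *\<^sub>R ?p, m) * F
      + lorentz (second_derivative \<phi> x \<i> \<i>) (m *\<^sub>R ?p, m) * E = 0"
    unfolding mean_curvature_def Let_def E_def F_def G_def
    by (auto simp: second_derivative_def dirderiv_def[abs_def])
  define T where "T = second_derivative ?h x 1 1 * G - 2 * second_derivative ?h x 1 \<i> * F
      + second_derivative ?h x \<i> \<i> * E"
  note tr = trace_second_derivative[OF x tangent, folded E_def F_def G_def d_def]
  have "m * (T + d\<^sup>2 * graph_operator u (fst (\<phi> x))) = 0"
    using sff unfolding second_fundamental_form_height[OF x] tr[symmetric] T_def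
    by (simp add: algebra_simps)
  then have T: "T = - d\<^sup>2 * graph_operator u (fst (\<phi> x))" using m by simp
  have "second_derivative ?h x v v = (Re v * Re v) * second_derivative ?h x 1 1
    + (Re v * Im v + Im v * Re v) * second_derivative ?h x 1 \<i> + (Im v * Im v) * second_derivative ?h x \<i> \<i>" for v
    using second_derivative_expand[OF W x h, of v v] by simp
  from this[of "Complex (- F) E"]
  have "E * T = second_derivative ?h x 1 1 * (E * G - F\<^sup>2)
      + second_derivative ?h x (Complex (- F) E) (Complex (- F) E)"
    by (simp add: T_def algebra_simps power2_eq_square)
  then have "\<sigma> * (E * T) = \<sigma> * (second_derivative ?h x 1 1 * (E * G - F\<^sup>2)
      + second_derivative ?h x (Complex (- F) E) (Complex (- F) E))"
    by (rule arg_cong)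
  then have "E * (\<sigma> * T) = (\<sigma> * second_derivative ?h x 1 1) * (E * G - F\<^sup>2)
      + \<sigma> * second_derivative ?h x (Complex (- F) E) (Complex (- F) E)"
    by (simp only: distrib_left mult.assoc mult.left_commute)
  also have "\<dots> \<le> 0"
    by (rule add_nonpos_nonpos[OF mult_nonpos_nonneg[OF hess less_imp_le[OF EG]] hess])
  finally have "\<sigma> * T \<le> 0" using E by (simp add: mult_le_0_iff)
  then have "d\<^sup>2 * (\<sigma> * graph_operator u (fst (\<phi> x))) \<ge> 0" by (simp add: T algebra_simps)
  then show ?thesis using d by (simp add: zero_le_mult_iff)
qed

text \<open>A surface inside the graph is tangent to it, and the derivatives of its coordinates determine those of
  \<open>u\<close>.\<close>

lemma height_zero:
  assumes x: "x \<in> W" and zero: "\<And>y. y \<in> W \<Longrightarrow> height u (\<phi> y) = 0"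
  shows "snd (dirderiv v \<phi> x) = grad u (fst (\<phi> x)) \<bullet> fst (dirderiv v \<phi> x)"
    and "second_derivative (\<lambda>y. height u (\<phi> y)) x v w = 0"
proof -
  have D: "((\<lambda>y. height u (\<phi> y)) has_derivative (\<lambda>v. 0)) (at y)" if "y \<in> W" for y
    by (rule has_derivative_transform_within_open[OF has_derivative_const W that]) (simp add: zero)
  from has_derivative_unique[OF D[OF x] has_derivative_height'[OF x]]
  show "snd (dirderiv v \<phi> x) = grad u (fst (\<phi> x)) \<bullet> fst (dirderiv v \<phi> x)"
    by (simp add: fun_eq_iff)
  show "second_derivative (\<lambda>y. height u (\<phi> y)) x v w = 0"
    by (rule second_derivative_eqI[OF W x D has_derivative_const])
qed

text \<open>For a conformal parameterization by harmonic functions the trace of the second derivatives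
  vanishes already in the parameter domain.\<close>

lemma conformal_harmonic_graph_operator:
  assumes x: "x \<in> W" and zero: "\<And>y. y \<in> W \<Longrightarrow> height u (\<phi> y) = 0"
    and conf: "\<And>v w. lorentz (dirderiv v \<phi> x) (dirderiv w \<phi> x) = c * (v \<bullet> w)" and c: "c > 0"
    and harm: "second_derivative \<phi> x 1 1 + second_derivative \<phi> x \<i> \<i> = 0"
  shows "norm (grad u (fst (\<phi> x))) < 1" and "graph_operator u (fst (\<phi> x)) = 0"
proof -
  let ?p = "grad u (fst (\<phi> x))"
  have tangent: "snd (dirderiv v \<phi> x) = ?p \<bullet> fst (dirderiv v \<phi> x)" for v
    by (rule height_zero(1)[OF x zero])
  define d where "d = Re (fst (dirderiv 1 \<phi> x)) * Im (fst (dirderiv \<i> \<phi> x))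
                      - Im (fst (dirderiv 1 \<phi> x)) * Re (fst (dirderiv \<i> \<phi> x))"
  have "lorentz (dirderiv 1 \<phi> x) (dirderiv 1 \<phi> x) * lorentz (dirderiv \<i> \<phi> x) (dirderiv \<i> \<phi> x)
     - (lorentz (dirderiv 1 \<phi> x) (dirderiv \<i> \<phi> x))\<^sup>2 = d\<^sup>2 * (1 - ?p \<bullet> ?p)"
    unfolding d_def lorentz_tangent[OF tangent] by (rule det_pullback)
  then have "c * c = d\<^sup>2 * (1 - ?p \<bullet> ?p)"
    unfolding conf by (simp add: inner_complex_def)
  then have "d\<^sup>2 * (1 - ?p \<bullet> ?p) > 0" using c by (metis mult_pos_pos)
  then have d: "d\<^sup>2 > 0" and p: "1 - ?p \<bullet> ?p > 0"
    using zero_le_power2[of d] by (auto simp: zero_less_mult_iff)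
  from p have "(norm ?p)\<^sup>2 < 1" by (simp add: power2_norm_eq_inner)
  then show "norm ?p < 1" by (simp add: power2_less_1_iff abs_square_less_1)
  define X where "X = second_derivative u (fst (\<phi> x))"
  have X: "X (fst (dirderiv v \<phi> x)) (fst (dirderiv w \<phi> x)) =
      snd (second_derivative \<phi> x v w) - ?p \<bullet> fst (second_derivative \<phi> x v w)" for v w
    using second_derivative_height[OF x, of v w] height_zero(2)[OF x zero, of v w] by (simp add: X_def)
  have "second_derivative \<phi> x 1 1 = - second_derivative \<phi> x \<i> \<i>"
    using harm by (simp add: add_eq_0_iff2)
  then have "X (fst (dirderiv 1 \<phi> x)) (fst (dirderiv 1 \<phi> x)) + X (fst (dirderiv \<i> \<phi> x)) (fst (dirderiv \<i> \<phi> x)) = 0"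
    unfolding X by simp
  then have "c * X (fst (dirderiv 1 \<phi> x)) (fst (dirderiv 1 \<phi> x)) + c * X (fst (dirderiv \<i> \<phi> x)) (fst (dirderiv \<i> \<phi> x)) = 0"
    by (metis distrib_left mult_zero_right)
  with trace_second_derivative[OF x tangent, folded d_def X_def]
  have "d\<^sup>2 * graph_operator u (fst (\<phi> x)) = 0"
    unfolding conf by (simp add: inner_complex_def algebra_simps)
  then show "graph_operator u (fst (\<phi> x)) = 0" using d by simp
qed

end

definition graph_over :: "complex set \<Rightarrow> (complex \<Rightarrow> real) \<Rightarrow> (complex \<times> real) set" where
  "graph_over H u = (\<lambda>z. (z, u z)) ` H"

lemma graph_over_iff: "q \<in> graph_over H u \<longleftrightarrow> fst q \<in> H \<and> height u q = 0"
  by (cases q) (auto simp: graph_over_def height_def)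

lemma surface_over_graph:
  assumes "open H" "Ck_on (Suc (Suc 0)) u H" "local_parameterization (graph_over H u) W \<phi>"
  shows "surface_over \<phi> W H u" and "\<And>y. y \<in> W \<Longrightarrow> height u (\<phi> y) = 0"
proof -
  have W: "open W" "Ck_on (Suc (Suc 0)) \<phi> W"
    using assms(3) by (auto simp: local_parameterization_def smooth_on_def)
  have "openin (top_of_set (graph_over H u)) (\<phi> ` W)"
    using assms(3) by (simp add: local_parameterization_def)
  then have "\<phi> y \<in> graph_over H u" if "y \<in> W" for y
    using openin_imp_subset that by blast
  then have "fst (\<phi> y) \<in> H" "height u (\<phi> y) = 0" if "y \<in> W" for y
    using that by (auto simp: graph_over_iff)
  then show "surface_over \<phi> W H u" "\<And>y. y \<in> W \<Longrightarrow> height u (\<phi> y) = 0"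
    using assms(1,2) W by (auto simp: surface_over_def)
qed

text \<open>On a surface inside the graph the horizontal part of a tangent vector determines its vertical part, so
  the horizontal part of the differential is injective, hence bijective.\<close>

lemma tangent_plane_onto:
  assumes "surface_over \<phi> W H u" "x \<in> W" and zero: "\<And>y. y \<in> W \<Longrightarrow> height u (\<phi> y) = 0"
    and inj: "inj (frechet_derivative \<phi> (at x))"
  shows "v \<noteq> 0 \<Longrightarrow> fst (dirderiv v \<phi> x) \<noteq> 0" and "\<exists>v. fst (dirderiv v \<phi> x) = w"
proof -
  interpret surface_over \<phi> W H u by fact
  have "linear (\<lambda>v. fst (dirderiv v \<phi> x))"
    unfolding dirderiv_def using Ck_on_SucD(1)[OF \<phi> assms(2)]
    by (intro has_derivative_linear[OF has_derivative_fst])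
  moreover have nz: "v = 0" if "fst (dirderiv v \<phi> x) = 0" for v
  proof -
    have "dirderiv v \<phi> x = 0"
      using that height_zero(1)[OF assms(2) zero, of v] by (simp add: prod_eq_iff)
    moreover have "frechet_derivative \<phi> (at x) 0 = 0"
      using linear_0[OF has_derivative_linear[OF Ck_on_SucD(1)[OF \<phi> assms(2)]]] .
    ultimately have "frechet_derivative \<phi> (at x) v = frechet_derivative \<phi> (at x) 0"
      by (simp add: dirderiv_def)
    then show ?thesis by (rule injD[OF inj])
  qed
  ultimately have "surj (\<lambda>v. fst (dirderiv v \<phi> x))"
    by (intro linear_injective_imp_surjective) (auto simp: linear_injective_0)
  from surjD[OF this, of w] show "\<exists>v. fst (dirderiv v \<phi> x) = w" by force
  show "v \<noteq> 0 \<Longrightarrow> fst (dirderiv v \<phi> x) \<noteq> 0" using nz by blast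
qed

lemma spacelike_graph:
  assumes "open H" "Ck_on (Suc (Suc 0)) u H" and grad: "\<And>z. z \<in> H \<Longrightarrow> norm (grad u z) < 1"
    and loc: "local_parameterization (graph_over H u) W \<phi>" and x: "x \<in> W"
  shows "spacelike_at \<phi> x"
  unfolding spacelike_at_def
proof (intro allI impI)
  fix v :: complex assume "v \<noteq> 0"
  note so = surface_over_graph[OF assms(1,2) loc]
  interpret surface_over \<phi> W H u by (rule so)
  have "inj (frechet_derivative \<phi> (at x))" using loc x by (simp add: local_parameterization_def)
  from tangent_plane_onto(1)[OF so(1) x so(2) this \<open>v \<noteq> 0\<close>]
  have z: "fst (dirderiv v \<phi> x) \<noteq> 0" .
  have tangent: "snd (dirderiv v \<phi> x) = grad u (fst (\<phi> x)) \<bullet> fst (dirderiv v \<phi> x)" for v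
    by (rule height_zero(1)[OF x so(2)])
  have "\<bar>grad u (fst (\<phi> x)) \<bullet> fst (dirderiv v \<phi> x)\<bar> \<le> norm (grad u (fst (\<phi> x))) * norm (fst (dirderiv v \<phi> x))"
    by (rule Cauchy_Schwarz_ineq2)
  also have "\<dots> < norm (fst (dirderiv v \<phi> x))"
    using grad[OF over[OF x]] z by simp
  finally have "(grad u (fst (\<phi> x)) \<bullet> fst (dirderiv v \<phi> x))\<^sup>2 < (norm (fst (dirderiv v \<phi> x)))\<^sup>2"
    by (simp add: abs_less_iff power2_strict_mono)
  then show "lorentz (dirderiv v \<phi> x) (dirderiv v \<phi> x) > 0"
    unfolding lorentz_tangent[OF tangent] dot_square_norm power2_eq_square by simp
qed

text \<open>Since the tangent vectors project onto the plane, every normal is a multiple of \<open>(grad u, 1)\<close>.\<close>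

lemma zero_mean_curvature_graph:
  assumes "open H" "Ck_on (Suc (Suc 0)) u H" and op: "\<And>z. z \<in> H \<Longrightarrow> graph_operator u z = 0"
  shows "zero_mean_curvature (graph_over H u)"
  unfolding zero_mean_curvature_def
proof (intro allI impI ballI)
  fix W \<phi> x N
  assume loc: "local_parameterization (graph_over H u) W \<phi>" and x: "x \<in> W" and N: "unit_normal \<phi> x N"
  note so = surface_over_graph[OF assms(1,2) loc]
  interpret surface_over \<phi> W H u by (rule so)
  let ?p = "grad u (fst (\<phi> x))"
  have "inj (frechet_derivative \<phi> (at x))" using loc x by (simp add: local_parameterization_def)
  note onto = tangent_plane_onto(2)[OF so(1) x so(2) this]
  have tangent: "snd (dirderiv v \<phi> x) = ?p \<bullet> fst (dirderiv v \<phi> x)" for v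
    by (rule height_zero(1)[OF x so(2)])
  define n where "n = fst N - snd N *\<^sub>R ?p"
  have "n \<bullet> fst (dirderiv v \<phi> x) = 0" for v
    using N unfolding unit_normal_def lorentz_def tangent n_def by (simp add: inner_diff_left)
  then have "n \<bullet> n = 0" using onto by metis
  then have N: "N = (snd N *\<^sub>R ?p, snd N)" by (simp add: n_def prod_eq_iff)
  have sff: "lorentz (second_derivative \<phi> x v w) N =
      - snd N * second_derivative u (fst (\<phi> x)) (fst (dirderiv v \<phi> x)) (fst (dirderiv w \<phi> x))" for v w
    using second_fundamental_form_height[OF x, of v w "snd N"] height_zero(2)[OF x so(2)] N by simp
  note tr = trace_second_derivative[OF x tangent, unfolded op[OF over[OF x]] mult_zero_right]
  have "lorentz (second_derivative \<phi> x 1 1) N * lorentz (dirderiv \<i> \<phi> x) (dirderiv \<i> \<phi> x)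
      - 2 * lorentz (second_derivative \<phi> x 1 \<i>) N * lorentz (dirderiv 1 \<phi> x) (dirderiv \<i> \<phi> x)
      + lorentz (second_derivative \<phi> x \<i> \<i>) N * lorentz (dirderiv 1 \<phi> x) (dirderiv 1 \<phi> x)
      = - snd N * 0"
    unfolding sff tr[symmetric] by (simp add: algebra_simps)
  then show "mean_curvature \<phi> x N = 0"
    unfolding mean_curvature_def Let_def by (simp add: second_derivative_def dirderiv_def[abs_def])
qed

section \<open>Comparison with a graph of zero mean curvature\<close>

lemma Ck_on_exp_scaled: "Ck_on k (\<lambda>t::real. a * exp (b * t)) UNIV"
proof (induction k arbitrary: a)
  case 0
  then show ?case by (auto intro!: continuous_intros)
next
  case (Suc k)
  show ?case
  proof (rule Ck_on_SucI)
    show "((\<lambda>t. a * exp (b * t)) has_derivative (\<lambda>v. v * (a * b * exp (b * t)))) (at t)" for t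
      by (auto intro!: derivative_eq_intros)
    show "Ck_on k (\<lambda>t. v * (a * b * exp (b * t))) UNIV" for v
      using Suc[of "v * (a * b)"] by (simp add: mult.assoc)
  qed auto
qed

text \<open>Adding a function of \<open>Re z\<close> alone leaves the imaginary part of the gradient alone, and hence the
  coefficient \<open>1 - (Im (grad u z))\<^sup>2\<close> of the second derivative that it changes.\<close>

lemma graph_operator_perturbed:
  fixes a b :: real
  assumes H: "open H" "z \<in> H" and u: "Ck_on (Suc (Suc 0)) u H"
  defines "u' \<equiv> \<lambda>z. u z + a * exp (b * Re z)"
  shows "Ck_on (Suc (Suc 0)) u' H"
    and "graph_operator u' z =
      (1 - (Im (grad u z))\<^sup>2) * (second_derivative u z 1 1 + a * b\<^sup>2 * exp (b * Re z))
      + 2 * (Re (grad u z) + a * b * exp (b * Re z)) * Im (grad u z) * second_derivative u z 1 \<i>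
      + (1 - (Re (grad u z) + a * b * exp (b * Re z))\<^sup>2) * second_derivative u z \<i> \<i>"
proof -
  have "Ck_on (Suc (Suc 0)) (\<lambda>z. a * exp (b * Re z)) H"
    by (rule Ck_on_compose[OF H(1) open_UNIV Ck_on_linear_self[OF bounded_linear_Re H(1)] Ck_on_exp_scaled]) auto
  then show "Ck_on (Suc (Suc 0)) u' H"
    unfolding u'_def by (rule Ck_on_add[OF H(1) u])
  have D: "(u' has_derivative (\<lambda>v. frechet_derivative u (at y) v + a * b * exp (b * Re y) * Re v)) (at y)"
    if "y \<in> H" for y
    unfolding u'_def
    by (rule has_derivative_add[OF Ck_on_SucD(1)[OF u that]]) (auto intro!: derivative_eq_intros)
  have g: "grad u' z = grad u z + of_real (a * b * exp (b * Re z))"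
    by (simp add: grad_def complex_eq_iff frechet_derivative_at[OF D[OF H(2)], symmetric])
  have s: "second_derivative u' z v w = second_derivative u z v w + a * b * (b * exp (b * Re z) * Re v) * Re w" for v w
    by (rule second_derivative_eqI[OF H D])
       (auto intro!: has_derivative_add[OF has_second_derivative[OF u H(2)]] derivative_eq_intros)
  show "graph_operator u' z =
      (1 - (Im (grad u z))\<^sup>2) * (second_derivative u z 1 1 + a * b\<^sup>2 * exp (b * Re z))
      + 2 * (Re (grad u z) + a * b * exp (b * Re z)) * Im (grad u z) * second_derivative u z 1 \<i>
      + (1 - (Re (grad u z) + a * b * exp (b * Re z))\<^sup>2) * second_derivative u z \<i> \<i>"
    unfolding graph_operator_def g s by (simp add: power2_eq_square mult.assoc)
qed

text \<open>The perturbation adds \<open>- s e\<close> to the first derivative and \<open>- s e l\<close> to the second one in the real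
  direction. Of the resulting change only the term \<open>- e l (1 - (Im p)\<^sup>2)\<close> grows with \<open>l\<close>; the others
  are at most \<open>e B\<close>.\<close>

lemma graph_operator_perturbed_neg:
  fixes p :: complex and a b c s e X Y Z B l :: real
  assumes op: "(1 - (Im p)\<^sup>2) * X + 2 * Re p * Im p * Y + (1 - (Re p)\<^sup>2) * Z = 0"
    and p: "norm p < 1" and c: "c \<le> 1 - (Im p)\<^sup>2" and B: "2 * \<bar>Y\<bar> + 3 * \<bar>Z\<bar> \<le> B"
    and s: "s = 1 \<or> s = - 1" and e: "0 < e" "e \<le> 1" and l: "l > 0" "B < l * c"
  shows "s * ((1 - (Im p)\<^sup>2) * (X - s * e * l) + 2 * (Re p - s * e) * Im p * Y + (1 - (Re p - s * e)\<^sup>2) * Z) < 0"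
proof -
  have ss: "s * s = 1" using s by auto
  have "\<bar>Re p\<bar> \<le> 1" "\<bar>Im p\<bar> \<le> 1"
    using abs_Re_le_cmod[of p] abs_Im_le_cmod[of p] p by linarith+
  have i1: "- (Im p * Y) \<le> \<bar>Y\<bar>"
  proof -
    have "\<bar>Im p\<bar> * \<bar>Y\<bar> \<le> \<bar>Y\<bar>" using \<open>\<bar>Im p\<bar> \<le> 1\<close> by (simp add: mult_left_le_one_le)
    then show ?thesis using abs_le_D2[of "Im p * Y" "\<bar>Y\<bar>"] by (simp add: abs_mult)
  qed
  have i2: "Re p * Z \<le> \<bar>Z\<bar>"
  proof -
    have "\<bar>Re p\<bar> * \<bar>Z\<bar> \<le> \<bar>Z\<bar>" using \<open>\<bar>Re p\<bar> \<le> 1\<close> by (simp add: mult_left_le_one_le)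
    then show ?thesis using abs_le_D1[of "Re p * Z" "\<bar>Z\<bar>"] by (simp add: abs_mult)
  qed
  have i3: "- (s * e * Z) \<le> \<bar>Z\<bar>"
  proof -
    have "e * \<bar>Z\<bar> \<le> \<bar>Z\<bar>" using e by (simp add: mult_left_le_one_le)
    moreover have "- (s * e * Z) \<le> e * \<bar>Z\<bar>"
      using s e by (auto simp: abs_if mult_less_0_iff)
    ultimately show ?thesis by simp
  qed
  have "l * c \<le> l * (1 - (Im p)\<^sup>2)" using c l by simp
  then have neg: "- l * (1 - (Im p)\<^sup>2) - 2 * (Im p * Y) + 2 * (Re p * Z) - s * e * Z < 0"
    using i1 i2 i3 B l by linarith
  have "s * ((1 - (Im p)\<^sup>2) * (X - s * e * l) + 2 * (Re p - s * e) * Im p * Y + (1 - (Re p - s * e)\<^sup>2) * Z)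
    = s * ((1 - (Im p)\<^sup>2) * X + 2 * Re p * Im p * Y + (1 - (Re p)\<^sup>2) * Z)
      + (s * s) * e * (- l * (1 - (Im p)\<^sup>2) - 2 * (Im p * Y) + 2 * (Re p * Z) - s * e * Z)"
    by (simp add: algebra_simps power2_eq_square)
  also have "\<dots> = e * (- l * (1 - (Im p)\<^sup>2) - 2 * (Im p * Y) + 2 * (Re p * Z) - s * e * Z)"
    unfolding op ss by simp
  also have "\<dots> < 0" using neg e by (simp add: mult_pos_neg)
  finally show ?thesis .
qed

text \<open>If the height over the graph were positive somewhere, a small multiple of \<open>exp (l * Re z)\<close>
  could be added to it without moving its maximum to the boundary contour. At the maximum the surface
  touches the graph of the perturbed function from one side, while for large \<open>l\<close> the second derivative
  of the perturbation dominates its gradient and makes the mean curvature of that graph have the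
  wrong sign. The sign \<open>s\<close> treats both sides at once.\<close>

lemma height_nonpos_comparison:
  fixes s :: real
  assumes s: "s = 1 \<or> s = - 1"
    and S: "spacelike_surface S" "zero_mean_curvature S" "compact (closure S)"
    and over: "\<And>q. q \<in> S \<Longrightarrow> fst q \<in> H"
    and U: "continuous_on (closure S) (height U)" "\<And>q. q \<in> closure S - S \<Longrightarrow> height U q = 0"
    and H: "open H" and uU: "\<And>z. z \<in> H \<Longrightarrow> U z = u z" and u: "Ck_on (Suc (Suc 0)) u H"
    and grad: "\<And>z. z \<in> H \<Longrightarrow> norm (grad u z) < 1"
    and op: "\<And>z. z \<in> H \<Longrightarrow> graph_operator u z = 0"
    and q0: "q0 \<in> S"
  shows "s * height U q0 \<le> 0"
proof (rule ccontr)
  assume "\<not> s * height U q0 \<le> 0"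
  define M where "M = s * height U q0"
  have M: "M > 0" using \<open>\<not> s * height U q0 \<le> 0\<close> by (simp add: M_def)
  have q0C: "q0 \<in> closure S" using q0 closure_subset by blast
  \<comment> \<open>The maximum of the perturbed height will lie in this compact part of the surface.\<close>
  define K where "K = {q \<in> closure S. M / 2 \<le> s * height U q}"
  have contD: "continuous_on (closure S) (\<lambda>q. s * height U q)"
    by (intro continuous_intros U)
  have KS: "K \<subseteq> S"
    using U(2) M by (force simp: K_def)
  have "closedin (top_of_set (closure S)) (closure S \<inter> (\<lambda>q. s * height U q) -` {M / 2..})"
    by (rule continuous_closedin_preimage[OF contD]) auto
  then have "compact (closure S \<inter> (\<lambda>q. s * height U q) -` {M / 2..})"
    by (rule closedin_compact[OF S(3)])
  also have "closure S \<inter> (\<lambda>q. s * height U q) -` {M / 2..} = K" by (auto simp: K_def)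
  finally have "compact (fst ` K)" by (intro compact_continuous_image continuous_intros)
  moreover have fK: "fst ` K \<subseteq> H" using KS over by auto
  moreover have "q0 \<in> K" using q0C M by (simp add: K_def M_def)
  then have "fst ` K \<noteq> {}" by auto
  ultimately have cmax: "\<exists>x\<in>fst ` K. \<forall>y\<in>fst ` K. f y \<le> f x" if "continuous_on H f" for f :: "complex \<Rightarrow> real"
    by (intro continuous_attains_sup continuous_on_subset[OF that]) auto
  have second: "continuous_on H (\<lambda>z. second_derivative u z v w)" for v w
    using Ck_on_SucD(2)[OF Ck_on_SucD(2)[OF u]] by (simp add: second_derivative_def)
  have first: "continuous_on H (\<lambda>z. frechet_derivative u (at z) v)" for v
    using Ck_on_Suc_imp[OF Ck_on_SucD(2)[OF u]] by simp
  have "continuous_on H (\<lambda>z. (Im (grad u z))\<^sup>2)"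
    unfolding grad_def complex.sel by (intro continuous_intros first)
  from cmax[OF this] obtain zc where zc: "zc \<in> fst ` K" "\<forall>y\<in>fst ` K. (Im (grad u y))\<^sup>2 \<le> (Im (grad u zc))\<^sup>2"
    by blast
  define c where "c = 1 - (Im (grad u zc))\<^sup>2"
  have "\<bar>Im (grad u zc)\<bar> < 1"
    using abs_Im_le_cmod[of "grad u zc"] grad[of zc] zc(1) fK by force
  then have c: "c > 0" by (simp add: c_def abs_square_less_1)
  have "continuous_on H (\<lambda>y. 2 * \<bar>second_derivative u y 1 \<i>\<bar> + 3 * \<bar>second_derivative u y \<i> \<i>\<bar>)"
    by (intro continuous_intros second)
  from cmax[OF this] obtain zB where zB: "\<forall>y\<in>fst ` K.
      2 * \<bar>second_derivative u y 1 \<i>\<bar> + 3 * \<bar>second_derivative u y \<i> \<i>\<bar>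
      \<le> 2 * \<bar>second_derivative u zB 1 \<i>\<bar> + 3 * \<bar>second_derivative u zB \<i> \<i>\<bar>"
    by blast
  define B where "B = 2 * \<bar>second_derivative u zB 1 \<i>\<bar> + 3 * \<bar>second_derivative u zB \<i> \<i>\<bar>"
  \<comment> \<open>The bounds over the compact set \<open>fst ` K\<close> fix \<open>l\<close>; only then \<open>d\<close> is chosen, so small that the
    perturbation is at most \<open>M / 4\<close> and its first derivative at most \<open>1\<close>.\<close>
  define l where "l = B / c + 1"
  have B: "B \<ge> 0" by (simp add: B_def)
  have l: "l > 0" "B < l * c" using B c by (auto simp: l_def field_simps add_nonneg_pos)
  have "bounded ((\<lambda>q. Re (fst q)) ` closure S)"
    by (intro compact_imp_bounded compact_continuous_image continuous_intros S(3))
  then obtain R where R: "\<And>q. q \<in> closure S \<Longrightarrow> \<bar>Re (fst q)\<bar> \<le> R"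
    by (auto simp: bounded_iff)
  define d where "d = min (M / 4) (1 / l) * exp (- (l * R))"
  have d: "d > 0" using M l by (simp add: d_def)
  have dexp: "d * exp (l * Re (fst q)) \<le> min (M / 4) (1 / l)" if "q \<in> closure S" for q
  proof -
    have "l * Re (fst q) \<le> l * R" using R[OF that] l by simp
    then have "d * exp (l * Re (fst q)) \<le> d * exp (l * R)" using d by simp
    also have "\<dots> = min (M / 4) (1 / l)" by (simp add: d_def exp_minus)
    finally show ?thesis .
  qed
  let ?f = "\<lambda>q. s * height U q + d * exp (l * Re (fst q))"
  define f where "f = ?f"
  have contf: "continuous_on (closure S) f" unfolding f_def by (intro continuous_intros contD)
  have "closure S \<noteq> {}" using q0 by auto
  from continuous_attains_sup[OF S(3) this contf]
  obtain q where q: "q \<in> closure S" "\<forall>q'\<in>closure S. f q' \<le> f q" by blast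
  then have q: "q \<in> closure S" "\<And>q'. q' \<in> closure S \<Longrightarrow> ?f q' \<le> ?f q"
    by (simp_all add: f_def)
  have "M + d * exp (l * Re (fst q0)) \<le> ?f q" using q(2)[OF q0C] by (simp add: M_def)
  moreover have "d * exp (l * Re (fst q0)) > 0" using d by simp
  moreover have "d * exp (l * Re (fst q)) \<le> M / 4" using dexp[OF q(1)] by simp
  ultimately have "M / 2 \<le> s * height U q" using M by linarith
  then have qK: "q \<in> K" using q(1) by (simp add: K_def)
  then have qS: "q \<in> S" using KS by blast
  then obtain W \<phi> where loc: "local_parameterization S W \<phi>" and "q \<in> \<phi> ` W"
    using S(1) unfolding spacelike_surface_def regular_surface_def by blast
  then obtain x where x: "x \<in> W" "\<phi> x = q" by blast
  have \<phi>S: "\<phi> y \<in> S" if "y \<in> W" for y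
    using loc that openin_imp_subset unfolding local_parameterization_def by blast
  define u' where "u' = (\<lambda>z. u z + - s * d * exp (l * Re z))"
  note pert = graph_operator_perturbed[OF H over[OF qS] u, of "- s * d" l, folded u'_def]
  have so: "surface_over \<phi> W H u'"
    using loc \<phi>S over H pert(1) by (auto simp: surface_over_def local_parameterization_def smooth_on_def)
  have ss: "s * s = 1" using s by auto
  have hf: "s * height u' q' = ?f q'" if "q' \<in> S" for q'
  proof -
    have "s * height u' q' = s * height U q' + (s * s) * (d * exp (l * Re (fst q')))"
      by (simp add: height_def u'_def uU[OF over[OF that]] algebra_simps)
    then show ?thesis unfolding ss by simp
  qed
  have ge: "s * graph_operator u' (fst (\<phi> x)) \<ge> 0"
  proof (rule surface_over.graph_operator_at_extremum[OF so x(1)])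
    show "spacelike_at \<phi> x" using S(1) loc x(1) unfolding spacelike_surface_def by blast
    show "mean_curvature \<phi> x N = 0" if "unit_normal \<phi> x N" for N
      using S(2) loc x(1) that unfolding zero_mean_curvature_def by blast
    show "s \<noteq> 0" using s by auto
    fix y assume "y \<in> W"
    then have y: "\<phi> y \<in> S" "\<phi> y \<in> closure S" using \<phi>S closure_subset by auto
    show "s * height u' (\<phi> y) \<le> s * height u' (\<phi> x)"
      using q(2)[OF y(2)] hf[OF y(1)] hf[OF qS] x(2) by simp
  qed
  define e where "e = d * l * exp (l * Re (fst q))"
  have e0: "e > 0" using d l by (simp add: e_def)
  have "e = l * (d * exp (l * Re (fst q)))" by (simp add: e_def)
  also have "\<dots> \<le> l * (1 / l)" using dexp[OF q(1)] l by (intro mult_left_mono) auto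
  finally have e1: "e \<le> 1" using l by simp
  have eq: "- s * d * l\<^sup>2 * exp (l * Re (fst q)) = - s * e * l"
    "- s * d * l * exp (l * Re (fst q)) = - s * e"
    by (simp_all add: e_def power2_eq_square)
  have fq: "fst q \<in> fst ` K" using qK by (rule imageI)
  have "s * graph_operator u' (fst q) =
      s * ((1 - (Im (grad u (fst q)))\<^sup>2) * (second_derivative u (fst q) 1 1 - s * e * l)
      + 2 * (Re (grad u (fst q)) - s * e) * Im (grad u (fst q)) * second_derivative u (fst q) 1 \<i>
      + (1 - (Re (grad u (fst q)) - s * e)\<^sup>2) * second_derivative u (fst q) \<i> \<i>)"
    unfolding pert(2) eq by simp
  also have "\<dots> < 0"
  proof (rule graph_operator_perturbed_neg[OF _ grad[OF over[OF qS]] _ _ s e0 e1 l])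
    show "(1 - (Im (grad u (fst q)))\<^sup>2) * second_derivative u (fst q) 1 1
      + 2 * Re (grad u (fst q)) * Im (grad u (fst q)) * second_derivative u (fst q) 1 \<i>
      + (1 - (Re (grad u (fst q)))\<^sup>2) * second_derivative u (fst q) \<i> \<i> = 0"
      using op[OF over[OF qS]] by (simp only: graph_operator_def)
    show "c \<le> 1 - (Im (grad u (fst q)))\<^sup>2"
      using bspec[OF zc(2) fq] by (simp add: c_def)
    show "2 * \<bar>second_derivative u (fst q) 1 \<i>\<bar> + 3 * \<bar>second_derivative u (fst q) \<i> \<i>\<bar> \<le> B"
      using bspec[OF zB fq] by (simp add: B_def)
  qed
  finally have "s * graph_operator u' (fst q) < 0" .
  then show False using ge x(2) by simp
qed

text \<open>A space-like tangent plane contains no vertical vector.\<close>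

lemma spacelike_surface_fst_interior:
  assumes "spacelike_surface S" "p \<in> S"
  shows "fst p \<in> interior (fst ` S)"
proof -
  obtain W \<phi> where loc: "local_parameterization S W \<phi>" and "p \<in> \<phi> ` W"
    using assms unfolding spacelike_surface_def regular_surface_def by blast
  then obtain x where x: "x \<in> W" "p = \<phi> x" by blast
  have W: "open W" and C: "Ck_on (Suc 0) \<phi> W"
    using loc by (simp_all add: local_parameterization_def smooth_on_def)
  have sub: "\<phi> ` W \<subseteq> S"
    using loc openin_imp_subset unfolding local_parameterization_def by blast
  have sp: "spacelike_at \<phi> x" using assms(1) loc x(1) unfolding spacelike_surface_def by blast
  define L where "L v = fst (frechet_derivative \<phi> (at x) v)" for v
  have D: "((\<lambda>y. fst (\<phi> y)) has_derivative L) (at x)"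
    unfolding L_def by (rule has_derivative_fst[OF Ck_on_SucD(1)[OF C x(1)]])
  have lin: "linear L" by (rule has_derivative_linear[OF D])
  have "v = 0" if "L v = 0" for v
  proof (rule ccontr)
    assume "v \<noteq> 0"
    then have "lorentz (dirderiv v \<phi> x) (dirderiv v \<phi> x) > 0" using sp by (simp add: spacelike_at_def)
    then show False
      using that zero_le_square[of "snd (dirderiv v \<phi> x)"] by (simp add: lorentz_def L_def dirderiv_def)
  qed
  then have "inj L" using linear_injective_0[OF lin] by blast
  from linear_surjective_right_inverse[OF lin linear_injective_imp_surjective[OF lin this]]
  obtain g where g: "linear g" "L \<circ> g = id" by auto
  have "(\<lambda>y. fst (\<phi> y)) x \<in> interior ((\<lambda>y. fst (\<phi> y)) ` W)"
  proof (rule sussmann_open_mapping[OF W _ x(1) D _ g(2)])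
    show "continuous_on W (\<lambda>y. fst (\<phi> y))"
      using Ck_on_Suc_imp[OF C] by (auto intro: continuous_on_fst)
    show "bounded_linear g" using g(1) by (simp add: linear_conv_bounded_linear)
    show "x \<in> interior W" using W x(1) by (simp add: interior_open)
  qed auto
  moreover have "(\<lambda>y. fst (\<phi> y)) ` W \<subseteq> fst ` S" using sub by auto
  ultimately show ?thesis using interior_mono x(2) by blast
qed

text \<open>A linear function of the first coordinate has no maximum on a space-like surface, since the
  surface projects to an open set. So its maximum over the closure lies on the contour.\<close>

lemma spacelike_surface_below_support:
  fixes a :: complex
  assumes S: "spacelike_surface S" "compact (closure S)" and a: "a \<noteq> 0"
    and bd: "\<And>q. q \<in> closure S - S \<Longrightarrow> a \<bullet> fst q \<le> r" and q: "q \<in> S"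
  shows "a \<bullet> fst q < r"
proof -
  have step: "\<exists>q'\<in>S. a \<bullet> fst p < a \<bullet> fst q'" if p: "p \<in> S" for p
  proof -
    obtain e where e: "e > 0" "ball (fst p) e \<subseteq> fst ` S"
      using spacelike_surface_fst_interior[OF S(1) p] by (auto simp: mem_interior)
    define t where "t = e / (2 * norm a)"
    have t: "t > 0" using e a by (simp add: t_def)
    have "norm (t *\<^sub>R a) < e" using e a by (simp add: t_def)
    then have "fst p + t *\<^sub>R a \<in> ball (fst p) e" by (simp add: dist_norm)
    then obtain q' where "q' \<in> S" "fst q' = fst p + t *\<^sub>R a" using e(2) by (metis imageE subsetD)
    moreover have "a \<bullet> (t *\<^sub>R a) > 0" using t a by simp
    ultimately show ?thesis by (intro bexI[of _ q']) (auto simp: inner_add_right)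
  qed
  have "continuous_on (closure S) (\<lambda>q. a \<bullet> fst q)" by (intro continuous_intros)
  moreover have "closure S \<noteq> {}" using q by auto
  ultimately obtain m where m: "m \<in> closure S" "\<forall>q'\<in>closure S. a \<bullet> fst q' \<le> a \<bullet> fst m"
    using continuous_attains_sup[OF S(2)] by blast
  have "m \<notin> S"
  proof
    assume "m \<in> S"
    from step[OF this] obtain q' where "q' \<in> S" "a \<bullet> fst m < a \<bullet> fst q'" by blast
    then show False using m(2) closure_subset[of S] by force
  qed
  with bd m(1) have mr: "a \<bullet> fst m \<le> r" by blast
  from step[OF q] obtain q' where q': "q' \<in> S" "a \<bullet> fst q < a \<bullet> fst q'" by blast
  have "a \<bullet> fst q' \<le> a \<bullet> fst m" using m(2) q'(1) closure_subset[of S] by blast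
  then show ?thesis using q'(2) mr by linarith
qed

text \<open>The supporting lines of \<open>H\<close> keep a competitor over \<open>H\<close>, and comparison from both sides puts it inside the
  graph. There it is open, because it projects to an open set, and closed, because its limit points
  outside itself lie on the contour, which does not meet the graph.\<close>

theorem spacelike_zero_mean_curvature_unique:
  fixes a :: "'i \<Rightarrow> complex" and r :: "'i \<Rightarrow> real"
  assumes H: "open H" and H_eq: "H = {z. \<forall>k\<in>I. a k \<bullet> z < r k}" and a: "\<And>k. k \<in> I \<Longrightarrow> a k \<noteq> 0"
    and u: "Ck_on (Suc (Suc 0)) u H" and grad: "\<And>z. z \<in> H \<Longrightarrow> norm (grad u z) < 1"
    and op: "\<And>z. z \<in> H \<Longrightarrow> graph_operator u z = 0"
    and bd1: "has_boundary_contour (graph_over H u) \<Gamma>" and \<Gamma>: "inj_on fst \<Gamma>" "\<Gamma> \<noteq> {}"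
    and S: "spacelike_surface S" "zero_mean_curvature S" and bd2: "has_boundary_contour S \<Gamma>"
  shows "S = graph_over H u"
proof -
  define S1 where "S1 = graph_over H u"
  have b1: "bounded S1" "connected S1" "closure S1 - S1 = \<Gamma>"
    and b2: "bounded S" "connected S" "closure S - S = \<Gamma>"
    using bd1 bd2 by (simp_all add: has_boundary_contour_def S1_def)
  have cp1: "compact (closure S1)" and cp2: "compact (closure S)"
    using b1(1) b2(1) by (simp_all add: compact_closure)
  have contu: "continuous_on H u"
    using Ck_on_Suc_imp[OF Ck_on_Suc_imp[OF u]] by simp
  have inS1: "q \<in> S1" if "q \<in> closure S1" "fst q \<in> H" for q
  proof -
    from that(1) obtain x where x: "\<forall>n. x n \<in> S1" "x \<longlonglongrightarrow> q"
      unfolding closure_sequential by blast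
    have "(\<lambda>n. u (fst (x n))) \<longlonglongrightarrow> u (fst q)"
      using continuous_on_tendsto_compose[OF contu tendsto_fst[OF x(2)] that(2)] x(1)
      by (simp add: S1_def graph_over_iff)
    moreover have "u (fst (x n)) = snd (x n)" for n
      using x(1) by (simp add: S1_def graph_over_iff height_def)
    ultimately have "(\<lambda>n. snd (x n)) \<longlonglongrightarrow> u (fst q)" by simp
    with tendsto_snd[OF x(2)] have "snd q = u (fst q)" using LIMSEQ_unique by blast
    then show ?thesis using that(2) by (simp add: S1_def graph_over_iff height_def)
  qed
  have \<Gamma>H: "fst q \<notin> H" if "q \<in> \<Gamma>" for q
    using inS1 that b1(3) by blast
  have support: "a k \<bullet> fst q \<le> r k" if "q \<in> closure S1" "k \<in> I" for q k
  proof -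
    have "closed {q :: complex \<times> real. a k \<bullet> fst q \<le> r k}"
      by (intro closed_Collect_le continuous_intros)
    moreover have "S1 \<subseteq> {q. a k \<bullet> fst q \<le> r k}"
      using that(2) by (force simp: S1_def graph_over_iff H_eq)
    ultimately show ?thesis using closure_minimal that(1) by blast
  qed
  have over: "fst q \<in> H" if "q \<in> S" for q
    unfolding H_eq
  proof (intro CollectI ballI)
    fix k assume k: "k \<in> I"
    show "a k \<bullet> fst q < r k"
    proof (rule spacelike_surface_below_support[OF S(1) cp2 a[OF k] _ that])
      fix p assume "p \<in> closure S - S"
      then have "p \<in> closure S1" using b1(3) b2(3) by blast
      then show "a k \<bullet> fst p \<le> r k" using support k by blast
    qed
  qed
  \<comment> \<open>The closure of the graph is a compact graph, hence that of a continuous function.\<close>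
  have inj: "inj_on fst (closure S1)"
  proof (rule inj_onI)
    fix p q assume pq: "p \<in> closure S1" "q \<in> closure S1" "fst p = fst q"
    show "p = q"
    proof (cases "fst p \<in> H")
      case True
      then have "p \<in> S1" "q \<in> S1" using inS1 pq by auto
      then show ?thesis using pq(3) by (auto simp: S1_def graph_over_iff height_def prod_eq_iff)
    next
      case False
      then have "p \<notin> S1" "q \<notin> S1" using pq(3) by (auto simp: S1_def graph_over_iff)
      then have "p \<in> \<Gamma>" "q \<in> \<Gamma>" using pq(1,2) b1(3) by blast+
      then show ?thesis using \<Gamma>(1) pq(3) by (simp add: inj_on_eq_iff)
    qed
  qed
  define v where "v = inv_into (closure S1) fst"
  define U where "U z = snd (v z)" for z
  have v: "v (fst q) = q" if "q \<in> closure S1" for q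
    unfolding v_def by (rule inv_into_f_f[OF inj that])
  have "continuous_on (fst ` closure S1) v"
    by (rule continuous_on_inv) (use cp1 v in \<open>auto intro: continuous_intros\<close>)
  then have contU: "continuous_on (fst ` closure S1) U"
    unfolding U_def by (intro continuous_on_snd)
  have Uu: "U z = u z" if "z \<in> H" for z
  proof -
    have "(z, u z) \<in> closure S1"
      using that closure_subset[of S1] by (auto simp: S1_def graph_over_def)
    from v[OF this] show ?thesis by (simp add: U_def)
  qed
  have U\<Gamma>: "height U q = 0" if "q \<in> closure S - S" for q
  proof -
    have "q \<in> closure S1" using that b1(3) b2(3) by blast
    from v[OF this] show ?thesis by (simp add: U_def height_def)
  qed
  have "fst ` closure S \<subseteq> fst ` closure S1"
  proof
    fix z assume "z \<in> fst ` closure S"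
    then obtain q where q: "q \<in> closure S" "z = fst q" by blast
    show "z \<in> fst ` closure S1"
    proof (cases "q \<in> S")
      case True
      then have "(z, u z) \<in> S1" using over q(2) by (auto simp: S1_def graph_over_def)
      then show ?thesis using closure_subset[of S1] by force
    next
      case False
      then have "q \<in> closure S1" using q(1) b1(3) b2(3) by blast
      then show ?thesis using q(2) by blast
    qed
  qed
  then have "continuous_on (closure S) (\<lambda>q. U (fst q))"
    by (intro continuous_on_compose2[OF contU]) (auto intro: continuous_intros)
  then have contD: "continuous_on (closure S) (height U)"
    unfolding height_def[abs_def] by (intro continuous_intros)
  have "height u q = 0" if "q \<in> S" for q
  proof -
    have "s * height U q \<le> 0" if "s = 1 \<or> s = - 1" for s
      by (rule height_nonpos_comparison[OF that S cp2 over contD U\<Gamma> H Uu u grad op \<open>q \<in> S\<close>])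
    from this[of 1] this[of "-1"] have "height U q = 0" by simp
    then show ?thesis using Uu[OF over[OF that]] by (simp add: height_def)
  qed
  then have SS1: "S \<subseteq> S1" using over by (auto simp: S1_def graph_over_iff)
  have "openin (top_of_set S1) S"
  proof -
    have "fst ` S \<subseteq> interior (fst ` S)"
      using spacelike_surface_fst_interior[OF S(1)] by blast
    then have "open (fst ` S)" by (simp add: interior_subset subset_antisym flip: interior_eq)
    then have "open (fst -` (fst ` S) :: (complex \<times> real) set)" by (rule open_vimage_fst)
    moreover have "S = S1 \<inter> fst -` (fst ` S)"
    proof
      show "S1 \<inter> fst -` (fst ` S) \<subseteq> S"
      proof
        fix q assume "q \<in> S1 \<inter> fst -` (fst ` S)"
        then obtain q' where q': "q \<in> S1" "q' \<in> S" "fst q = fst q'" by auto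
        then have "q = q'" using SS1 by (auto simp: S1_def graph_over_iff height_def prod_eq_iff)
        then show "q \<in> S" using q' by simp
      qed
    qed (use SS1 in auto)
    ultimately show ?thesis unfolding openin_open by blast
  qed
  moreover have "closedin (top_of_set S1) S"
  proof -
    have "S = S1 \<inter> closure S" using SS1 b1(3) b2(3) closure_subset[of S] by blast
    then show ?thesis unfolding closedin_closed by blast
  qed
  moreover have "S \<noteq> {}" using b2(3) \<Gamma>(2) by auto
  ultimately show ?thesis using b1(2) unfolding connected_clopen S1_def by blast
qed

section \<open>Harmonic extension of step functions to the upper half plane\<close>

lemma Im_Ln_upper:
  assumes "Im z > 0"
  shows "0 < Im (Ln z) \<and> Im (Ln z) < pi"
proof -
  have "z \<noteq> 0" using assms by auto
  from Im_Ln_pos_lt[OF this] show ?thesis using assms by simp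
qed

lemma Ln_uminus_upper:
  assumes "Im z > 0"
  shows "Ln (- z) = Ln z - \<i> * of_real pi"
  using assms by (subst Ln_minus) auto

lemma Ln_quotient_upper:
  assumes "Im a > 0" "Im b > 0"
  shows "Ln (a / b) = Ln a - Ln b"
proof -
  have "a \<noteq> 0" "b \<noteq> 0" using assms by auto
  then have "a / b = exp (Ln a - Ln b)" by (simp add: exp_diff)
  moreover have "Ln (exp (Ln a - Ln b)) = Ln a - Ln b"
    using Im_Ln_upper[OF assms(1)] Im_Ln_upper[OF assms(2)] by (intro Ln_exp) auto
  ultimately show ?thesis by simp
qed

text \<open>A point of the upper half plane sees points of the real line under angles that increase from left to
  right; \<open>Im (b / a)\<close> is the sine of the difference up to a positive factor.\<close>

lemma Im_Ln_less:
  assumes z: "Im z > 0" and pq: "p < q"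
  shows "Im (Ln (z - of_real p)) < Im (Ln (z - of_real q))"
proof -
  let ?a = "z - of_real p" and ?b = "z - of_real q"
  have ab: "Im ?a > 0" "Im ?b > 0" using z by simp_all
  have "Im (?b / ?a) = (q - p) * Im z / ((Re ?a)\<^sup>2 + (Im ?a)\<^sup>2)"
    by (simp add: Im_divide algebra_simps)
  also have "\<dots> > 0"
    using z pq by (intro divide_pos_pos mult_pos_pos) (auto intro: add_nonneg_pos)
  finally have "Im (?b / ?a) > 0" .
  from Im_Ln_upper[OF this] show ?thesis
    using Ln_quotient_upper[OF ab(2,1)] by simp
qed

lemma Im_Ln_tendsto_0:
  assumes "\<zeta> \<longlonglongrightarrow> of_real x" "p < x"
  shows "(\<lambda>k. Im (Ln (\<zeta> k - of_real p))) \<longlonglongrightarrow> 0"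
proof -
  have "(\<lambda>k. \<zeta> k - of_real p) \<longlonglongrightarrow> of_real x - of_real p"
    by (intro tendsto_intros assms)
  then have "(\<lambda>k. Ln (\<zeta> k - of_real p)) \<longlonglongrightarrow> Ln (of_real (x - p))"
    using assms(2) by (intro tendsto_Ln) (auto simp: complex_nonpos_Reals_iff)
  then have "(\<lambda>k. Im (Ln (\<zeta> k - of_real p))) \<longlonglongrightarrow> Im (Ln (of_real (x - p)))"
    by (rule tendsto_Im)
  then show ?thesis using assms(2) by (simp add: Ln_of_real del: of_real_diff)
qed

lemma Im_Ln_tendsto_pi:
  assumes "\<zeta> \<longlonglongrightarrow> of_real x" "x < p" "\<And>k. Im (\<zeta> k) > 0"
  shows "(\<lambda>k. Im (Ln (\<zeta> k - of_real p))) \<longlonglongrightarrow> pi"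
proof -
  have "(\<lambda>k. of_real p - \<zeta> k) \<longlonglongrightarrow> of_real (p - x)"
    using tendsto_diff[OF tendsto_const assms(1), of "of_real p"] by simp
  moreover have "complex_of_real (p - x) \<notin> \<real>\<^sub>\<le>\<^sub>0"
    unfolding nonpos_Reals_of_real_iff using assms(2) by simp
  ultimately have "(\<lambda>k. Ln (of_real p - \<zeta> k)) \<longlonglongrightarrow> Ln (of_real (p - x))"
    by (rule tendsto_Ln)
  then have "(\<lambda>k. Im (Ln (of_real p - \<zeta> k)) + pi) \<longlonglongrightarrow> Im (Ln (of_real (p - x))) + pi"
    by (rule tendsto_add[OF tendsto_Im tendsto_const])
  moreover have "Im (Ln (of_real p - \<zeta> k)) + pi = Im (Ln (\<zeta> k - of_real p))" for k
    using Ln_uminus_upper[of "\<zeta> k - of_real p"] assms(3)[of k] by simp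
  ultimately show ?thesis using assms(2) by (simp add: Ln_of_real del: of_real_diff)
qed

text \<open>Towards infinity the angles become equal because the quotient of \<open>\<zeta> - p\<close> and \<open>\<zeta> - q\<close> tends to
  \<open>1\<close>.\<close>

lemma Im_Ln_diff_tendsto_0:
  assumes "filterlim (\<lambda>k. norm (\<zeta> k)) at_top sequentially" "\<And>k. Im (\<zeta> k) > 0"
  shows "(\<lambda>k. Im (Ln (\<zeta> k - of_real p)) - Im (Ln (\<zeta> k - of_real q))) \<longlonglongrightarrow> 0"
proof -
  have "filterlim (\<lambda>k. \<zeta> k) at_infinity sequentially"
    using assms(1) by (simp add: filterlim_at_infinity_conv_norm_at_top)
  then have "filterlim (\<lambda>k. \<zeta> k + (- of_real q)) at_infinity sequentially"
    by (rule tendsto_add_filterlim_at_infinity'[OF _ tendsto_const])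
  then have "(\<lambda>k. of_real (q - p) / (\<zeta> k + (- of_real q))) \<longlonglongrightarrow> 0"
    by (rule tendsto_divide_0[OF tendsto_const])
  then have "(\<lambda>k. 1 + of_real (q - p) / (\<zeta> k + (- of_real q))) \<longlonglongrightarrow> 1 + 0"
    by (intro tendsto_intros)
  then have "(\<lambda>k. Im (Ln (1 + of_real (q - p) / (\<zeta> k + (- of_real q))))) \<longlonglongrightarrow> Im (Ln (1 + 0))"
    by (intro tendsto_Im tendsto_Ln) auto
  moreover have "Ln (1 + of_real (q - p) / (\<zeta> k + (- of_real q)))
      = Ln (\<zeta> k - of_real p) - Ln (\<zeta> k - of_real q)" for k
  proof -
    have "\<zeta> k - of_real q \<noteq> 0" using assms(2)[of k] by (auto simp: complex_eq_iff)
    then have "1 + of_real (q - p) / (\<zeta> k + (- of_real q)) = (\<zeta> k - of_real p) / (\<zeta> k - of_real q)"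
      by (simp add: field_simps)
    then show ?thesis using Ln_quotient_upper[of "\<zeta> k - of_real p" "\<zeta> k - of_real q"] assms(2)[of k] by simp
  qed
  ultimately show ?thesis by simp
qed

text \<open>The bounded harmonic function whose boundary values are \<open>U j\<close> between the consecutive
  jump points \<open>p j\<close> and \<open>p (j + 1)\<close>. The harmonic measure of such an interval is \<open>1 / \<pi>\<close> times the
  angle under which it is seen; the unbounded intervals are covered by the conventions
  \<open>angle 0 = 0\<close> and \<open>angle (n + 1) = \<pi>\<close>.\<close>

locale step_extension =
  fixes n :: nat and p :: "nat \<Rightarrow> real" and U :: "nat \<Rightarrow> 'a::real_normed_vector"
  assumes n: "n \<ge> 1" and p: "\<And>i j. 1 \<le> i \<Longrightarrow> i < j \<Longrightarrow> j \<le> n \<Longrightarrow> p i < p j"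
begin

definition angle :: "nat \<Rightarrow> complex \<Rightarrow> real" where
  "angle j \<zeta> = (if j = 0 then 0 else if j \<le> n then Im (Ln (\<zeta> - of_real (p j))) else pi)"

definition ext :: "complex \<Rightarrow> 'a" where
  "ext \<zeta> = (\<Sum>j<Suc n. ((angle (Suc j) \<zeta> - angle j \<zeta>) / pi) *\<^sub>R U j)"

definition contour :: "'a set" where
  "contour = (\<Union>j\<in>{1..n}. closed_segment (U (j - 1)) (U j)) \<union> closed_segment (U n) (U 0)"

lemma angle_less:
  assumes "Im \<zeta> > 0" "j \<le> n"
  shows "angle j \<zeta> < angle (Suc j) \<zeta>"
  using assms Im_Ln_upper[of "\<zeta> - of_real (p j)"] Im_Ln_upper[of "\<zeta> - of_real (p (Suc j))"] n
  by (auto simp: angle_def intro!: Im_Ln_less p)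

lemma sum_weights: "(\<Sum>j<Suc n. (angle (Suc j) \<zeta> - angle j \<zeta>) / pi) = 1"
proof -
  have "(\<Sum>j<Suc n. angle (Suc j) \<zeta> - angle j \<zeta>) = angle (Suc n) \<zeta> - angle 0 \<zeta>"
    by (rule sum_lessThan_telescope)
  also have "\<dots> = pi" by (simp add: angle_def)
  finally show ?thesis unfolding sum_divide_distrib[symmetric] by simp
qed

text \<open>All weights are positive, so a half space that contains the values \<open>U j\<close>, not all of them
  on its boundary, contains the extension in its interior.\<close>

lemma ext_in_half_space:
  fixes L :: "'a \<Rightarrow> real"
  assumes \<zeta>: "Im \<zeta> > 0" and L: "linear L" and le: "\<And>j. j \<le> n \<Longrightarrow> L (U j) \<le> r"
    and less: "i \<le> n" "L (U i) < r"
  shows "L (ext \<zeta>) < r"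
proof -
  let ?w = "\<lambda>j. (angle (Suc j) \<zeta> - angle j \<zeta>) / pi"
  have w: "?w j > 0" if "j < Suc n" for j
    using angle_less[OF \<zeta>, of j] that by simp
  have "L (ext \<zeta>) = (\<Sum>j<Suc n. ?w j * L (U j))"
    unfolding ext_def by (simp add: linear_sum[OF L] linear_cmul[OF L] del: sum.lessThan_Suc)
  also have "\<dots> < (\<Sum>j<Suc n. ?w j * r)"
  proof (rule sum_strict_mono_ex1)
    show "\<forall>j\<in>{..<Suc n}. ?w j * L (U j) \<le> ?w j * r"
      using w le by (intro ballI mult_left_mono) (auto intro: less_imp_le)
    show "\<exists>j\<in>{..<Suc n}. ?w j * L (U j) < ?w j * r"
      by (rule bexI[of _ i], rule mult_strict_left_mono) (use w less in auto)
  qed auto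
  also have "\<dots> = r" unfolding sum_distrib_right[symmetric] sum_weights by simp
  finally show ?thesis .
qed

lemma ext_tendsto:
  assumes "\<And>j. j \<le> Suc n \<Longrightarrow> (\<lambda>k. angle j (\<zeta> k)) \<longlonglongrightarrow> a j"
  shows "(\<lambda>k. ext (\<zeta> k)) \<longlonglongrightarrow> (\<Sum>j<Suc n. ((a (Suc j) - a j) / pi) *\<^sub>R U j)"
  unfolding ext_def by (intro tendsto_intros assms) auto

text \<open>Where all angles but one are extreme, only the weights on the two sides of that one survive.\<close>

lemma sum_one_jump:
  assumes m: "m \<in> {1..n}" and a: "\<And>j. j < m \<Longrightarrow> a j = 0" "\<And>j. m < j \<Longrightarrow> j \<le> Suc n \<Longrightarrow> a j = pi"
  shows "(\<Sum>j<Suc n. ((a (Suc j) - a j) / pi) *\<^sub>R U j) = (a m / pi) *\<^sub>R U (m - 1) + (1 - a m / pi) *\<^sub>R U m"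
proof -
  have "(\<Sum>j<Suc n. ((a (Suc j) - a j) / pi) *\<^sub>R U j) = (\<Sum>j\<in>{m - 1, m}. ((a (Suc j) - a j) / pi) *\<^sub>R U j)"
  proof (rule sum.mono_neutral_right)
    show "\<forall>j\<in>{..<Suc n} - {m - 1, m}. ((a (Suc j) - a j) / pi) *\<^sub>R U j = 0"
    proof
      fix j assume j: "j \<in> {..<Suc n} - {m - 1, m}"
      then consider "Suc j < m" | "m < j" by force
      then have "a (Suc j) = a j"
        using j a(1)[of j] a(1)[of "Suc j"] a(2)[of j] a(2)[of "Suc j"] by cases auto
      then show "((a (Suc j) - a j) / pi) *\<^sub>R U j = 0" by simp
    qed
  qed (use m in auto)
  also have "\<dots> = (a m / pi) *\<^sub>R U (m - 1) + (1 - a m / pi) *\<^sub>R U m"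
    using m a(1)[of "m - 1"] a(2)[of "Suc m"] by (auto simp: diff_divide_distrib)
  finally show ?thesis .
qed

lemma sum_jump_infinity:
  assumes "a 0 = 0" "\<And>j. j \<in> {1..n} \<Longrightarrow> a j = b" "a (Suc n) = pi"
  shows "(\<Sum>j<Suc n. ((a (Suc j) - a j) / pi) *\<^sub>R U j) = (b / pi) *\<^sub>R U 0 + (1 - b / pi) *\<^sub>R U n"
proof -
  have "(\<Sum>j<Suc n. ((a (Suc j) - a j) / pi) *\<^sub>R U j) = (\<Sum>j\<in>{0, n}. ((a (Suc j) - a j) / pi) *\<^sub>R U j)"
    by (rule sum.mono_neutral_right) (use assms(2) in auto)
  also have "\<dots> = (b / pi) *\<^sub>R U 0 + (1 - b / pi) *\<^sub>R U n"
    using n assms(1,3) assms(2)[of 1] assms(2)[of n] by (auto simp: diff_divide_distrib)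
  finally show ?thesis .
qed

lemma angle_tendsto_real:
  assumes \<zeta>: "\<zeta> \<longlonglongrightarrow> of_real x" "\<And>k. Im (\<zeta> k) > 0" and m: "m \<in> {1..n}"
    and x: "\<And>j. 1 \<le> j \<Longrightarrow> j < m \<Longrightarrow> p j < x" "x \<le> p m"
    and am: "(\<lambda>k. angle m (\<zeta> k)) \<longlonglongrightarrow> b"
  shows "(\<lambda>k. ext (\<zeta> k)) \<longlonglongrightarrow> (b / pi) *\<^sub>R U (m - 1) + (1 - b / pi) *\<^sub>R U m"
proof -
  define a where "a j = (if j < m then 0 else if j = m then b else pi)" for j
  have "(\<lambda>k. angle j (\<zeta> k)) \<longlonglongrightarrow> a j" if "j \<le> Suc n" for j
  proof -
    have "j = 0 \<or> (1 \<le> j \<and> j < m) \<or> j = m \<or> (m < j \<and> j \<le> n) \<or> j = Suc n"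
      using that by (cases "j < m"; cases "j = m") auto
    then consider "j = 0" | "1 \<le> j" "j < m" | "j = m" | "m < j" "j \<le> n" | "j = Suc n"
      by blast
    then show ?thesis
    proof cases
      case 2
      then show ?thesis using Im_Ln_tendsto_0[OF \<zeta>(1) x(1)[OF 2]] m by (simp add: a_def angle_def)
    next
      case 4
      have "x < p j" using x(2) p[of m j] 4 m by auto
      from Im_Ln_tendsto_pi[OF \<zeta>(1) this \<zeta>(2)] show ?thesis using 4 by (simp add: a_def angle_def)
    qed (use am m in \<open>auto simp: a_def angle_def\<close>)
  qed
  from ext_tendsto[OF this] show ?thesis
    using sum_one_jump[OF m, of a] by (simp add: a_def)
qed

lemma angle_tendsto_infinity:
  assumes \<zeta>: "filterlim (\<lambda>k. norm (\<zeta> k)) at_top sequentially" "\<And>k. Im (\<zeta> k) > 0"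
    and b: "(\<lambda>k. Im (Ln (\<zeta> k - of_real c))) \<longlonglongrightarrow> b"
  shows "(\<lambda>k. ext (\<zeta> k)) \<longlonglongrightarrow> (b / pi) *\<^sub>R U 0 + (1 - b / pi) *\<^sub>R U n"
proof -
  define a where "a j = (if j = 0 then 0 else if j \<le> n then b else pi)" for j
  have "(\<lambda>k. angle j (\<zeta> k)) \<longlonglongrightarrow> a j" if "j \<le> Suc n" for j
  proof (cases "j = 0 \<or> j = Suc n")
    case True
    then show ?thesis by (auto simp: a_def angle_def)
  next
    case False
    have "(\<lambda>k. (Im (Ln (\<zeta> k - of_real (p j))) - Im (Ln (\<zeta> k - of_real c))) + Im (Ln (\<zeta> k - of_real c)))
        \<longlonglongrightarrow> 0 + b"
      by (intro tendsto_add Im_Ln_diff_tendsto_0 \<zeta> b)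
    then show ?thesis using False that by (simp add: a_def angle_def)
  qed
  from ext_tendsto[OF this] show ?thesis
    using sum_jump_infinity[of a b] by (simp add: a_def)
qed

lemma convex_comb_in_segment:
  assumes "0 \<le> b" "b \<le> pi"
  shows "(b / pi) *\<^sub>R x + (1 - b / pi) *\<^sub>R y \<in> closed_segment x y"
  unfolding closed_segment_def using assms
  by (intro CollectI exI[of _ "1 - b / pi"]) auto

text \<open>At a boundary point that is not a jump point the extension converges to one of the values. At
  a jump point, and at infinity, one angle remains undetermined; every limit of it moves the value
  along the segment between the two adjacent values.\<close>

lemma ext_cluster:
  assumes \<zeta>: "\<And>k. Im (\<zeta> k) > 0"
  obtains r x where "strict_mono (r :: nat \<Rightarrow> nat)" "Im x > 0" "(\<lambda>k. \<zeta> (r k)) \<longlonglongrightarrow> x"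
    | r q where "strict_mono (r :: nat \<Rightarrow> nat)" "q \<in> contour" "(\<lambda>k. ext (\<zeta> (r k))) \<longlonglongrightarrow> q"
proof -
  have angle_conv: "\<exists>b r. b \<in> {0..pi} \<and> strict_mono (r :: nat \<Rightarrow> nat) \<and>
      (\<lambda>k. Im (Ln (\<zeta>' (r k) - of_real c))) \<longlonglongrightarrow> b" if "\<And>k. Im (\<zeta>' k) > 0" for \<zeta>' :: "nat \<Rightarrow> complex" and c
  proof -
    have "\<forall>k. Im (Ln (\<zeta>' k - of_real c)) \<in> {0..pi}"
      using Im_Ln_upper[of "\<zeta>' k - of_real c" for k] that by (auto intro: less_imp_le)
    with compact_Icc[of 0 pi, unfolded compact_def]
    obtain b r where "b \<in> {0..pi}" "strict_mono r" "((\<lambda>k. Im (Ln (\<zeta>' k - of_real c))) \<circ> r) \<longlonglongrightarrow> b"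
      by (metis (no_types, lifting))
    then show ?thesis by (auto simp: o_def)
  qed
  show thesis
  proof (cases "\<exists>r x. strict_mono (r :: nat \<Rightarrow> nat) \<and> (\<lambda>k. \<zeta> (r k)) \<longlonglongrightarrow> x")
    case True
    then obtain r x where r: "strict_mono (r :: nat \<Rightarrow> nat)" and x: "(\<lambda>k. \<zeta> (r k)) \<longlonglongrightarrow> x" by blast
    have "Im x \<ge> 0"
      by (rule LIMSEQ_le_const[OF tendsto_Im[OF x]]) (use \<zeta> in \<open>auto intro: less_imp_le\<close>)
    show thesis
    proof (cases "Im x > 0")
      case True
      then show thesis using that(1) r x by blast
    next
      case False
      then have xr: "x = of_real (Re x)" using \<open>Im x \<ge> 0\<close> by (simp add: complex_eq_iff)
      show thesis
      proof (cases "\<exists>j\<in>{1..n}. Re x \<le> p j")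
        case False
        have lim: "(\<lambda>k. \<zeta> (r k)) \<longlonglongrightarrow> of_real (Re x)" using x xr by simp
        define a where "a j = (if j \<le> n then 0 else pi)" for j
        have "(\<lambda>k. angle j (\<zeta> (r k))) \<longlonglongrightarrow> a j" if "j \<le> Suc n" for j
        proof (cases "j \<in> {1..n}")
          case True
          then have "p j < Re x" using False by force
          from Im_Ln_tendsto_0[OF lim this] show ?thesis using True by (simp add: a_def angle_def)
        qed (use that in \<open>auto simp: a_def angle_def\<close>)
        from ext_tendsto[OF this]
        have "(\<lambda>k. ext (\<zeta> (r k))) \<longlonglongrightarrow> U n"
          using sum_jump_infinity[of a 0] by (simp add: a_def)
        moreover have "U n \<in> contour" by (simp add: contour_def)
        ultimately show thesis using that(2) r by blast
      next
        case True
        define m where "m = (LEAST j. j \<in> {1..n} \<and> Re x \<le> p j)"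
        have "m \<in> {1..n} \<and> Re x \<le> p m"
          unfolding m_def by (rule LeastI_ex) (use True in blast)
        then have m: "m \<in> {1..n}" "Re x \<le> p m" by auto
        have lt: "p j < Re x" if "1 \<le> j" "j < m" for j
          using not_less_Least[of j "\<lambda>j. j \<in> {1..n} \<and> Re x \<le> p j"] that m by (auto simp: m_def)
        obtain b r' where b: "b \<in> {0..pi}" and r': "strict_mono (r' :: nat \<Rightarrow> nat)"
          and lim: "(\<lambda>k. Im (Ln (\<zeta> (r (r' k)) - of_real (p m)))) \<longlonglongrightarrow> b"
          using angle_conv[of "\<lambda>k. \<zeta> (r k)"] \<zeta> by blast
        have "(\<lambda>k. \<zeta> (r (r' k))) \<longlonglongrightarrow> of_real (Re x)"
          using LIMSEQ_subseq_LIMSEQ[OF x r'] xr by (simp add: o_def)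
        from angle_tendsto_real[OF this \<zeta> m(1) lt m(2), of b] lim m
        have "(\<lambda>k. ext (\<zeta> (r (r' k)))) \<longlonglongrightarrow> (b / pi) *\<^sub>R U (m - 1) + (1 - b / pi) *\<^sub>R U m"
          by (simp add: angle_def)
        moreover have "(b / pi) *\<^sub>R U (m - 1) + (1 - b / pi) *\<^sub>R U m \<in> contour"
          using convex_comb_in_segment[of b "U (m - 1)" "U m"] b m(1) by (auto simp: contour_def)
        ultimately show thesis using that(2)[of "\<lambda>k. r (r' k)"] strict_mono_o[OF r r'] by (simp add: o_def)
      qed
    qed
  next
    case False
    have "filterlim (\<lambda>k. norm (\<zeta> k)) at_top sequentially"
    proof (rule ccontr)
      assume "\<not> filterlim (\<lambda>k. norm (\<zeta> k)) at_top sequentially"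
      then obtain B where "\<not> (\<forall>\<^sub>F k in sequentially. B \<le> norm (\<zeta> k))"
        by (auto simp: filterlim_at_top)
      then have "infinite {k. norm (\<zeta> k) < B}"
        unfolding infinite_nat_iff_unbounded_le eventually_sequentially by (auto simp: not_le)
      then obtain s where s: "strict_mono (s :: nat \<Rightarrow> nat)" "\<And>k. norm (\<zeta> (s k)) < B"
        using infinite_enumerate by blast
      have "\<forall>k. \<zeta> (s k) \<in> cball 0 B" using s(2) by (auto intro: less_imp_le)
      with compact_cball[of "0 :: complex" B, unfolded compact_def]
      obtain x t where "strict_mono t" "((\<lambda>k. \<zeta> (s k)) \<circ> t) \<longlonglongrightarrow> x"
        by (metis (no_types, lifting))
      then have "strict_mono (s \<circ> t)" "(\<lambda>k. \<zeta> ((s \<circ> t) k)) \<longlonglongrightarrow> x"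
        using strict_mono_o[OF s(1)] by (auto simp: o_def)
      then show False using False by blast
    qed
    note top = this
    obtain b r where b: "b \<in> {0..pi}" and r: "strict_mono (r :: nat \<Rightarrow> nat)"
      and lim: "(\<lambda>k. Im (Ln (\<zeta> (r k) - of_real 0))) \<longlonglongrightarrow> b"
      using angle_conv[of \<zeta>] \<zeta> by blast
    have "filterlim (\<lambda>k. norm (\<zeta> (r k))) at_top sequentially"
      using filterlim_compose[OF top filterlim_subseq[OF r]] .
    from angle_tendsto_infinity[OF this \<zeta> lim]
    have "(\<lambda>k. ext (\<zeta> (r k))) \<longlonglongrightarrow> (b / pi) *\<^sub>R U 0 + (1 - b / pi) *\<^sub>R U n" .
    moreover have "(b / pi) *\<^sub>R U 0 + (1 - b / pi) *\<^sub>R U n \<in> contour"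
      using convex_comb_in_segment[of b "U 0" "U n"] b closed_segment_commute[of "U 0" "U n"]
      by (auto simp: contour_def)
    ultimately show thesis using that(2) r by blast
  qed
qed

lemma segment_subset_closed:
  fixes x y :: 'a
  assumes "closed C" and "\<And>b. 0 < b \<Longrightarrow> b < pi \<Longrightarrow> (b / pi) *\<^sub>R x + (1 - b / pi) *\<^sub>R y \<in> C"
  shows "closed_segment x y \<subseteq> C"
proof -
  let ?f = "\<lambda>t. (1 - t) *\<^sub>R x + t *\<^sub>R y"
  have "?f ` closure {0<..<1} \<subseteq> C"
  proof (rule image_closure_subset)
    show "continuous_on (closure {0<..<1}) ?f" by (intro continuous_intros)
    show "?f ` {0<..<1} \<subseteq> C"
    proof clarify
      fix t :: real assume "t \<in> {0<..<1}"
      then show "?f t \<in> C" using assms(2)[of "pi * (1 - t)"] by simp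
    qed
  qed (rule assms(1))
  then show ?thesis by (auto simp: closed_segment_def)
qed

text \<open>Along the ray in direction \<open>b\<close> from a jump point, or from a fixed point towards infinity, the
  undetermined angle is constant.\<close>

lemma contour_subset_closure: "contour \<subseteq> closure (ext ` {\<zeta>. Im \<zeta> > 0})"
proof -
  have limit: "q \<in> closure (ext ` {\<zeta>. Im \<zeta> > 0})"
    if "(\<lambda>k. ext (\<zeta> k)) \<longlonglongrightarrow> q" "\<And>k. Im (\<zeta> k) > 0" for \<zeta> q
    unfolding closure_sequential using that by (intro exI[of _ "\<lambda>k. ext (\<zeta> k)"]) auto
  have Ln_ray: "Im (Ln (of_real t * exp (\<i> * of_real b))) = b" if "t > 0" "0 < b" "b < pi" for t b
  proof -
    have "of_real t * exp (\<i> * of_real b) = exp (of_real (ln t) + \<i> * of_real b)"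
      using that by (simp add: exp_add exp_of_real)
    also have "Ln \<dots> = of_real (ln t) + \<i> * of_real b"
      using that by (intro Ln_exp) auto
    finally show ?thesis by simp
  qed
  have Im_ray: "Im (of_real t * exp (\<i> * of_real b)) > 0" if "t > 0" "0 < b" "b < pi" for t b
    using that by (simp add: Im_exp sin_gt_zero)
  have "closed_segment (U (m - 1)) (U m) \<subseteq> closure (ext ` {\<zeta>. Im \<zeta> > 0})" if m: "m \<in> {1..n}" for m
  proof (rule segment_subset_closed)
    fix b :: real assume b: "0 < b" "b < pi"
    define \<zeta> where "\<zeta> k = of_real (p m) + of_real (1 / real (Suc k)) * exp (\<i> * of_real b)" for k
    have up: "Im (\<zeta> k) > 0" for k
      using Im_ray[of "1 / real (Suc k)" b] b by (simp add: \<zeta>_def)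
    have "\<zeta> \<longlonglongrightarrow> of_real (p m) + of_real 0 * exp (\<i> * of_real b)"
      unfolding \<zeta>_def using LIMSEQ_Suc[OF lim_1_over_n[where 'a = real]]
      by (intro tendsto_intros) (simp add: inverse_eq_divide)
    then have lim: "\<zeta> \<longlonglongrightarrow> of_real (p m)" by simp
    have "angle m (\<zeta> k) = b" for k
      using m Ln_ray[of "1 / real (Suc k)" b] b by (simp add: angle_def \<zeta>_def)
    then have "(\<lambda>k. angle m (\<zeta> k)) \<longlonglongrightarrow> b" by simp
    from angle_tendsto_real[OF lim up m _ _ this] p[of _ m] m
    show "(b / pi) *\<^sub>R U (m - 1) + (1 - b / pi) *\<^sub>R U m \<in> closure (ext ` {\<zeta>. Im \<zeta> > 0})"
      by (intro limit[OF _ up]) auto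
  qed auto
  moreover have "closed_segment (U 0) (U n) \<subseteq> closure (ext ` {\<zeta>. Im \<zeta> > 0})"
  proof (rule segment_subset_closed)
    fix b :: real assume b: "0 < b" "b < pi"
    define \<zeta> where "\<zeta> k = of_real (real (Suc k)) * exp (\<i> * of_real b)" for k
    have up: "Im (\<zeta> k) > 0" for k
      unfolding \<zeta>_def using b by (intro Im_ray) auto
    have "norm (\<zeta> k) = real (Suc k)" for k by (simp add: \<zeta>_def norm_mult del: of_nat_Suc)
    then have top: "filterlim (\<lambda>k. norm (\<zeta> k)) at_top sequentially"
      using filterlim_compose[OF filterlim_real_sequentially filterlim_Suc] by simp
    have "Im (Ln (\<zeta> k - of_real 0)) = b" for k
      using Ln_ray[of "real (Suc k)" b] b by (simp add: \<zeta>_def)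
    then have "(\<lambda>k. Im (Ln (\<zeta> k - of_real 0))) \<longlonglongrightarrow> b" by simp
    from angle_tendsto_infinity[OF top up this]
    show "(b / pi) *\<^sub>R U 0 + (1 - b / pi) *\<^sub>R U n \<in> closure (ext ` {\<zeta>. Im \<zeta> > 0})"
      by (rule limit[OF _ up])
  qed auto
  ultimately show ?thesis
    unfolding contour_def closed_segment_commute[of "U n"] by blast
qed

end

section \<open>Derivatives and boundary behaviour of the extension\<close>

lemma open_upper: "open {\<zeta>. Im \<zeta> > 0}"
  by (intro open_Collect_less continuous_intros)

lemma convex_upper: "convex {\<zeta>. Im \<zeta> > 0}"
  by (rule convex_halfspace_Im_gt)

context step_extension
begin

text \<open>Summation by parts.\<close>

lemma ext_eq:
  assumes "Im \<zeta> > 0"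
  shows "ext \<zeta> = U 0 - (\<Sum>j\<in>{1..n}. (Im (Ln (of_real (p j) - \<zeta>)) / pi) *\<^sub>R (U j - U (j - 1)))"
proof -
  have "ext \<zeta> = U 0 + (\<Sum>j\<in>{1..m}. ((pi - angle j \<zeta>) / pi) *\<^sub>R (U j - U (j - 1)))
      - ((pi - angle (Suc m) \<zeta>) / pi) *\<^sub>R U m
      + (\<Sum>j\<in>{Suc m..n}. ((angle (Suc j) \<zeta> - angle j \<zeta>) / pi) *\<^sub>R U j)" if "m \<le> n" for m
    using that
  proof (induction m)
    case 0
    have "{..<Suc n} = insert 0 {1..n}" by auto
    then show ?case
      by (simp add: ext_def angle_def[of 0] diff_divide_distrib algebra_simps del: sum.lessThan_Suc)
  next
    case (Suc m)
    have "{Suc m..n} = insert (Suc m) {Suc (Suc m)..n}" using Suc.prems by auto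
    then show ?case using Suc by (simp add: diff_divide_distrib algebra_simps)
  qed
  from this[of n] have "ext \<zeta> = U 0 + (\<Sum>j\<in>{1..n}. ((pi - angle j \<zeta>) / pi) *\<^sub>R (U j - U (j - 1)))"
    by (simp add: angle_def[of "Suc n"])
  moreover have "pi - angle j \<zeta> = - Im (Ln (of_real (p j) - \<zeta>))" if "j \<in> {1..n}" for j
    using Ln_uminus_upper[of "\<zeta> - of_real (p j)"] that assms by (simp add: angle_def)
  ultimately show ?thesis by (simp add: sum_negf)
qed

lemma has_derivative_ext:
  assumes "Im \<zeta> > 0"
  shows "(ext has_derivative
    (\<lambda>v. - (\<Sum>j\<in>{1..n}. (Im (v / (\<zeta> - of_real (p j))) / pi) *\<^sub>R (U j - U (j - 1))))) (at \<zeta>)"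
proof -
  have Ln: "((\<lambda>z. Ln (of_real (p j) - z)) has_derivative (\<lambda>v. v / (\<zeta> - of_real (p j)))) (at \<zeta>)" for j
  proof -
    have nz: "of_real (p j) - \<zeta> \<notin> \<real>\<^sub>\<le>\<^sub>0" "of_real (p j) - \<zeta> \<noteq> 0"
      using assms by (auto simp: complex_nonpos_Reals_iff complex_eq_iff)
    then have "((\<lambda>z. Ln (of_real (p j) - z)) has_field_derivative 1 / (\<zeta> - of_real (p j))) (at \<zeta>)"
      by (auto intro!: derivative_eq_intros simp: field_simps)
    from has_field_derivative_imp_has_derivative[OF this] show ?thesis
      by (rule has_derivative_eq_rhs) (simp add: fun_eq_iff)
  qed
  have "((\<lambda>z. U 0 - (\<Sum>j\<in>{1..n}. (Im (Ln (of_real (p j) - z)) / pi) *\<^sub>R (U j - U (j - 1)))) has_derivative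
    (\<lambda>v. 0 - (\<Sum>j\<in>{1..n}. (Im (v / (\<zeta> - of_real (p j))) / pi) *\<^sub>R (U j - U (j - 1))))) (at \<zeta>)"
    by (intro has_derivative_diff has_derivative_const has_derivative_sum has_derivative_scaleR_left
        bounded_linear.has_derivative[OF bounded_linear_divide] bounded_linear.has_derivative[OF bounded_linear_Im] Ln)
  then have "((\<lambda>z. U 0 - (\<Sum>j\<in>{1..n}. (Im (Ln (of_real (p j) - z)) / pi) *\<^sub>R (U j - U (j - 1)))) has_derivative
    (\<lambda>v. - (\<Sum>j\<in>{1..n}. (Im (v / (\<zeta> - of_real (p j))) / pi) *\<^sub>R (U j - U (j - 1))))) (at \<zeta>)"
    by simp
  from this open_upper _ show ?thesis
    by (rule has_derivative_transform_within_open) (use assms ext_eq in auto)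
qed

lemma Ck_on_ext: "Ck_on k ext {\<zeta>. Im \<zeta> > 0}"
proof -
  have "Ck_on k (\<lambda>\<zeta>. (Im (Ln (of_real (p j) - \<zeta>)) / pi) *\<^sub>R (U j - U (j - 1))) {\<zeta>. Im \<zeta> > 0}" for j
  proof -
    have "(\<lambda>\<zeta>. Ln (of_real (p j) - \<zeta>)) holomorphic_on {\<zeta>. Im \<zeta> > 0}"
      by (intro holomorphic_intros) (auto simp: complex_nonpos_Reals_iff)
    moreover have "bounded_linear (\<lambda>z. (Im z / pi) *\<^sub>R (U j - U (j - 1)))"
      by (intro bounded_linear_scaleR_const bounded_linear_compose[OF bounded_linear_divide bounded_linear_Im])
    ultimately show ?thesis
      using Ck_on_bounded_linear[OF _ open_upper Ck_on_holomorphic[OF open_upper]] by blast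
  qed
  then have "Ck_on k (\<lambda>\<zeta>. - (\<Sum>j\<in>{1..n}. (Im (Ln (of_real (p j) - \<zeta>)) / pi) *\<^sub>R (U j - U (j - 1)))) {\<zeta>. Im \<zeta> > 0}"
    by (intro Ck_on_bounded_linear[OF bounded_linear_minus[OF bounded_linear_ident] open_upper] Ck_on_sum open_upper) auto
  from Ck_on_add[OF open_upper Ck_on_const[of k "U 0"] this]
  show ?thesis
    by (rule Ck_on_cong[OF open_upper, rotated]) (use ext_eq in auto)
qed

lemma ext_harmonic:
  assumes "Im \<zeta> > 0"
  shows "second_derivative ext \<zeta> 1 1 + second_derivative ext \<zeta> \<i> \<i> = 0"
proof -
  have D: "((\<lambda>y. - (\<Sum>j\<in>{1..n}. (Im (w / (y - of_real (p j))) / pi) *\<^sub>R (U j - U (j - 1)))) has_derivative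
    (\<lambda>v. - (\<Sum>j\<in>{1..n}. (Im (- w * v / (\<zeta> - of_real (p j))\<^sup>2) / pi) *\<^sub>R (U j - U (j - 1))))) (at \<zeta>)" for w
  proof -
    have "((\<lambda>y. w / (y - of_real (p j))) has_derivative (\<lambda>v. - w * v / (\<zeta> - of_real (p j))\<^sup>2)) (at \<zeta>)" for j
    proof -
      have "\<zeta> - of_real (p j) \<noteq> 0" using assms by (auto simp: complex_eq_iff)
      then have "((\<lambda>y. w / (y - of_real (p j))) has_field_derivative - w / (\<zeta> - of_real (p j))\<^sup>2) (at \<zeta>)"
        by (auto intro!: derivative_eq_intros simp: power2_eq_square)
      from has_field_derivative_imp_has_derivative[OF this] show ?thesis
      by (rule has_derivative_eq_rhs) (simp add: fun_eq_iff)
    qed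
    then show ?thesis
      by (intro has_derivative_minus has_derivative_sum has_derivative_scaleR_left
        bounded_linear.has_derivative[OF bounded_linear_divide] bounded_linear.has_derivative[OF bounded_linear_Im])
  qed
  have \<zeta>: "\<zeta> \<in> {\<zeta>. Im \<zeta> > 0}" using assms by simp
  have "second_derivative ext \<zeta> v w =
      - (\<Sum>j\<in>{1..n}. (Im (- w * v / (\<zeta> - of_real (p j))\<^sup>2) / pi) *\<^sub>R (U j - U (j - 1)))" for v w
    by (rule second_derivative_eqI[OF open_upper \<zeta> _ D]) (use has_derivative_ext in simp)
  then show ?thesis by (simp add: sum_negf)
qed

lemma bounded_ext: "bounded (ext ` {\<zeta>. Im \<zeta> > 0})"
proof (rule bounded_subset)
  show "bounded (convex hull (U ` {..n}))"
    by (intro bounded_convex_hull finite_imp_bounded) auto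
  show "ext ` {\<zeta>. Im \<zeta> > 0} \<subseteq> convex hull (U ` {..n})"
  proof clarify
    fix \<zeta> :: complex assume \<zeta>: "Im \<zeta> > 0"
    have "0 \<le> (angle (Suc j) \<zeta> - angle j \<zeta>) / pi" if "j \<in> {..<Suc n}" for j
      using angle_less[OF \<zeta>, of j] that by simp
    then show "ext \<zeta> \<in> convex hull (U ` {..n})"
      unfolding ext_def
      by (intro convex_sum convex_convex_hull sum_weights) (auto intro!: hull_inc)
  qed
qed

text \<open>A limit of values belongs to the image or, by \<open>ext_cluster\<close>, to the contour.\<close>

lemma closure_ext:
  assumes "ext ` {\<zeta>. Im \<zeta> > 0} \<inter> contour = {}"
  shows "closure (ext ` {\<zeta>. Im \<zeta> > 0}) - ext ` {\<zeta>. Im \<zeta> > 0} = contour"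
proof
  show "contour \<subseteq> closure (ext ` {\<zeta>. Im \<zeta> > 0}) - ext ` {\<zeta>. Im \<zeta> > 0}"
    using contour_subset_closure assms by blast
  show "closure (ext ` {\<zeta>. Im \<zeta> > 0}) - ext ` {\<zeta>. Im \<zeta> > 0} \<subseteq> contour"
  proof
    fix q assume q: "q \<in> closure (ext ` {\<zeta>. Im \<zeta> > 0}) - ext ` {\<zeta>. Im \<zeta> > 0}"
    from DiffD1[OF q] obtain y where y: "\<forall>k. y k \<in> ext ` {\<zeta>. Im \<zeta> > 0}" "y \<longlonglongrightarrow> q"
      unfolding closure_sequential by blast
    then have "\<forall>k. \<exists>\<zeta>. Im \<zeta> > 0 \<and> y k = ext \<zeta>" by blast
    then obtain \<zeta> where \<zeta>: "\<And>k. Im (\<zeta> k) > 0" "\<And>k. y k = ext (\<zeta> k)" by metis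
    have lim: "(\<lambda>k. ext (\<zeta> (r k))) \<longlonglongrightarrow> q" if "strict_mono r" for r
      using LIMSEQ_subseq_LIMSEQ[OF y(2) that] \<zeta>(2) by (simp add: o_def)
    show "q \<in> contour"
    proof (rule ext_cluster[of \<zeta>, OF \<zeta>(1)])
      fix r x assume r: "strict_mono (r :: nat \<Rightarrow> nat)" and x: "Im x > 0" "(\<lambda>k. \<zeta> (r k)) \<longlonglongrightarrow> x"
      have "isCont ext x" using has_derivative_continuous[OF has_derivative_ext[OF x(1)]] .
      from LIMSEQ_unique[OF isCont_tendsto_compose[OF this x(2)] lim[OF r]] have "ext x = q" .
      then show ?thesis using q x(1) by blast
    next
      fix r q' assume r: "strict_mono (r :: nat \<Rightarrow> nat)" and q': "q' \<in> contour" "(\<lambda>k. ext (\<zeta> (r k))) \<longlonglongrightarrow> q'"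
      from LIMSEQ_unique[OF q'(2) lim[OF r]] show ?thesis using q'(1) by simp
    qed
  qed
qed

text \<open>A sequence in the preimage that left every compact part of the half plane would have values that
  accumulate at the contour, whose image avoids \<open>K\<close>.\<close>

lemma proper_ext:
  assumes L: "bounded_linear L" and K: "compact K" and disj: "\<And>q. q \<in> contour \<Longrightarrow> L q \<notin> K"
  shows "compact ({\<zeta>. Im \<zeta> > 0} \<inter> (\<lambda>\<zeta>. L (ext \<zeta>)) -` K)"
  unfolding compact_def
proof (intro allI impI)
  fix \<zeta> :: "nat \<Rightarrow> complex" assume "\<forall>k. \<zeta> k \<in> {\<zeta>. Im \<zeta> > 0} \<inter> (\<lambda>\<zeta>. L (ext \<zeta>)) -` K"
  then have up: "Im (\<zeta> k) > 0" and inK: "L (ext (\<zeta> k)) \<in> K" for k by auto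
  have mem: "L q \<in> K" if "(\<lambda>k. ext (\<zeta> (r k))) \<longlonglongrightarrow> q" for r q
    using closed_sequentially[OF compact_imp_closed[OF K] _ bounded_linear.tendsto[OF L that]] inK by blast
  show "\<exists>l\<in>{\<zeta>. Im \<zeta> > 0} \<inter> (\<lambda>\<zeta>. L (ext \<zeta>)) -` K. \<exists>r. strict_mono r \<and> (\<zeta> \<circ> r) \<longlonglongrightarrow> l"
  proof (rule ext_cluster[of \<zeta>, OF up])
    fix r x assume r: "strict_mono (r :: nat \<Rightarrow> nat)" and x: "Im x > 0" "(\<lambda>k. \<zeta> (r k)) \<longlonglongrightarrow> x"
    have "isCont ext x" using has_derivative_continuous[OF has_derivative_ext[OF x(1)]] .
    from mem[OF isCont_tendsto_compose[OF this x(2)]] show ?thesis using r x by (auto simp: o_def)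
  next
    fix r q assume "q \<in> contour" "(\<lambda>k. ext (\<zeta> (r k))) \<longlonglongrightarrow> q"
    then show ?thesis using mem disj by blast
  qed
qed

end

section \<open>The hexagon\<close>

definition hex_root :: complex where "hex_root = exp (\<i> * of_real pi / 3)"

lemma hex_root_eq: "hex_root = Complex (1 / 2) (sqrt 3 / 2)"
  using cis_conv_exp[of "pi / 3"] by (simp add: hex_root_def cis.code cos_60 sin_60)

text \<open>The instances with \<open>Suc\<close> are the forms that small sums \<open>k + 1\<close> take in simplification.\<close>

lemma hex_vertex_fst:
  "fst (hex_vertex 1) = Complex (- 1 / 2) (- sqrt 3 / 2)" "fst (hex_vertex (Suc 0)) = Complex (- 1 / 2) (- sqrt 3 / 2)"
  "fst (hex_vertex 2) = Complex (1 / 2) (- sqrt 3 / 2)"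
  "fst (hex_vertex (Suc (Suc 0))) = Complex (1 / 2) (- sqrt 3 / 2)"
  "fst (hex_vertex 3) = 1" "fst (hex_vertex (Suc (Suc (Suc 0)))) = 1" "fst (hex_vertex 4) = Complex (1 / 2) (sqrt 3 / 2)"
  "fst (hex_vertex 5) = Complex (- 1 / 2) (sqrt 3 / 2)"
  "fst (hex_vertex 6) = - 1" "fst (hex_vertex 7) = Complex (- 1 / 2) (- sqrt 3 / 2)"
proof -
  let ?s = hex_root
  have pow: "fst (hex_vertex k) = - (?s ^ k)" for k
  proof -
    have "\<i> * of_nat k * of_real pi / 3 = of_nat k * (\<i> * of_real pi / 3)" by simp
    then show ?thesis by (simp only: hex_vertex_def fst_conv exp_of_nat_mult hex_root_def)
  qed
  have s2: "?s ^ 2 = Complex (- 1 / 2) (sqrt 3 / 2)" and s3: "?s ^ 3 = - 1"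
    by (simp_all add: hex_root_eq power2_eq_square power3_eq_cube complex_eq_iff field_simps)
  have "?s ^ 4 = ?s ^ 3 * ?s" "?s ^ 5 = ?s ^ 3 * ?s ^ 2"
    "?s ^ 6 = ?s ^ 3 * ?s ^ 3" "?s ^ 7 = ?s ^ 3 * ?s ^ 3 * ?s"
    by (simp_all add: eval_nat_numeral)
  then show "fst (hex_vertex 1) = Complex (- 1 / 2) (- sqrt 3 / 2)" "fst (hex_vertex (Suc 0)) = Complex (- 1 / 2) (- sqrt 3 / 2)"
  "fst (hex_vertex 2) = Complex (1 / 2) (- sqrt 3 / 2)"
  "fst (hex_vertex (Suc (Suc 0))) = Complex (1 / 2) (- sqrt 3 / 2)"
  "fst (hex_vertex 3) = 1" "fst (hex_vertex (Suc (Suc (Suc 0)))) = 1" "fst (hex_vertex 4) = Complex (1 / 2) (sqrt 3 / 2)"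
  "fst (hex_vertex 5) = Complex (- 1 / 2) (sqrt 3 / 2)"
  "fst (hex_vertex 6) = - 1" "fst (hex_vertex 7) = Complex (- 1 / 2) (- sqrt 3 / 2)"
    unfolding pow by (simp_all add: s2 s3) (simp_all add: hex_root_eq complex_eq_iff)
qed

lemma hex_vertex_snd: "snd (hex_vertex k) = (- 1) ^ k / 2"
  by (simp add: hex_vertex_def)

lemmas hex_vertex_simps = hex_vertex_fst hex_vertex_snd inner_complex_def

lemma atLeastAtMost_1_6: "{1..6::nat} = {1, 2, 3, 4, 5, 6}"
  by auto

text \<open>The sum of two adjacent vertices is normal to the edge between them.\<close>

definition hex_normal :: "nat \<Rightarrow> complex" where
  "hex_normal k = fst (hex_vertex k) + fst (hex_vertex (k + 1))"

definition hexagon :: "complex set" where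
  "hexagon = {z. \<forall>k\<in>{1..6}. hex_normal k \<bullet> z < 3 / 2}"

lemma open_hexagon: "open hexagon" and convex_hexagon: "convex hexagon"
proof -
  have eq: "hexagon = (\<Inter>k\<in>{1..6}. {z. hex_normal k \<bullet> z < 3 / 2})" by (auto simp: hexagon_def)
  show "open hexagon" unfolding eq by (intro open_INT ballI open_halfspace_lt) auto
  show "convex hexagon" unfolding eq by (intro convex_INT convex_halfspace_lt)
qed

lemma hex_normal_nonzero:
  assumes "k \<in> {1..6}"
  shows "hex_normal k \<noteq> 0"
  using assms unfolding atLeastAtMost_1_6 hex_normal_def
  by (auto simp: hex_vertex_fst complex_eq_iff)

lemma hex_normal_vertex:
  assumes "k \<in> {1..6}" "j \<in> {1..7}"
  shows "hex_normal k \<bullet> fst (hex_vertex j) \<le> 3 / 2"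
proof -
  have "{1..7::nat} = {1, 2, 3, 4, 5, 6, 7}" by auto
  then show ?thesis
    using assms unfolding atLeastAtMost_1_6 hex_normal_def
    by (auto simp: hex_vertex_simps algebra_simps)
qed

lemma hex_normal_opposite:
  assumes "k \<in> {1..6}"
  shows "\<exists>j\<in>{2, 5}. hex_normal k \<bullet> fst (hex_vertex j) < 3 / 2"
  using assms unfolding atLeastAtMost_1_6 hex_normal_def
  by (auto simp: hex_vertex_simps algebra_simps)

lemma hex_normal_edge:
  assumes "k \<in> {1..6}"
  shows "hex_normal k \<bullet> fst (hex_vertex k) = 3 / 2" "hex_normal k \<bullet> fst (hex_vertex (k + 1)) = 3 / 2"
  using assms unfolding atLeastAtMost_1_6 hex_normal_def
  by (auto simp: hex_vertex_simps algebra_simps)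

lemma hex_contour_cases:
  assumes "q \<in> hex_contour"
  obtains k t where "k \<in> {1..6}" "0 \<le> t" "t \<le> 1"
    "fst q = (1 - t) *\<^sub>R fst (hex_vertex k) + t *\<^sub>R fst (hex_vertex (k + 1))"
    "snd q = (1 - t) * snd (hex_vertex k) + t * snd (hex_vertex (k + 1))"
  using assms unfolding hex_contour_def closed_segment_def by fastforce

lemma hex_contour_not_over_hexagon:
  assumes "q \<in> hex_contour"
  shows "fst q \<notin> hexagon"
proof -
  from assms obtain k t where k: "k \<in> {1..6}"
    and q: "fst q = (1 - t) *\<^sub>R fst (hex_vertex k) + t *\<^sub>R fst (hex_vertex (k + 1))"
    by (rule hex_contour_cases)
  have "hex_normal k \<bullet> fst q = (1 - t) * (3 / 2) + t * (3 / 2)"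
    unfolding q inner_add_right inner_scaleR_right hex_normal_edge[OF k] by simp
  also have "\<dots> = 3 / 2" by (simp add: field_simps)
  finally have "\<not> hex_normal k \<bullet> fst q < 3 / 2" by simp
  then show ?thesis using k unfolding hexagon_def by blast
qed

text \<open>The functions \<open>a\<close>, \<open>b\<close>, \<open>- a - b\<close> are the products with the odd vertices and \<open>- a\<close>, \<open>- b\<close>,
  \<open>a + b\<close> those with the even ones. On an edge the largest of the first is attained at its odd end
  point and the largest of the others at the even one; moving along the edge trades the one
  for the other. So the contour is a graph over the boundary of the hexagon.\<close>

lemma hex_contour_height:
  assumes "q \<in> hex_contour"
  defines "a \<equiv> fst (hex_vertex 1) \<bullet> fst q" and "b \<equiv> fst (hex_vertex 3) \<bullet> fst q"
  shows "snd q = max (a + b) (max (- a) (- b)) - max a (max b (- a - b))"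
proof -
  from assms(1) obtain k t where k: "k \<in> {1..6}" and t: "0 \<le> t" "t \<le> 1"
    and q: "fst q = (1 - t) *\<^sub>R fst (hex_vertex k) + t *\<^sub>R fst (hex_vertex (k + 1))"
      "snd q = (1 - t) * snd (hex_vertex k) + t * snd (hex_vertex (k + 1))"
    by (rule hex_contour_cases)
  consider "k = 1" | "k = 2" | "k = 3" | "k = 4" | "k = 5" | "k = 6"
    using k unfolding atLeastAtMost_1_6 by blast
  then show ?thesis
  proof cases
  case 1
  have "a = 1 + (- 1 / 2) * t" "b = - 1 / 2 + (1) * t" "snd q = - 1 / 2 + (1) * t"
    unfolding a_def b_def q 1 inner_add_right inner_scaleR_right by (simp_all add: hex_vertex_simps algebra_simps diff_divide_distrib)
  then show ?thesis using t by (auto simp: max_def)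
next
  case 2
  have "a = 1 / 2 + (- 1) * t" "b = 1 / 2 + (1 / 2) * t" "snd q = 1 / 2 + (- 1) * t"
    unfolding a_def b_def q 2 inner_add_right inner_scaleR_right by (simp_all add: hex_vertex_simps algebra_simps diff_divide_distrib)
  then show ?thesis using t by (auto simp: max_def)
next
  case 3
  have "a = - 1 / 2 + (- 1 / 2) * t" "b = 1 + (- 1 / 2) * t" "snd q = - 1 / 2 + (1) * t"
    unfolding a_def b_def q 3 inner_add_right inner_scaleR_right by (simp_all add: hex_vertex_simps algebra_simps diff_divide_distrib)
  then show ?thesis using t by (auto simp: max_def)
next
  case 4
  have "a = - 1 + (1 / 2) * t" "b = 1 / 2 + (- 1) * t" "snd q = 1 / 2 + (- 1) * t"
    unfolding a_def b_def q 4 inner_add_right inner_scaleR_right by (simp_all add: hex_vertex_simps algebra_simps diff_divide_distrib)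
  then show ?thesis using t by (auto simp: max_def)
next
  case 5
  have "a = - 1 / 2 + (1) * t" "b = - 1 / 2 + (- 1 / 2) * t" "snd q = - 1 / 2 + (1) * t"
    unfolding a_def b_def q 5 inner_add_right inner_scaleR_right by (simp_all add: hex_vertex_simps algebra_simps diff_divide_distrib)
  then show ?thesis using t by (auto simp: max_def)
next
  case 6
  have "a = 1 / 2 + (1 / 2) * t" "b = - 1 + (1 / 2) * t" "snd q = 1 / 2 + (- 1) * t"
    unfolding a_def b_def q 6 inner_add_right inner_scaleR_right by (simp_all add: hex_vertex_simps algebra_simps diff_divide_distrib)
  then show ?thesis using t by (auto simp: max_def)
  qed
qed

lemma inj_on_fst_hex_contour: "inj_on fst hex_contour"
  by (rule inj_onI) (auto simp: prod_eq_iff hex_contour_height)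

definition hex_pole :: "nat \<Rightarrow> real" where
  "hex_pole j = (if j = 1 then - 2 else if j = 2 then - 1 else if j = 3 then - 1 / 2 else if j = 4 then 0 else 1)"

text \<open>Along the real line the vertices are met in decreasing order of their index, starting
  with \<open>hex_vertex 7 = hex_vertex 1\<close> at \<open>- \<infinity>\<close>.\<close>

interpretation hex: step_extension 5 hex_pole "\<lambda>j. hex_vertex (7 - j)"
proof
  show "hex_pole i < hex_pole j" if "1 \<le> i" "i < j" "j \<le> 5" for i j
  proof -
    have "i \<in> {1, 2, 3, 4}" "j \<in> {1, 2, 3, 4, 5}" using that by auto
    then show ?thesis using that(2) by (auto simp: hex_pole_def)
  qed
qed simp

lemma hex_contour_eq: "hex.contour = hex_contour"
proof -
  have eq: "{1..6::nat} = insert 1 ((\<lambda>j. 7 - j) ` {1..5})" by (auto simp: image_iff) presburger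
  have "hex_vertex 7 = hex_vertex 1" by (simp add: prod_eq_iff hex_vertex_simps)
  then have "hex_contour = closed_segment (hex_vertex 1) (hex_vertex 2)
      \<union> (\<Union>j\<in>{1..5}. closed_segment (hex_vertex (7 - j)) (hex_vertex (7 - j + 1)))"
    unfolding hex_contour_def eq by (simp add: numeral_2_eq_2)
  moreover have "7 - j + 1 = 7 - (j - 1)" if "j \<in> {1..5}" for j :: nat using that by auto
  ultimately show ?thesis
    using \<open>hex_vertex 7 = hex_vertex 1\<close>
    by (simp add: hex.contour_def closed_segment_commute Un_commute)
qed

lemma fst_ext_in_hexagon:
  assumes "Im \<zeta> > 0"
  shows "fst (hex.ext \<zeta>) \<in> hexagon"
  unfolding hexagon_def
proof (intro CollectI ballI)
  fix k :: nat assume k: "k \<in> {1..6}"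
  obtain j where j: "j \<in> {2, 5}" "hex_normal k \<bullet> fst (hex_vertex j) < 3 / 2"
    using hex_normal_opposite[OF k] by blast
  have "linear (\<lambda>q :: complex \<times> real. hex_normal k \<bullet> fst q)"
    by (rule linearI) (simp_all add: inner_add_right)
  then show "hex_normal k \<bullet> fst (hex.ext \<zeta>) < 3 / 2"
    by (rule hex.ext_in_half_space[OF assms, where i = "7 - j"])
       (use j hex_normal_vertex[OF k] in auto)
qed

section \<open>The Weierstrass data\<close>

lemma hex_root_square: "hex_root * hex_root = hex_root - 1"
  by (simp add: hex_root_eq complex_eq_iff field_simps)

lemma cnj_hex_root: "cnj hex_root = 1 - hex_root"
  by (simp add: hex_root_eq complex_eq_iff)

lemma exp_hex_root:
  "exp (\<i> * of_real pi / 3) = hex_root" "exp (- \<i> * of_real pi / 3) = 1 - hex_root"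
  "\<i> * exp (\<i> * of_real pi / 6) = hex_root - 1" "\<i> * exp (- \<i> * of_real pi / 6) = hex_root"
  "exp (- \<i> * (2 * of_real pi / 3)) = - hex_root"
proof -
  show "exp (\<i> * of_real pi / 3) = hex_root" by (simp add: hex_root_def)
  have "exp (- \<i> * of_real pi / 3) = cnj hex_root" by (simp add: hex_root_def exp_cnj)
  then show m: "exp (- \<i> * of_real pi / 3) = 1 - hex_root" by (simp only: cnj_hex_root)
  have "exp (\<i> * of_real pi / 6) = Complex (sqrt 3 / 2) (1 / 2)"
    using cis_conv_exp[of "pi / 6"] by (simp add: cis.code cos_30 sin_30)
  then show "\<i> * exp (\<i> * of_real pi / 6) = hex_root - 1"
    by (simp add: hex_root_eq complex_eq_iff)
  have "exp (- \<i> * of_real pi / 6) = Complex (sqrt 3 / 2) (- 1 / 2)"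
    using cis_conv_exp[of "- pi / 6"] by (simp add: cis.code cos_30 sin_30)
  then show "\<i> * exp (- \<i> * of_real pi / 6) = hex_root"
    by (simp add: hex_root_eq complex_eq_iff)
  have "exp (- \<i> * (2 * of_real pi / 3)) = exp (- \<i> * of_real pi / 3) * exp (- \<i> * of_real pi / 3)"
  proof -
    have "- \<i> * (2 * complex_of_real pi / 3) = - \<i> * of_real pi / 3 + - \<i> * of_real pi / 3" by simp
    then show ?thesis by (simp only: exp_add)
  qed
  also have "\<dots> = - hex_root" unfolding m using hex_root_square by (simp add: algebra_simps)
  finally show "exp (- \<i> * (2 * of_real pi / 3)) = - hex_root" .
qed

definition pole_product :: "complex \<Rightarrow> complex" where
  "pole_product z = (z + 2) * (z + 1) * (z + 1 / 2) * z * (z - 1)"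

lemma pole_product_nonzero:
  assumes "Im z = 0 \<Longrightarrow> Re z < - 2"
  shows "pole_product z \<noteq> 0"
proof -
  have "z + 2 \<noteq> 0" "z + 1 \<noteq> 0" "z + 1 / 2 \<noteq> 0" "z \<noteq> 0" "z - 1 \<noteq> 0"
    using assms by (auto simp: complex_eq_iff)
  then show ?thesis by (simp add: pole_product_def)
qed

text \<open>Modulo \<open>s\<^sup>2 = s - 1\<close>, which says that \<open>s\<close> is a primitive sixth root of unity, the numerators of \<open>f\<close>
  and \<open>g\<close> are the same perfect square. The values \<open>s - 1, s, 1, 1 - s, - s\<close> are the directions of
  the edges of the hexagon.\<close>

lemma partial_fractions_hex:
  fixes s z :: complex
  assumes s: "s * s = s - 1" and z: "pole_product z \<noteq> 0"
  shows "(s - 1) / (z + 2) + s / (z + 1) + 1 / (z + 1 / 2) + (1 - s) / z - s / (z - 1)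
      = (z + 1 - s) ^ 4 / pole_product z"
    and "1 / (z + 2) - 1 / (z + 1) + 1 / (z + 1 / 2) - 1 / z + 1 / (z - 1)
      = (z + 1 - s)\<^sup>2 * (z + s)\<^sup>2 / pole_product z"
    and "2 / 3 * ((s - 1) * (1 / (z - 1)) - 1 / 2 * (1 / (z + 1 / 2)) - s * (1 / (z + 2)))
      = - (z + 1 - s)\<^sup>2 / ((z - 1) * (z + 1 / 2) * (z + 2))"
    and "- 1 + 1 / z * s - 1 / (z + 1) * (1 - s) = - (z + 1 - s)\<^sup>2 / (z * (z + 1))"
proof -
  have nz: "z + 2 \<noteq> 0" "z + 1 \<noteq> 0" "z + 1 / 2 \<noteq> 0" "z \<noteq> 0" "z - 1 \<noteq> 0"
    using z by (auto simp: pole_product_def)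
  \<comment> \<open>The name \<open>h\<close> keeps fractions out of the polynomial identities.\<close>
  define h where "h = z + 1 / 2"
  have h: "h \<noteq> 0" "2 * z = 2 * h - 1" using nz by (auto simp: h_def)
  have cancel: "(a * (z + 1) * h * z * (z - 1) + b * (z + 2) * h * z * (z - 1)
      + c * (z + 2) * (z + 1) * z * (z - 1) + d * (z + 2) * (z + 1) * h * (z - 1)
      + e * (z + 2) * (z + 1) * h * z) / pole_product z
      = a / (z + 2) + b / (z + 1) + c / h + d / z + e / (z - 1)" for a b c d e
    unfolding pole_product_def h_def[symmetric] add_divide_distrib using nz h(1) by simp
  have "(z + 1 - s) ^ 4 = (s - 1) * (z + 1) * h * z * (z - 1) + s * (z + 2) * h * z * (z - 1)
      + 1 * (z + 2) * (z + 1) * z * (z - 1) + (1 - s) * (z + 2) * (z + 1) * h * (z - 1)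
      + (- s) * (z + 2) * (z + 1) * h * z"
    using s h(2) by algebra
  then show "(s - 1) / (z + 2) + s / (z + 1) + 1 / (z + 1 / 2) + (1 - s) / z - s / (z - 1)
      = (z + 1 - s) ^ 4 / pole_product z"
    unfolding h_def[symmetric] using cancel[of "s - 1" s 1 "1 - s" "- s"] by simp
  have "(z + 1 - s)\<^sup>2 * (z + s)\<^sup>2 = 1 * (z + 1) * h * z * (z - 1) + (- 1) * (z + 2) * h * z * (z - 1)
      + 1 * (z + 2) * (z + 1) * z * (z - 1) + (- 1) * (z + 2) * (z + 1) * h * (z - 1)
      + 1 * (z + 2) * (z + 1) * h * z"
    using s h(2) by algebra
  then show "1 / (z + 2) - 1 / (z + 1) + 1 / (z + 1 / 2) - 1 / z + 1 / (z - 1)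
      = (z + 1 - s)\<^sup>2 * (z + s)\<^sup>2 / pole_product z"
    unfolding h_def[symmetric] using cancel[of 1 "- 1" 1 "- 1" 1] by simp
  have "2 / 3 * ((s - 1) * (1 / (z - 1)) - 1 / 2 * (1 / h) - s * (1 / (z + 2)))
      = (2 * ((s - 1) * (h * (z + 2))) - (z - 1) * (z + 2) - 2 * (s * ((z - 1) * h))) / (3 * ((z - 1) * h * (z + 2)))"
  proof -
    have "2 / 3 * ((s - 1) * (1 / a) - 1 / 2 * (1 / h) - s * (1 / c))
      = (2 * ((s - 1) * (h * c)) - a * c - 2 * (s * (a * h))) / (3 * (a * h * c))"
      if "a \<noteq> 0" "c \<noteq> 0" for a c
      using that h(1) by (simp add: field_simps)
    then show ?thesis using nz by blast
  qed
  also have "2 * ((s - 1) * (h * (z + 2))) - (z - 1) * (z + 2) - 2 * (s * ((z - 1) * h)) = 3 * (- (z + 1 - s)\<^sup>2)"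
    using s h(2) by algebra
  finally show "2 / 3 * ((s - 1) * (1 / (z - 1)) - 1 / 2 * (1 / (z + 1 / 2)) - s * (1 / (z + 2)))
      = - (z + 1 - s)\<^sup>2 / ((z - 1) * (z + 1 / 2) * (z + 2))"
    unfolding h_def[symmetric] by (simp only: mult_divide_mult_cancel_left_if) simp
  have "- 1 + 1 / z * s - 1 / (z + 1) * (1 - s) = (- (z * (z + 1)) + s * (z + 1) - z * (1 - s)) / (z * (z + 1))"
    using nz by (simp add: field_simps)
  also have "- (z * (z + 1)) + s * (z + 1) - z * (1 - s) = - (z + 1 - s)\<^sup>2"
    using s by algebra
  finally show "- 1 + 1 / z * s - 1 / (z + 1) * (1 - s) = - (z + 1 - s)\<^sup>2 / (z * (z + 1))" .
qed


lemma atLeastAtMost_1_5: "{1..5::nat} = {1, 2, 3, 4, 5}"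
  by auto

lemma hex_vertex_root:
  "fst (hex_vertex 2) = 1 - hex_root" "fst (hex_vertex 3) = 1" "fst (hex_vertex 4) = hex_root"
  "fst (hex_vertex 5) = hex_root - 1" "fst (hex_vertex 6) = - 1" "fst (hex_vertex 7) = - hex_root"
  by (simp_all add: hex_vertex_fst hex_root_eq complex_eq_iff)

text \<open>The residues of \<open>f g\<close> and \<open>f\<close> times the conjugate of \<open>g\<close> are the differences of consecutive
  vertices.\<close>

lemma hex_residues_horizontal:
  assumes "pole_product z \<noteq> 0"
  shows "(\<Sum>j\<in>{1..5}. (fst (hex_vertex (7 - j)) - fst (hex_vertex (7 - (j - 1)))) / (z - of_real (hex_pole j)))
    = (z + 1 - hex_root) ^ 4 / pole_product z"
  unfolding partial_fractions_hex(1)[OF hex_root_square assms, symmetric] atLeastAtMost_1_5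
  by (simp add: hex_pole_def hex_vertex_root hex_root_square algebra_simps)

lemma hex_residues_vertical:
  assumes "pole_product z \<noteq> 0"
  shows "(\<Sum>j\<in>{1..5}. of_real (snd (hex_vertex (7 - j)) - snd (hex_vertex (7 - (j - 1)))) / (z - of_real (hex_pole j)))
    = (z + 1 - hex_root)\<^sup>2 * (z + hex_root)\<^sup>2 / pole_product z"
  unfolding partial_fractions_hex(2)[OF hex_root_square assms, symmetric] atLeastAtMost_1_5
  by (simp add: hex_pole_def hex_vertex_snd algebra_simps)

lemma cnj_pole_product: "cnj (pole_product z) = pole_product (cnj z)"
  by (simp add: pole_product_def)

lemma hex_residues_conjugate:
  assumes "pole_product z \<noteq> 0"
  shows "(\<Sum>j\<in>{1..5}. cnj (fst (hex_vertex (7 - j)) - fst (hex_vertex (7 - (j - 1)))) / (z - of_real (hex_pole j)))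
    = (z + hex_root) ^ 4 / pole_product z"
proof -
  have "pole_product (cnj z) \<noteq> 0" using assms by (metis cnj_pole_product complex_cnj_zero_iff)
  from arg_cong[OF hex_residues_horizontal[OF this], of cnj]
  show ?thesis by (simp add: cnj_pole_product cnj_hex_root)
qed

lemma f_Hex_g_Hex:
  assumes "pole_product z \<noteq> 0"
  shows "f_Hex z * g_Hex z = (z + 1 - hex_root) ^ 4 / pole_product z"
    and "f_Hex z * g_Hex_bar z = (z + 1 - hex_root)\<^sup>2 * (z + hex_root)\<^sup>2 / pole_product z"
proof -
  have f: "f_Hex z = - (z + 1 - hex_root)\<^sup>2 / ((z - 1) * (z + 1 / 2) * (z + 2))"
    unfolding f_Hex_def exp_hex_root by (rule partial_fractions_hex(3)[OF hex_root_square assms])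
  have g: "g_Hex z = - (z + 1 - hex_root)\<^sup>2 / (z * (z + 1))" if "pole_product z \<noteq> 0" for z
    unfolding g_Hex_def exp_hex_root by (rule partial_fractions_hex(4)[OF hex_root_square that])
  have "pole_product (cnj z) \<noteq> 0" using assms by (metis cnj_pole_product complex_cnj_zero_iff)
  from g[OF this] have gb: "g_Hex_bar z = - (z + hex_root)\<^sup>2 / (z * (z + 1))"
    by (simp add: g_Hex_bar_def cnj_hex_root)
  have prod: "- a / ((z - 1) * (z + 1 / 2) * (z + 2)) * (- b / (z * (z + 1))) = (a * b) / pole_product z" for a b
    by (simp add: pole_product_def mult_ac)
  show "f_Hex z * g_Hex z = (z + 1 - hex_root) ^ 4 / pole_product z"
    unfolding f g[OF assms] prod by (simp flip: power_add)
  show "f_Hex z * g_Hex_bar z = (z + 1 - hex_root)\<^sup>2 * (z + hex_root)\<^sup>2 / pole_product z"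
    unfolding f gb prod ..
qed

text \<open>The primitive is a combination of branches of \<open>Ln (p j - z)\<close> whose cuts are the half lines to the right
  of the poles. These branches take conjugate values at conjugate points, so that only the imaginary parts
  of the logarithms remain.\<close>

lemma contour_integral_simple_poles:
  fixes p :: "'j \<Rightarrow> real" and c :: "'j \<Rightarrow> complex"
  assumes \<gamma>: "valid_path \<gamma>" "pathstart \<gamma> = cnj \<zeta>" "pathfinish \<gamma> = \<zeta>" and J: "finite J"
    and slit: "\<And>z j. z \<in> path_image \<gamma> \<Longrightarrow> j \<in> J \<Longrightarrow> of_real (p j) - z \<notin> \<real>\<^sub>\<le>\<^sub>0"
    and f: "\<And>z. z \<in> path_image \<gamma> \<Longrightarrow> f z = (\<Sum>j\<in>J. c j / (z - of_real (p j)))"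
  shows "contour_integral \<gamma> f = 2 * \<i> * (\<Sum>j\<in>J. of_real (Im (Ln (of_real (p j) - \<zeta>))) * c j)"
proof -
  define F where "F z = (\<Sum>j\<in>J. c j * Ln (of_real (p j) - z))" for z
  have "(F has_field_derivative f z) (at z within path_image \<gamma>)" if z: "z \<in> path_image \<gamma>" for z
  proof -
    have "((\<lambda>z. c j * Ln (of_real (p j) - z)) has_field_derivative c j / (z - of_real (p j))) (at z within path_image \<gamma>)"
      if "j \<in> J" for j
    proof -
      have "of_real (p j) - z \<noteq> 0" using slit[OF z that] by auto
      then show ?thesis
        using slit[OF z that] by (auto intro!: derivative_eq_intros simp: field_simps)
    qed
    then show ?thesis unfolding F_def f[OF z] by (intro DERIV_sum)
  qed
  from contour_integral_primitive[OF this \<gamma>(1) subset_refl]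
  have "contour_integral \<gamma> f = F \<zeta> - F (cnj \<zeta>)"
    unfolding \<gamma>(2,3) by (rule contour_integral_unique)
  also have "\<dots> = (\<Sum>j\<in>J. 2 * \<i> * (of_real (Im (Ln (of_real (p j) - \<zeta>))) * c j))"
    unfolding F_def sum_subtractf[symmetric]
  proof (rule sum.cong[OF refl])
    fix j assume j: "j \<in> J"
    have "\<zeta> \<in> path_image \<gamma>" using \<gamma>(3) pathfinish_in_path_image by metis
    from cnj_Ln[OF slit[OF this j]]
    have "Ln (of_real (p j) - cnj \<zeta>) = cnj (Ln (of_real (p j) - \<zeta>))" by simp
    moreover have "w - cnj w = 2 * \<i> * of_real (Im w)" for w by (simp add: complex_eq_iff)
    ultimately show "c j * Ln (of_real (p j) - \<zeta>) - c j * Ln (of_real (p j) - cnj \<zeta>)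
        = 2 * \<i> * (of_real (Im (Ln (of_real (p j) - \<zeta>))) * c j)"
      by (metis (no_types, lifting) mult.assoc mult.commute right_diff_distrib')
  qed
  finally show ?thesis by (simp only: sum_distrib_left)
qed

lemma admissible_contour_slit:
  assumes "admissible_contour \<zeta> \<gamma>" "z \<in> path_image \<gamma>"
  shows "j \<in> {1..5} \<Longrightarrow> of_real (hex_pole j) - z \<notin> \<real>\<^sub>\<le>\<^sub>0" and "pole_product z \<noteq> 0"
proof -
  have lt: "Re z < - 2" if "Im z = 0"
    using assms that unfolding admissible_contour_def path_image_def
    by (auto simp: complex_is_Real_iff)
  have pole: "- 2 \<le> hex_pole j" for j by (simp add: hex_pole_def)
  show "of_real (hex_pole j) - z \<notin> \<real>\<^sub>\<le>\<^sub>0"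
    using lt pole[of j] by (auto simp: complex_nonpos_Reals_iff)
  show "pole_product z \<noteq> 0"
    using lt by (rule pole_product_nonzero)
qed

lemma contour_integrals_eq_ext:
  assumes "admissible_contour \<zeta> \<gamma>" "Im \<zeta> > 0"
  shows "z_Hex \<gamma> = fst (hex.ext \<zeta>)" and "theta_Hex \<gamma> = of_real (snd (hex.ext \<zeta>))"
proof -
  note \<gamma> = assms(1)[unfolded admissible_contour_def]
  note slit = admissible_contour_slit[OF assms(1)]
  let ?L = "\<lambda>j. Im (Ln (of_real (hex_pole j) - \<zeta>))"
  have "contour_integral \<gamma> (\<lambda>z. f_Hex z * g_Hex z) = 2 * \<i> * (\<Sum>j\<in>{1..5}.
      of_real (?L j) * (fst (hex_vertex (7 - j)) - fst (hex_vertex (7 - (j - 1)))))"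
    by (rule contour_integral_simple_poles)
       (use \<gamma> slit f_Hex_g_Hex(1) hex_residues_horizontal in auto)
  moreover have "fst (hex.ext \<zeta>) = fst (hex_vertex 7) - (\<Sum>j\<in>{1..5}.
      of_real (?L j / pi) * (fst (hex_vertex (7 - j)) - fst (hex_vertex (7 - (j - 1)))))"
    unfolding hex.ext_eq[OF assms(2)] by (simp add: fst_sum scaleR_conv_of_real)
  ultimately show "z_Hex \<gamma> = fst (hex.ext \<zeta>)"
    unfolding z_Hex_def exp_hex_root hex_vertex_root
    by (simp add: sum_divide_distrib[symmetric] del: sum.cl_ivl_Suc)
  have "contour_integral \<gamma> (\<lambda>z. f_Hex z * g_Hex_bar z) = 2 * \<i> * (\<Sum>j\<in>{1..5}.
      of_real (?L j) * of_real (snd (hex_vertex (7 - j)) - snd (hex_vertex (7 - (j - 1)))))"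
    by (rule contour_integral_simple_poles)
       (use \<gamma> slit f_Hex_g_Hex(2) hex_residues_vertical in auto)
  moreover have "snd (hex.ext \<zeta>) = snd (hex_vertex 7) - (\<Sum>j\<in>{1..5}.
      (?L j / pi) * (snd (hex_vertex (7 - j)) - snd (hex_vertex (7 - (j - 1)))))"
    unfolding hex.ext_eq[OF assms(2)] by (simp add: snd_sum)
  ultimately show "theta_Hex \<gamma> = of_real (snd (hex.ext \<zeta>))"
    unfolding theta_Hex_def hex_vertex_snd
    by (simp add: sum_divide_distrib[symmetric] del: sum.cl_ivl_Suc)
qed

section \<open>The conformal parameterization\<close>

text \<open>The condition \<open>h h' = k\<^sup>2\<close> makes the quadratic differential of the pulled back metric vanish; what
  remains is a multiple of the flat metric.\<close>

lemma weierstrass_first_form: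
  fixes h h' k v w :: complex
  assumes "h * h' = k * k"
  shows "(v * h - cnj (v * h')) \<bullet> (w * h - cnj (w * h')) - 4 * (Im (v * k) * Im (w * k))
    = (norm h - norm h')\<^sup>2 * (v \<bullet> w)"
proof -
  have "norm h * norm h' = (norm k)\<^sup>2"
    using arg_cong[OF assms, of norm] by (simp add: norm_mult power2_eq_square)
  then have "(norm h - norm h')\<^sup>2 = (norm h)\<^sup>2 + (norm h')\<^sup>2 - 2 * (norm k)\<^sup>2"
    by (simp add: power2_diff)
  also have "\<dots> = (Re h)\<^sup>2 + (Im h)\<^sup>2 + ((Re h')\<^sup>2 + (Im h')\<^sup>2) - 2 * ((Re k)\<^sup>2 + (Im k)\<^sup>2)"
    by (simp add: cmod_power2)
  finally have n: "(norm h - norm h')\<^sup>2 = (Re h)\<^sup>2 + (Im h)\<^sup>2 + ((Re h')\<^sup>2 + (Im h')\<^sup>2) - 2 * ((Re k)\<^sup>2 + (Im k)\<^sup>2)" .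
  have "(v * h - cnj (v * h')) \<bullet> (w * h - cnj (w * h')) - 4 * (Im (v * k) * Im (w * k))
    = (norm h - norm h')\<^sup>2 * (v \<bullet> w) - 2 * Re (v * w * (h * h' - k * k))"
    unfolding n by (simp add: inner_complex_def algebra_simps power2_eq_square)
  then show ?thesis using assms by simp
qed

lemma sum_Im_scaleR:
  fixes c r :: "'j \<Rightarrow> complex"
  shows "(\<Sum>j\<in>J. Im (v * c j) *\<^sub>R r j)
    = (v * (\<Sum>j\<in>J. r j * c j) - cnj (v * (\<Sum>j\<in>J. cnj (r j) * c j))) / (2 * \<i>)"
proof -
  have Im: "Im w *\<^sub>R x = (w * x - cnj (w * cnj x)) / (2 * \<i>)" for w x
    by (simp add: complex_eq_iff Re_divide Im_divide power2_eq_square algebra_simps)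
  have "(\<Sum>j\<in>J. Im (v * c j) *\<^sub>R r j)
      = (\<Sum>j\<in>J. (v * (r j * c j) - cnj (v * (cnj (r j) * c j))) / (2 * \<i>))"
    by (simp only: Im mult_ac)
  then show ?thesis
    by (simp only: sum_divide_distrib[symmetric] sum_subtractf sum_distrib_left cnj_sum)
qed

text \<open>The conformal factor does not vanish: its zeros are the points that have the same distance from the zero
  \<open>hex_root - 1\<close> of \<open>f\<close> and from its conjugate \<open>- hex_root\<close>, and these points are real.\<close>

lemma hex_conformal:
  assumes \<zeta>: "Im \<zeta> > 0"
  shows "\<exists>c>0. \<forall>v w. lorentz (dirderiv v hex.ext \<zeta>) (dirderiv w hex.ext \<zeta>) = c * (v \<bullet> w)"
proof -
  let ?r = "\<lambda>j. fst (hex_vertex (7 - j)) - fst (hex_vertex (7 - (j - 1)))"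
  let ?e = "\<lambda>j. snd (hex_vertex (7 - j)) - snd (hex_vertex (7 - (j - 1)))"
  have Q: "pole_product \<zeta> \<noteq> 0" by (rule pole_product_nonzero) (use \<zeta> in simp)
  define h where "h = (\<zeta> + 1 - hex_root) ^ 4 / pole_product \<zeta>"
  define h' where "h' = (\<zeta> + hex_root) ^ 4 / pole_product \<zeta>"
  define k where "k = (\<zeta> + 1 - hex_root)\<^sup>2 * (\<zeta> + hex_root)\<^sup>2 / pole_product \<zeta>"
  have hk: "h * h' = k * k"
    by (simp add: h_def h'_def k_def power2_eq_square power4_eq_xxxx)
  have "norm (\<zeta> + 1 - hex_root) < norm (\<zeta> + hex_root)"
  proof -
    have "(norm (\<zeta> + hex_root))\<^sup>2 = (norm (\<zeta> + 1 - hex_root))\<^sup>2 + 2 * sqrt 3 * Im \<zeta>"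
      unfolding cmod_power2 by (simp add: hex_root_eq power2_eq_square algebra_simps)
    moreover have "2 * sqrt 3 * Im \<zeta> > 0" using \<zeta> by simp
    ultimately have "(norm (\<zeta> + 1 - hex_root))\<^sup>2 < (norm (\<zeta> + hex_root))\<^sup>2" by linarith
    then show ?thesis by (rule power2_less_imp_less) simp
  qed
  then have "norm (\<zeta> + 1 - hex_root) ^ 4 < norm (\<zeta> + hex_root) ^ 4"
    by (intro power_strict_mono) auto
  then have "norm h < norm h'"
    unfolding h_def h'_def using Q by (simp add: norm_divide norm_power divide_strict_right_mono)
  then have c: "(norm h - norm h')\<^sup>2 / (4 * pi\<^sup>2) > 0" by simp
  have D: "dirderiv v hex.ext \<zeta> = - (1 / pi) *\<^sub>R (\<Sum>j\<in>{1..5}. Im (v * (1 / (\<zeta> - of_real (hex_pole j)))) *\<^sub>R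
      (hex_vertex (7 - j) - hex_vertex (7 - (j - 1))))" for v
    unfolding dirderiv_def frechet_derivative_at[OF hex.has_derivative_ext[OF \<zeta>], symmetric]
    by (simp add: scaleR_sum_right sum_negf)
  have fstD: "fst (dirderiv v hex.ext \<zeta>) = - (1 / pi) *\<^sub>R ((v * h - cnj (v * h')) / (2 * \<i>))" for v
  proof -
    have "fst (dirderiv v hex.ext \<zeta>) = - (1 / pi) *\<^sub>R
        (\<Sum>j\<in>{1..5}. Im (v * (1 / (\<zeta> - of_real (hex_pole j)))) *\<^sub>R ?r j)"
      unfolding D by (simp add: fst_sum)
    then show ?thesis
      unfolding sum_Im_scaleR h_def h'_def hex_residues_horizontal[OF Q, symmetric]
        hex_residues_conjugate[OF Q, symmetric] by simp
  qed
  have sndD: "snd (dirderiv v hex.ext \<zeta>) = - (1 / pi) * Im (v * k)" for v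
  proof -
    have "snd (dirderiv v hex.ext \<zeta>) = - (1 / pi) *
        (\<Sum>j\<in>{1..5}. Im (v * (1 / (\<zeta> - of_real (hex_pole j)))) * ?e j)"
      unfolding D by (simp add: snd_sum)
    also have "(\<Sum>j\<in>{1..5}. Im (v * (1 / (\<zeta> - of_real (hex_pole j)))) * ?e j)
        = Im (\<Sum>j\<in>{1..5}. v * (of_real (?e j) / (\<zeta> - of_real (hex_pole j))))"
    proof -
      have "Im (v * (1 / x)) * y = Im (v * (of_real y / x))" for x :: complex and y
        by (simp add: Im_divide field_simps)
      then show ?thesis by (simp only: Im_sum)
    qed
    also have "\<dots> = Im (v * k)"
      unfolding k_def hex_residues_vertical[OF Q, symmetric] by (simp only: sum_distrib_left)
    finally show ?thesis .
  qed
  have half: "(x / (2 * \<i>)) \<bullet> (y / (2 * \<i>)) = (x \<bullet> y) / 4" for x y :: complex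
    by (simp add: inner_complex_def Re_divide Im_divide power2_eq_square algebra_simps)
  have "lorentz (dirderiv v hex.ext \<zeta>) (dirderiv w hex.ext \<zeta>)
      = (norm h - norm h')\<^sup>2 / (4 * pi\<^sup>2) * (v \<bullet> w)" for v w
  proof -
    have "lorentz (dirderiv v hex.ext \<zeta>) (dirderiv w hex.ext \<zeta>)
      = ((v * h - cnj (v * h')) \<bullet> (w * h - cnj (w * h')) - 4 * (Im (v * k) * Im (w * k))) / (4 * pi\<^sup>2)"
      unfolding lorentz_def fstD sndD inner_scaleR_left inner_scaleR_right half
      by (simp add: power2_eq_square diff_divide_distrib)
    then show ?thesis unfolding weierstrass_first_form[OF hk] by simp
  qed
  then show ?thesis using c by blast
qed

text \<open>A vector in the kernel of the horizontal part would be mapped to a vertical vector, which is not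
  space-like.\<close>

lemma inj_of_conformal:
  assumes "\<phi> differentiable (at x)" "c > 0"
    and conf: "\<And>v w. lorentz (dirderiv v \<phi> x) (dirderiv w \<phi> x) = c * (v \<bullet> w)"
  shows "inj (\<lambda>v. fst (frechet_derivative \<phi> (at x) v))"
proof -
  have "linear (\<lambda>v. fst (frechet_derivative \<phi> (at x) v))"
    using assms(1) by (intro has_derivative_linear[OF has_derivative_fst]) (simp add: frechet_derivative_works)
  moreover have "v = 0" if "fst (frechet_derivative \<phi> (at x) v) = 0" for v
  proof (rule ccontr)
    assume "v \<noteq> 0"
    then have "c * (v \<bullet> v) > 0" using assms(2) by simp
    moreover have "lorentz (dirderiv v \<phi> x) (dirderiv v \<phi> x) \<le> 0"
      using that by (simp add: lorentz_def dirderiv_def)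
    ultimately show False using conf[of v v] by linarith
  qed
  ultimately show ?thesis by (simp add: linear_injective_0)
qed

definition hex_chart :: "complex \<Rightarrow> complex" where "hex_chart \<zeta> = fst (hex.ext \<zeta>)"

lemma smooth_on_hex_chart: "smooth_on hex_chart {\<zeta>. Im \<zeta> > 0}"
  unfolding smooth_on_def hex_chart_def
  by (intro allI Ck_on_bounded_linear[OF bounded_linear_fst open_upper] hex.Ck_on_ext)

lemma hex_ext_differentiable: "Im \<zeta> > 0 \<Longrightarrow> hex.ext differentiable (at \<zeta>)"
  using hex.has_derivative_ext by (auto simp: differentiable_def)

lemma inj_frechet_hex:
  assumes "Im \<zeta> > 0"
  shows "inj (frechet_derivative hex_chart (at \<zeta>))" "inj (frechet_derivative hex.ext (at \<zeta>))"
proof -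
  note d = hex_ext_differentiable[OF assms]
  obtain c where "c > 0" "\<And>v w. lorentz (dirderiv v hex.ext \<zeta>) (dirderiv w hex.ext \<zeta>) = c * (v \<bullet> w)"
    using hex_conformal[OF assms] by blast
  from inj_of_conformal[OF d this]
  have inj: "inj (\<lambda>v. fst (frechet_derivative hex.ext (at \<zeta>) v))" .
  have "(hex_chart has_derivative (\<lambda>v. fst (frechet_derivative hex.ext (at \<zeta>) v))) (at \<zeta>)"
    unfolding hex_chart_def using d by (intro has_derivative_fst) (simp add: frechet_derivative_works)
  from frechet_derivative_at[OF this] inj show "inj (frechet_derivative hex_chart (at \<zeta>))" by simp
  show "inj (frechet_derivative hex.ext (at \<zeta>))" using inj by (auto simp: inj_def)
qed

text \<open>The horizontal part is a local diffeomorphism, and it is proper because the limits of \<open>ext\<close> at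
  the boundary lie over the boundary of the hexagon.\<close>

lemma bij_betw_hex_chart: "bij_betw hex_chart {\<zeta>. Im \<zeta> > 0} hexagon"
proof (rule proper_local_homeomorphism_bij_betw)
  show "open {\<zeta>. Im \<zeta> > 0}" by (rule open_upper)
  show "connected {\<zeta>. Im \<zeta> > 0}" by (rule convex_connected[OF convex_upper])
  show "{\<zeta>. Im \<zeta> > 0} \<noteq> {}" by (auto intro: exI[of _ \<i>])
  show "open hexagon" by (rule open_hexagon)
  show "simply_connected hexagon" by (rule convex_imp_simply_connected[OF convex_hexagon])
  have C: "Ck_on k hex_chart {\<zeta>. Im \<zeta> > 0}" for k using smooth_on_hex_chart by (simp add: smooth_on_def)
  show "continuous_on {\<zeta>. Im \<zeta> > 0} hex_chart" using C[of 0] by simp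
  show "hex_chart ` {\<zeta>. Im \<zeta> > 0} \<subseteq> hexagon" using fst_ext_in_hexagon by (auto simp: hex_chart_def)
  show "\<exists>U. x \<in> U \<and> open U \<and> U \<subseteq> {\<zeta>. Im \<zeta> > 0} \<and> inj_on hex_chart U" if "x \<in> {\<zeta>. Im \<zeta> > 0}" for x
    by (rule locally_injective_plane[OF open_upper that C]) (use inj_frechet_hex that in simp)
  show "compact ({\<zeta>. Im \<zeta> > 0} \<inter> hex_chart -` K)" if "K \<subseteq> hexagon" "compact K" for K
    using hex.proper_ext[OF bounded_linear_fst that(2)] that(1) hex_contour_not_over_hexagon
    unfolding hex_contour_eq hex_chart_def[abs_def] by blast
qed

definition hex_inverse :: "complex \<Rightarrow> complex" where
  "hex_inverse = inv_into {\<zeta>. Im \<zeta> > 0} hex_chart"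

definition hex_height :: "complex \<Rightarrow> real" where
  "hex_height z = snd (hex.ext (hex_inverse z))"

lemma hex_inverse_chart: "Im \<zeta> > 0 \<Longrightarrow> hex_inverse (hex_chart \<zeta>) = \<zeta>"
  unfolding hex_inverse_def using bij_betw_hex_chart by (intro inv_into_f_f) (auto simp: bij_betw_def)

lemma hex_chart_image: "hex_chart ` {\<zeta>. Im \<zeta> > 0} = hexagon"
  using bij_betw_hex_chart by (simp add: bij_betw_def)

lemma hex_inverse_upper: "z \<in> hexagon \<Longrightarrow> Im (hex_inverse z) > 0"
  using hex_inverse_chart unfolding hex_chart_image[symmetric] by auto

lemma hex_chart_inverse: "z \<in> hexagon \<Longrightarrow> hex_chart (hex_inverse z) = z"
  using hex_inverse_chart unfolding hex_chart_image[symmetric] by auto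

lemma smooth_on_hex_inverse: "smooth_on hex_inverse hexagon"
  unfolding hex_chart_image[symmetric]
  by (rule smooth_on_inverse_plane[OF open_upper smooth_on_hex_chart])
     (use inj_frechet_hex hex_inverse_chart in auto)

lemma Ck_on_hex_height: "Ck_on k hex_height hexagon"
  unfolding hex_height_def[abs_def]
proof (rule Ck_on_bounded_linear[OF bounded_linear_snd open_hexagon])
  show "Ck_on k (\<lambda>z. hex.ext (hex_inverse z)) hexagon"
    by (rule Ck_on_compose[OF open_hexagon open_upper _ hex.Ck_on_ext])
       (use smooth_on_hex_inverse hex_inverse_upper in \<open>auto simp: smooth_on_def\<close>)
qed

lemma height_hex_ext: "Im \<zeta> > 0 \<Longrightarrow> height hex_height (hex.ext \<zeta>) = 0"
  using hex_inverse_chart by (simp add: height_def hex_height_def hex_chart_def)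

lemma hex_image_graph: "hex.ext ` {\<zeta>. Im \<zeta> > 0} = graph_over hexagon hex_height"
proof
  show "hex.ext ` {\<zeta>. Im \<zeta> > 0} \<subseteq> graph_over hexagon hex_height"
    using height_hex_ext fst_ext_in_hexagon by (auto simp: graph_over_iff)
  show "graph_over hexagon hex_height \<subseteq> hex.ext ` {\<zeta>. Im \<zeta> > 0}"
  proof
    fix q assume "q \<in> graph_over hexagon hex_height"
    then have q: "fst q \<in> hexagon" "snd q = hex_height (fst q)" by (auto simp: graph_over_iff height_def)
    have "hex.ext (hex_inverse (fst q)) = q"
      using hex_chart_inverse[OF q(1)] q(2) by (simp add: prod_eq_iff hex_chart_def hex_height_def)
    then show "q \<in> hex.ext ` {\<zeta>. Im \<zeta> > 0}" using hex_inverse_upper[OF q(1)] by force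
  qed
qed

text \<open>A point of the hexagon is the horizontal part of a point of the conformal harmonic
  parameterization.\<close>

lemma hex_graph_maximal:
  assumes z: "z \<in> hexagon"
  shows "norm (grad hex_height z) < 1" and "graph_operator hex_height z = 0"
proof -
  interpret surface_over hex.ext "{\<zeta>. Im \<zeta> > 0}" hexagon hex_height
    by (rule surface_over.intro[OF open_upper open_hexagon hex.Ck_on_ext Ck_on_hex_height])
       (use fst_ext_in_hexagon in auto)
  have up: "hex_inverse z \<in> {\<zeta>. Im \<zeta> > 0}" using hex_inverse_upper[OF z] by simp
  obtain c where c: "c > 0"
    "\<And>v w. lorentz (dirderiv v hex.ext (hex_inverse z)) (dirderiv w hex.ext (hex_inverse z)) = c * (v \<bullet> w)"
    using hex_conformal[OF hex_inverse_upper[OF z]] by blast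
  have "fst (hex.ext (hex_inverse z)) = z" using hex_chart_inverse[OF z] by (simp add: hex_chart_def)
  then show "norm (grad hex_height z) < 1" "graph_operator hex_height z = 0"
    using conformal_harmonic_graph_operator[OF up _ c(2,1) hex.ext_harmonic[OF hex_inverse_upper[OF z]]]
      height_hex_ext by auto
qed

lemma hex_homeomorphism:
  "homeomorphism {\<zeta>. Im \<zeta> > 0} (hex.ext ` {\<zeta>. Im \<zeta> > 0}) hex.ext (\<lambda>q. hex_inverse (fst q))"
proof (rule homeomorphismI)
  show "continuous_on {\<zeta>. Im \<zeta> > 0} hex.ext" using hex.Ck_on_ext[of 0] by simp
  have "continuous_on hexagon hex_inverse"
    using smooth_on_hex_inverse by (metis Ck_on.simps(1) smooth_on_def)
  then show "continuous_on (hex.ext ` {\<zeta>. Im \<zeta> > 0}) (\<lambda>q. hex_inverse (fst q))"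
    by (rule continuous_on_compose2) (use fst_ext_in_hexagon in \<open>auto intro: continuous_intros\<close>)
  show "(\<lambda>q. hex_inverse (fst q)) ` hex.ext ` {\<zeta>. Im \<zeta> > 0} \<subseteq> {\<zeta>. Im \<zeta> > 0}"
    using hex_inverse_chart by (auto simp: hex_chart_def)
  show "hex_inverse (fst (hex.ext x)) = x" if "x \<in> {\<zeta>. Im \<zeta> > 0}" for x
    using hex_inverse_chart that by (simp add: hex_chart_def)
  then show "hex.ext (hex_inverse (fst y)) = y" if "y \<in> hex.ext ` {\<zeta>. Im \<zeta> > 0}" for y
    using that by auto
qed auto

lemma hex_surface:
  defines "S \<equiv> graph_over hexagon hex_height"
  shows "spacelike_surface S" "zero_mean_curvature S" "has_boundary_contour S hex_contour"
proof -
  have "local_parameterization S {\<zeta>. Im \<zeta> > 0} hex.ext"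
    unfolding local_parameterization_def S_def hex_image_graph[symmetric]
    using open_upper hex.Ck_on_ext inj_frechet_hex(2) hex_homeomorphism by (auto simp: smooth_on_def)
  then have "regular_surface S"
    unfolding regular_surface_def S_def hex_image_graph[symmetric] by blast
  moreover have "spacelike_at \<phi> x" if "local_parameterization S W \<phi>" "x \<in> W" for W \<phi> x
    by (rule spacelike_graph[OF open_hexagon Ck_on_hex_height hex_graph_maximal(1)])
       (use that in \<open>auto simp: S_def\<close>)
  ultimately show "spacelike_surface S" by (auto simp: spacelike_surface_def)
  show "zero_mean_curvature S"
    unfolding S_def by (rule zero_mean_curvature_graph[OF open_hexagon Ck_on_hex_height hex_graph_maximal(2)])
  have "hex.ext ` {\<zeta>. Im \<zeta> > 0} \<inter> hex.contour = {}"
    unfolding hex_contour_eq using fst_ext_in_hexagon hex_contour_not_over_hexagon by blast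
  from hex.closure_ext[OF this]
  have "closure S - S = hex_contour" by (simp only: S_def hex_image_graph[symmetric] hex_contour_eq)
  moreover have "bounded S" unfolding S_def hex_image_graph[symmetric] by (rule hex.bounded_ext)
  moreover have "connected S"
    unfolding S_def hex_image_graph[symmetric]
    by (rule connected_continuous_image) (use hex.Ck_on_ext[of 0] convex_connected[OF convex_upper] in auto)
  ultimately show "has_boundary_contour S hex_contour" by (simp add: has_boundary_contour_def)
qed

lemma S_Hex_eq: "S_Hex = graph_over hexagon hex_height"
  unfolding S_Hex_def
proof (rule the_equality)
  show "spacelike_surface (graph_over hexagon hex_height) \<and> zero_mean_curvature (graph_over hexagon hex_height)
      \<and> has_boundary_contour (graph_over hexagon hex_height) hex_contour"
    using hex_surface by blast
  fix S assume S: "spacelike_surface S \<and> zero_mean_curvature S \<and> has_boundary_contour S hex_contour"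
  have "hex_contour \<noteq> {}" by (auto simp: hex_contour_def)
  then show "S = graph_over hexagon hex_height"
    by (intro spacelike_zero_mean_curvature_unique[OF open_hexagon hexagon_def hex_normal_nonzero
          Ck_on_hex_height hex_graph_maximal hex_surface(3) inj_on_fst_hex_contour])
       (use S in auto)
qed

theorem proposition1p5:
  fixes \<gamma> :: "complex \<Rightarrow> real \<Rightarrow> complex"
  assumes "\<And>\<zeta>. \<zeta> \<in> upper_half_plane \<Longrightarrow> admissible_contour \<zeta> (\<gamma> \<zeta>)"
  shows "(\<forall>\<zeta>\<in>upper_half_plane. theta_Hex (\<gamma> \<zeta>) \<in> \<real>) \<and>
         conformal_parameterization S_Hex (\<lambda>\<zeta>. (z_Hex (\<gamma> \<zeta>), Re (theta_Hex (\<gamma> \<zeta>))))"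
proof -
  define \<Phi> where "\<Phi> = (\<lambda>\<zeta>. (z_Hex (\<gamma> \<zeta>), Re (theta_Hex (\<gamma> \<zeta>))))"
  let ?U = "{\<zeta>. Im \<zeta> > 0}"
  have U: "upper_half_plane = ?U" by (simp add: upper_half_plane_def)
  have z: "z_Hex (\<gamma> \<zeta>) = fst (hex.ext \<zeta>)" and \<theta>: "theta_Hex (\<gamma> \<zeta>) = of_real (snd (hex.ext \<zeta>))"
    if "\<zeta> \<in> ?U" for \<zeta>
    using contour_integrals_eq_ext[of \<zeta> "\<gamma> \<zeta>"] assms that by (simp_all add: U)
  then have eq: "hex.ext \<zeta> = \<Phi> \<zeta>" if "\<zeta> \<in> ?U" for \<zeta> using that by (simp add: \<Phi>_def)
  have image: "\<Phi> ` ?U = S_Hex"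
    unfolding S_Hex_eq hex_image_graph[symmetric] using eq by force
  have inj: "inj_on \<Phi> ?U"
    using hex_inverse_chart eq by (intro inj_on_inverseI[of _ "\<lambda>q. hex_inverse (fst q)"]) (simp add: hex_chart_def)
  have diffeo: "diffeomorphism_onto ?U S_Hex \<Phi>"
    unfolding diffeomorphism_onto_def
  proof (intro conjI ballI)
    show "smooth_on \<Phi> ?U"
      by (rule smooth_on_cong[OF open_upper eq]) (auto simp: smooth_on_def hex.Ck_on_ext)
    show "bij_betw \<Phi> ?U S_Hex" using inj image by (simp add: bij_betw_def)
    fix p assume p: "p \<in> S_Hex"
    let ?V = "fst -` hexagon :: (complex \<times> real) set"
    have V: "open ?V" by (rule open_vimage_fst[OF open_hexagon])
    have "smooth_on (\<lambda>q. hex_inverse (fst q)) ?V"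
      by (rule smooth_on_compose[OF V open_hexagon _ smooth_on_hex_inverse])
         (use V in \<open>auto simp: smooth_on_def intro: Ck_on_linear_self bounded_linear_fst\<close>)
    moreover have "hex_inverse (fst q) = inv_into ?U \<Phi> q" if "q \<in> S_Hex" for q
    proof -
      obtain \<zeta> where \<zeta>: "\<zeta> \<in> ?U" "q = \<Phi> \<zeta>" using \<open>q \<in> S_Hex\<close> image by blast
      have "hex_inverse (fst (hex.ext \<zeta>)) = \<zeta>" using hex_inverse_chart \<zeta>(1) by (simp add: hex_chart_def)
      then have "hex_inverse (fst q) = \<zeta>" using eq[OF \<zeta>(1)] \<zeta>(2) by simp
      then show ?thesis using inv_into_f_f[OF inj \<zeta>(1)] \<zeta>(2) by simp
    qed
    moreover have "p \<in> ?V" using p by (simp add: S_Hex_eq graph_over_iff)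
    ultimately show "\<exists>V \<Psi>. open V \<and> p \<in> V \<and> smooth_on \<Psi> V \<and> (\<forall>q\<in>S_Hex \<inter> V. \<Psi> q = inv_into ?U \<Phi> q)"
      using V by (intro exI[of _ ?V] exI[of _ "\<lambda>q. hex_inverse (fst q)"]) auto
  qed
  have "\<exists>c>0. \<forall>v w. lorentz (dirderiv v \<Phi> \<zeta>) (dirderiv w \<Phi> \<zeta>) = c * (v \<bullet> w)" if \<zeta>: "\<zeta> \<in> ?U" for \<zeta>
  proof -
    have "frechet_derivative hex.ext (at \<zeta>) = frechet_derivative \<Phi> (at \<zeta>)"
      by (rule frechet_derivative_transform_within_open[OF hex_ext_differentiable open_upper \<zeta> eq])
         (use \<zeta> in auto)
    then have "dirderiv v \<Phi> \<zeta> = dirderiv v hex.ext \<zeta>" for v by (simp add: dirderiv_def)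
    then show ?thesis using hex_conformal \<zeta> by simp
  qed
  then have "conformal_parameterization S_Hex \<Phi>"
    using diffeo by (simp add: conformal_parameterization_def U)
  moreover have "\<forall>\<zeta>\<in>upper_half_plane. theta_Hex (\<gamma> \<zeta>) \<in> \<real>" using \<theta> by (simp add: U)
  ultimately show ?thesis by (simp add: \<Phi>_def)
qed

end
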